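(* Let $1\le p<\infty$. (1) Let $s>0$ be non-integer. For each $f\in L^1_{\mathrm{loc}}(\mathbb{R}^N)$, we have $$|f|_{W^{s,p}}<\infty\iff\mathscr{E}_{s,p}(f)<\infty.$$ (2) Let $s\ge1$ be an integer. For each $f\in W^{s,1}_{\mathrm{loc}}(\mathbb{R}^N)$, we have $$|f|_{W^{s,p}}<\infty\iff\mathscr{E}_{s,p}(f)<\infty.$$
   Context: $N\ge 2$ is an integer. For $f:\mathbb{R}^N\to\mathbb{R}$ measurable and $h\in\mathbb{R}^N$, $\Delta_h f(x)=f(x+h)-f(x)$ and $\Delta_h^{m+1}=\Delta_h\circ\Delta_h^m$. $\lfloor s\rfloor$ is the integer part of $s$, $\mathscr{H}^{N-1}$ is the $(N-1)$-dimensional Hausdorff measure, $\sigma_N=\mathscr{H}^{N-1}(\mathbb{S}^{N-1})$. Norms $\|\cdot\|_{L^p}$ take the value $\infty$ on measurable functions not in $L^p$. Semi-norms (with values in $[0,\infty]$). If $s>0$ is not an integer and $f\in L^1_{\mathrm{loc}}(\mathbb{R}^N)$, $|f|_{W^{s,p}}^p=\int_{\mathbb{R}^N}\frac{\|\Delta_h^{\lfloor s\rfloor+1}f\|_{L^p}^p}{|h|^{sp+N}}\,dh$. If $s\ge1$ is an integer and $f\in W^{s,1}_{\mathrm{loc}}(\mathbb{R}^N)$, $|f|_{W^{s,p}}^p=\int_{\mathbb{R}^N}\|D^s_xf\|^p\,dx$, where $D_x^sf$ is the $s$-linear form given by the $s$-th derivative of $f$ at $x$ and $\|\eta\|=\sup_{|x_1|\le1,\dots,|x_s|\le1}|\eta(x_1,\dots,x_s)|$.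 Affine energy. For $\xi\in\mathbb{S}^{N-1}$ put $I_f(\xi)=\int_0^\infty t^{-sp-1}\|\Delta^{\lfloor s\rfloor+1}_{t\xi}f\|_{L^p}^p\,dt$ if $s$ is not an integer, and $I_f(\xi)=\int_{\mathbb{R}^N}|\partial^s_\xi f(x)|^p\,dx$ if $s\ge1$ is an integer, where $\partial_\xi^sf(x)=D^s_xf(\xi,\dots,\xi)$. Then $$\mathscr{E}_{s,p}(f)=\sigma_N^{(N+sp)/(Np)}\Big(\int_{\mathbb{S}^{N-1}}I_f(\xi)^{-N/(sp)}\,d\mathscr{H}^{N-1}(\xi)\Big)^{-s/N},$$ with the conventions that a negative power of $0$ is $\infty$ and a negative power of $\infty$ is $0$. *)

theory Defs
  imports "HOL-Analysis.Analysis"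
begin

section \<open>Real powers and Lebesgue norms with values in \<open>[0,\<infinity>]\<close>\<close>

text \<open>A negative power of 0 is \<open>\<infinity>\<close> and a negative power of \<open>\<infinity>\<close> is 0; this differs from
  \<open>powr\<close> on the reals, where \<open>0 powr a = 0\<close> for every \<open>a\<close>.\<close>

definition epow :: "ennreal \<Rightarrow> real \<Rightarrow> ennreal" where
  "epow x a =
     (if a = 0 then 1
      else if x = 0 then (if a < 0 then \<infinity> else 0)
      else if x = \<infinity> then (if a < 0 then 0 else \<infinity>)
      else ennreal (enn2real x powr a))"

definition Lp_norm :: "real \<Rightarrow> ('a::euclidean_space \<Rightarrow> real) \<Rightarrow> ennreal" where
  "Lp_norm p f = epow (\<integral>\<^sup>+x. ennreal (\<bar>f x\<bar> powr p) \<partial>lebesgue) (1 / p)"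

section \<open>Local integrability, weak derivatives and local Sobolev spaces\<close>

definition L1_loc :: "('a::euclidean_space \<Rightarrow> real) set" where
  "L1_loc = {f. \<forall>K. compact K \<longrightarrow> f absolutely_integrable_on K}"

definition dir_deriv :: "'a::euclidean_space \<Rightarrow> ('a \<Rightarrow> real) \<Rightarrow> 'a \<Rightarrow> real" where
  "dir_deriv v f x = frechet_derivative f (at x) v"

primrec C_diff :: "nat \<Rightarrow> ('a::euclidean_space \<Rightarrow> real) \<Rightarrow> bool" where
  "C_diff 0 f \<longleftrightarrow> continuous_on UNIV f"
| "C_diff (Suc k) f \<longleftrightarrow> (\<forall>x. f differentiable (at x)) \<and> (\<forall>v. C_diff k (dir_deriv v f))"

definition test_functions :: "('a::euclidean_space \<Rightarrow> real) set" where
  "test_functions = {\<phi>. (\<forall>k. C_diff k \<phi>) \<and> compact (closure {x. \<phi> x \<noteq> 0})}"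

definition has_weak_deriv ::
    "'a::euclidean_space list \<Rightarrow> ('a \<Rightarrow> real) \<Rightarrow> ('a \<Rightarrow> real) \<Rightarrow> bool" where
  "has_weak_deriv bs f g \<longleftrightarrow>
     f \<in> L1_loc \<and> g \<in> L1_loc \<and>
     (\<forall>\<phi>\<in>test_functions.
        (\<integral>x. f x * foldr dir_deriv bs \<phi> x \<partial>lebesgue)
          = (-1) ^ length bs * (\<integral>x. g x * \<phi> x \<partial>lebesgue))"

definition W1_loc :: "nat \<Rightarrow> ('a::euclidean_space \<Rightarrow> real) set" where
  "W1_loc k = {f \<in> L1_loc. \<forall>bs. set bs \<subseteq> Basis \<and> length bs \<le> k \<longrightarrow> (\<exists>g. has_weak_deriv bs f g)}"

text \<open>A representative of the weak derivative, which is unique up to a null set.\<close>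

definition weak_partial :: "'a::euclidean_space list \<Rightarrow> ('a \<Rightarrow> real) \<Rightarrow> 'a \<Rightarrow> real" where
  "weak_partial bs f = (SOME g. has_weak_deriv bs f g)"

text \<open>\<open>weak_D k f x\<close> is the \<open>k\<close>-linear form given by the \<open>k\<close>-th weak derivative of \<open>f\<close> at \<open>x\<close>.
  Its arguments form a list of length \<open>k\<close>; the coefficients are the weak partial derivatives.\<close>

definition weak_D :: "nat \<Rightarrow> ('a::euclidean_space \<Rightarrow> real) \<Rightarrow> 'a \<Rightarrow> 'a list \<Rightarrow> real" where
  "weak_D k f x vs =
     (\<Sum>bs\<in>{bs. set bs \<subseteq> Basis \<and> length bs = k}.
        (\<Prod>i<k. vs ! i \<bullet> bs ! i) * weak_partial bs f x)"

definition form_norm :: "nat \<Rightarrow> ('a::euclidean_space list \<Rightarrow> real) \<Rightarrow> real" where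
  "form_norm k \<eta> = (SUP vs\<in>{vs. length vs = k \<and> (\<forall>v\<in>set vs. norm v \<le> 1)}. \<bar>\<eta> vs\<bar>)"

section \<open>Hausdorff measure\<close>

text \<open>The normalisation is such that the \<open>DIM('a)\<close>-dimensional measure is Lebesgue measure.
  The empty set is treated separately since \<open>0 ^ 0 = 1\<close>.\<close>

definition hausdorff_premeasure :: "nat \<Rightarrow> 'a::euclidean_space set \<Rightarrow> ennreal" where
  "hausdorff_premeasure d U =
     (if U = {} then 0 else ennreal (unit_ball_vol (real d) * (diameter U / 2) ^ d))"

text \<open>Boundedness of the covering sets is explicit because \<open>diameter\<close> is real-valued and
  meaningless on unbounded sets.\<close>

definition hausdorff_outer :: "nat \<Rightarrow> 'a::euclidean_space set \<Rightarrow> ennreal" where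
  "hausdorff_outer d A =
     (SUP \<delta>\<in>{0<..}.
        INF U\<in>{U :: nat \<Rightarrow> 'a set.
                  (\<forall>i. bounded (U i) \<and> diameter (U i) \<le> \<delta>) \<and> A \<subseteq> (\<Union>i. U i)}.
          (\<Sum>i. hausdorff_premeasure d (U i)))"

text \<open>The restriction of the outer measure to its Caratheodory-measurable sets.\<close>

definition hausdorff_measure :: "nat \<Rightarrow> 'a::euclidean_space measure" where
  "hausdorff_measure d =
     measure_of UNIV (lambda_system UNIV UNIV (hausdorff_outer d)) (hausdorff_outer d)"

section \<open>Fractional semi-norms and affine energies\<close>

definition diff_op :: "'a::euclidean_space \<Rightarrow> ('a \<Rightarrow> real) \<Rightarrow> 'a \<Rightarrow> real" where
  "diff_op h f x = f (x + h) - f x"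

definition W_seminorm :: "real \<Rightarrow> real \<Rightarrow> ('a::euclidean_space \<Rightarrow> real) \<Rightarrow> ennreal" where
  "W_seminorm s p f =
     epow (if s \<in> \<int>
           then \<integral>\<^sup>+x. ennreal (form_norm (nat \<lfloor>s\<rfloor>) (weak_D (nat \<lfloor>s\<rfloor>) f x) powr p) \<partial>lebesgue
           else \<integral>\<^sup>+h. epow (Lp_norm p ((diff_op h ^^ (nat \<lfloor>s\<rfloor> + 1)) f)) p
                       / ennreal (norm h powr (s * p + real DIM('a))) \<partial>lebesgue)
       (1 / p)"

definition direction_energy ::
    "real \<Rightarrow> real \<Rightarrow> ('a::euclidean_space \<Rightarrow> real) \<Rightarrow> 'a \<Rightarrow> ennreal" where
  "direction_energy s p f \<xi> =
     (if s \<in> \<int>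
      then \<integral>\<^sup>+x. ennreal (\<bar>weak_D (nat \<lfloor>s\<rfloor>) f x (replicate (nat \<lfloor>s\<rfloor>) \<xi>)\<bar> powr p) \<partial>lebesgue
      else \<integral>\<^sup>+t\<in>{0<..}. (ennreal (t powr (- s * p - 1))
              * epow (Lp_norm p ((diff_op (t *\<^sub>R \<xi>) ^^ (nat \<lfloor>s\<rfloor> + 1)) f)) p) \<partial>lebesgue)"

definition affine_energy :: "real \<Rightarrow> real \<Rightarrow> ('a::euclidean_space \<Rightarrow> real) \<Rightarrow> ennreal" where
  "affine_energy s p f =
     (let N = real DIM('a);
          H = (hausdorff_measure (DIM('a) - 1) :: 'a measure)
      in epow (emeasure H (sphere 0 1)) ((N + s * p) / (N * p))
         * epow (\<integral>\<^sup>+\<xi>\<in>sphere 0 1. epow (direction_energy s p f \<xi>) (- N / (s * p)) \<partial>H) (- s / N))"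

end

theory Submission
  imports Defs
begin

text \<open>
  Let \<open>N\<close> be the dimension and \<open>I(\<xi>)\<close> the energy of \<open>f\<close> in direction \<open>\<xi>\<close>. It makes sense for every
  vector \<open>\<xi>\<close> and is homogeneous of degree \<open>sp\<close>. By the conventions on negative powers,
  the affine energy is finite exactly if \<open>\<integral> I(\<xi>) powr (-N/(sp))\<close> over the sphere is nonzero, that is, if
  \<open>I\<close> is finite on a set of directions of positive Hausdorff measure. So the claim is that one
  has \<open>I < \<infinity>\<close> on a non-null set of directions exactly if the full semi-norm is finite.

  \<^item> Null sets of directions. Hausdorff measure on the sphere is compared with the Lebesgue measure of
    \<open>annular_cone A\<close>, the part of the cone over \<open>A\<close> that lies between the spheres of radii 1 and 2. They
    have the same (Borel) null sets, so by homogeneity the affine energy is finite if and only if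
    \<open>{x. 1 < norm x < 2, I x < \<infinity>}\<close> has positive Lebesgue measure (\<open>affine_integral_finite_iff\<close>).
    For one direction a set of small diameter \<open>d\<close> on the sphere spans a cone of volume \<open>O(d^(N-1))\<close>;
    for the other the Vitali covering lemma is used.

  \<^item> Finite semi-norm implies finite energy. For non-integer \<open>s\<close>, Tonelli and scaling show that the
    integral of \<open>I\<close> over the annulus is a constant times the \<open>p\<close>-th power of the semi-norm
    (\<open>ray_energy_annulus_integral\<close>, a substitute for polar coordinates). For integer \<open>s\<close>, \<open>I\<close> is even
    bounded on the sphere by that power.

  \<^item> Finite energy implies finite semi-norm. Let \<open>E\<close> be a set of positive measure on which \<open>I\<close> is
    finite. By a Steinhaus argument (\<open>exists_common_translate\<close>), every finite configuration of
    sufficiently small vectors has a translate \<open>y + h\<^sub>1, \<dots>, y + h\<^sub>n\<close> inside \<open>E\<close>. It therefore suffices to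
    express the quantity to be estimated, for arbitrary \<open>y\<close>, through quantities in the
    directions \<open>y + h\<^sub>i\<close>. For non-integer \<open>s\<close> this is the identity
    \<open>diff_op_power_decomposition\<close>: the \<open>m\<close>-th difference with step \<open>h\<close> is an alternating sum of translates of
    \<open>m\<close>-th differences with steps \<open>y - c\<^sub>S h\<close>. For integer \<open>s\<close> it is the polarisation formula
    \<open>diag_form_polarization\<close>, which recovers the partial derivatives of order \<open>s\<close> from the
    pure directional derivatives.

  The polarisation formula needs symmetric coefficients. Weak partial derivatives of \<open>f\<close> that differ in the order of
  differentiation agree almost everywhere (\<open>weak_deriv_unique_perm\<close>), because test functions
  have commuting derivatives and are numerous enough to determine a locally integrable function.
\<close>

section \<open>Borel sets and metric outer measures\<close>

text \<open>\<open>outer_measure_space\<close> asserts countable subadditivity for disjoint families; disjointification removes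
  the restriction.\<close>

lemma outer_measure_spaceD:
  fixes \<mu> :: "'a set \<Rightarrow> ennreal"
  assumes "outer_measure_space UNIV \<mu>"
  shows "\<mu> {} = 0" "A \<subseteq> B \<Longrightarrow> \<mu> A \<le> \<mu> B" "\<mu> (A \<union> B) \<le> \<mu> A + \<mu> B"
    and "\<mu> (\<Union>i::nat. X i) \<le> (\<Sum>i. \<mu> (X i))"
proof -
  have pos: "positive UNIV \<mu>" and inc: "increasing UNIV \<mu>" and csa: "countably_subadditive UNIV \<mu>"
    using assms by (auto simp: outer_measure_space_def)
  show e: "\<mu> {} = 0" using pos by (simp add: positive_def)
  show "A \<subseteq> B \<Longrightarrow> \<mu> A \<le> \<mu> B" using inc by (auto simp: increasing_def)
  show c: "\<mu> (\<Union>i::nat. X i) \<le> (\<Sum>i. \<mu> (X i))" for X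
  proof -
    have "\<mu> (\<Union>i. X i) = \<mu> (\<Union>i. disjointed X i)"
      by (simp add: UN_disjointed_eq)
    also have "\<dots> \<le> (\<Sum>i. \<mu> (disjointed X i))"
      using csa disjoint_family_disjointed[of X] by (auto simp: countably_subadditive_def)
    also have "\<dots> \<le> (\<Sum>i. \<mu> (X i))"
      using inc disjointed_subset[of X] by (intro suminf_le) (auto simp: increasing_def)
    finally show ?thesis .
  qed
  show "\<mu> (A \<union> B) \<le> \<mu> A + \<mu> B"
  proof -
    have "\<mu> (A \<union> B) = \<mu> (\<Union>i. binaryset A B i)" by (simp add: UN_binaryset_eq)
    also have "\<dots> \<le> (\<Sum>i. \<mu> (binaryset A B i))" by (rule c)
    also have "\<dots> = \<mu> A + \<mu> B" by (rule suminf_binaryset_eq[of \<mu>, OF e])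
    finally show ?thesis .
  qed
qed

text \<open>An outer measure with this property is called metric; Caratheodory's criterion then makes all Borel sets measurable.\<close>

definition metric_additive :: "('a::metric_space set \<Rightarrow> ennreal) \<Rightarrow> bool" where
  "metric_additive \<mu> \<longleftrightarrow>
     (\<forall>A B e. e > 0 \<longrightarrow> (\<forall>x\<in>A. \<forall>y\<in>B. e \<le> dist x y) \<longrightarrow> \<mu> A + \<mu> B \<le> \<mu> (A \<union> B))"

lemma metric_additiveD:
  "metric_additive \<mu> \<Longrightarrow> e > 0 \<Longrightarrow> (\<And>x y. x \<in> A \<Longrightarrow> y \<in> B \<Longrightarrow> e \<le> dist x y) \<Longrightarrow> \<mu> A + \<mu> B \<le> \<mu> (A \<union> B)"
  unfolding metric_additive_def by blast

text \<open>Shells around \<open>C\<close> whose indices have the same parity are at positive distance from each other, so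
  metric additivity applies to them. Consecutive shells touch, which is why parities are separated.\<close>

lemma metric_outer_measure_shell_sum:
  fixes \<mu> :: "'a::metric_space set \<Rightarrow> ennreal" and A C :: "'a set"
  assumes oms: "outer_measure_space UNIV \<mu>" and add: "metric_additive \<mu>"
  defines "R \<equiv> \<lambda>k. {x\<in>A. 1 / (real k + 2) \<le> infdist x C \<and> infdist x C < 1 / (real k + 1)}"
  shows "(\<Sum>k<n. \<mu> (R (2 * k + r))) \<le> \<mu> A"
proof -
  have "(\<Sum>k<n. \<mu> (R (2 * k + r))) \<le> \<mu> (\<Union>k<n. R (2 * k + r))"
  proof (induction n)
    case 0
    then show ?case by simp
  next
    case (Suc n)
    let ?e = "1 / (real (2 * n + r) + 1) - 1 / (real (2 * n + r) + 2)"
    have "(\<Sum>k<Suc n. \<mu> (R (2 * k + r))) \<le> \<mu> (\<Union>k<n. R (2 * k + r)) + \<mu> (R (2 * n + r))"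
      using Suc by (simp add: add_right_mono)
    also have "\<dots> \<le> \<mu> ((\<Union>k<n. R (2 * k + r)) \<union> R (2 * n + r))"
    proof (cases "n = 0")
      case True
      then show ?thesis using outer_measure_spaceD(1)[OF oms] by simp
    next
      case n: False
      define N where "N = real (2 * n + r)"
      have N: "N \<ge> 2" using n by (simp add: N_def)
      show ?thesis
      proof (rule metric_additiveD[OF add])
        show "1 / N - 1 / (N + 1) > 0" using N by (simp add: field_simps add_pos_pos)
        fix x y assume "x \<in> (\<Union>k<n. R (2 * k + r))" and y: "y \<in> R (2 * n + r)"
        then obtain k where k: "k < n" "x \<in> R (2 * k + r)" by blast
        have "real (2 * k + r) + 2 \<le> N" using k(1) by (simp add: N_def)
        then have "1 / N \<le> 1 / (real (2 * k + r) + 2)" by (intro divide_left_mono) (use N in auto)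
        also have "\<dots> \<le> infdist x C" using k(2) by (simp add: R_def)
        also have "\<dots> \<le> infdist y C + dist x y" by (rule infdist_triangle)
        also have "infdist y C < 1 / (N + 1)" using y by (simp add: R_def N_def)
        finally show "1 / N - 1 / (N + 1) \<le> dist x y" by simp
      qed
    qed
    also have "(\<Union>k<n. R (2 * k + r)) \<union> R (2 * n + r) = (\<Union>k<Suc n. R (2 * k + r))"
      by (auto simp: lessThan_Suc)
    finally show ?case .
  qed
  also have "\<dots> \<le> \<mu> A"
    by (rule outer_measure_spaceD(2)[OF oms]) (auto simp: R_def)
  finally show ?thesis .
qed

lemma ennreal_suminf_tail_null:
  fixes f :: "nat \<Rightarrow> ennreal"
  assumes "(\<Sum>k. f k) < \<infinity>"
  shows "(\<lambda>n. \<Sum>k. f (k + n)) \<longlonglongrightarrow> 0"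
proof -
  have fin: "(\<Sum>k. f k) \<noteq> top" using assms by simp
  have part: "(\<Sum>k<n. f k) \<le> (\<Sum>k. f k)" for n by (rule sum_le_suminf) auto
  have eq: "(\<Sum>k. f (k + n)) = (\<Sum>k. f k) - (\<Sum>k<n. f k)" for n
  proof -
    have "(\<Sum>k. f k) = (\<Sum>k. f (k + n)) + (\<Sum>k<n. f k)" by (rule suminf_offset) simp
    moreover have "(\<Sum>k<n. f k) \<noteq> top" using part[of n] fin by (metis neq_top_trans)
    ultimately show ?thesis by simp
  qed
  have "(\<lambda>n. (\<Sum>k. f k) - (\<Sum>k<n. f k)) \<longlonglongrightarrow> (\<Sum>k. f k) - (\<Sum>k. f k)"
    by (intro tendsto_diff_ennreal tendsto_const summable_LIMSEQ fin) simp
  then show ?thesis using fin by (simp add: eq)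
qed

text \<open>Caratheodory's criterion. The points of \<open>A\<close> outside \<open>C\<close> are exhausted by the sets \<open>T n\<close> of points at
  distance at least \<open>1/(n+1)\<close> from \<open>C\<close>, on which \<open>\<mu>\<close> is additive relative to \<open>C \<inter> A\<close>. What \<open>T n\<close> misses is covered by
  the shells of index at least \<open>n\<close>, and their total measure is the tail of a convergent series.\<close>

lemma closed_in_lambda_system:
  fixes \<mu> :: "'a::metric_space set \<Rightarrow> ennreal"
  assumes oms: "outer_measure_space UNIV \<mu>" and add: "metric_additive \<mu>" and C: "closed C"
  shows "C \<in> lambda_system UNIV UNIV \<mu>"
proof -
  note om = outer_measure_spaceD[OF oms]
  have main: "\<mu> (C \<inter> A) + \<mu> (A - C) \<le> \<mu> A" for A
  proof (cases "C = {} \<or> \<mu> A = \<infinity>")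
    case True
    then show ?thesis using om(1) by auto
  next
    case False
    then have Cne: "C \<noteq> {}" and fin: "\<mu> A < \<infinity>" by (auto simp: less_top)
    define R where "R = (\<lambda>k. {x\<in>A. 1 / (real k + 2) \<le> infdist x C \<and> infdist x C < 1 / (real k + 1)})"
    define T where "T = (\<lambda>n. {x\<in>A. 1 / (real n + 1) \<le> infdist x C})"
    have shell: "(\<Sum>k<n. \<mu> (R (2 * k + r))) \<le> \<mu> A" for n r
      unfolding R_def by (rule metric_outer_measure_shell_sum[OF oms add])
    have "(\<Sum>k<2 * n. \<mu> (R k)) = (\<Sum>k<n. \<mu> (R (2 * k + 0))) + (\<Sum>k<n. \<mu> (R (2 * k + 1)))" for n
      by (induction n) (auto simp: ac_simps)
    then have le2: "(\<Sum>k<2 * n. \<mu> (R k)) \<le> \<mu> A + \<mu> A" for n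
      using add_mono[OF shell[where r=0] shell[where r=1]] by simp
    have "(\<Sum>k<n. \<mu> (R k)) \<le> \<mu> A + \<mu> A" for n
    proof -
      have "(\<Sum>k<n. \<mu> (R k)) \<le> (\<Sum>k<2 * n. \<mu> (R k))" by (rule sum_mono2) auto
      also note le2
      finally show ?thesis .
    qed
    then have "(\<Sum>k. \<mu> (R k)) \<le> \<mu> A + \<mu> A" by (intro suminf_le_const summableI)
    also have "\<dots> < \<infinity>" using fin by simp
    finally have tail: "(\<lambda>n. \<Sum>k. \<mu> (R (k + n))) \<longlonglongrightarrow> 0" by (rule ennreal_suminf_tail_null)
    have bound: "\<mu> (C \<inter> A) + \<mu> (A - C) \<le> \<mu> A + (\<Sum>k. \<mu> (R (k + n)))" for n
    proof -
      have "A - C \<subseteq> T n \<union> (\<Union>k. R (k + n))"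
      proof
        fix x assume x: "x \<in> A - C"
        then have pos: "infdist x C > 0"
          using C Cne in_closed_iff_infdist_zero[OF C Cne, of x] infdist_nonneg[of x C] by force
        show "x \<in> T n \<union> (\<Union>k. R (k + n))"
        proof (cases "x \<in> T n")
          case nT: False
          define P where "P k \<longleftrightarrow> 1 / (real k + 1) \<le> infdist x C" for k :: nat
          obtain m where "inverse (real (Suc m)) < infdist x C" using reals_Archimedean[OF pos] by blast
          then have ex: "P m" by (simp add: P_def field_simps)
          define l where "l = (LEAST k. P k)"
          have Pl: "P l" unfolding l_def by (rule LeastI[of P, OF ex])
          have mono: "P k" if "P j" "j \<le> k" for j k
          proof -
            have "1 / (real k + 1) \<le> 1 / (real j + 1)" using that(2) by (intro divide_left_mono) auto
            then show ?thesis using that(1) by (simp add: P_def)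
          qed
          have "\<not> P n" using nT x by (simp add: T_def P_def)
          then have nl: "n < l" using mono[OF Pl, of n] by linarith
          then obtain k where k: "l = Suc (k + n)" by (metis add.commute less_imp_Suc_add)
          have "\<not> P (k + n)" using not_less_Least[of "k + n" P] k l_def by simp
          then have "x \<in> R (k + n)" using Pl x k by (simp add: R_def P_def ac_simps)
          then show ?thesis by blast
        qed simp
      qed
      then have "\<mu> (A - C) \<le> \<mu> (T n) + \<mu> (\<Union>k. R (k + n))"
        using om(2,3) order_trans by meson
      also have "\<dots> \<le> \<mu> (T n) + (\<Sum>k. \<mu> (R (k + n)))" by (intro add_left_mono om(4))
      finally have "\<mu> (C \<inter> A) + \<mu> (A - C) \<le> \<mu> (C \<inter> A) + \<mu> (T n) + (\<Sum>k. \<mu> (R (k + n)))"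
        by (metis add.assoc add_left_mono)
      also have "\<mu> (C \<inter> A) + \<mu> (T n) \<le> \<mu> ((C \<inter> A) \<union> T n)"
      proof (rule metric_additiveD[OF add])
        show "1 / (real n + 1) > 0" by simp
        fix x y assume "x \<in> C \<inter> A" "y \<in> T n"
        then have "1 / (real n + 1) \<le> infdist y C" "infdist y C \<le> dist y x"
          by (auto simp: T_def intro: infdist_le)
        then show "1 / (real n + 1) \<le> dist x y" by (simp add: dist_commute)
      qed
      also have "\<mu> ((C \<inter> A) \<union> T n) \<le> \<mu> A" by (intro om(2)) (auto simp: T_def)
      finally show ?thesis by (simp add: add_right_mono)
    qed
    have "(\<lambda>n. \<mu> A + (\<Sum>k. \<mu> (R (k + n)))) \<longlonglongrightarrow> \<mu> A + 0"
      by (intro tendsto_add tendsto_const tail)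
    then show ?thesis
      using bound by (intro LIMSEQ_le_const[where X="\<lambda>n. \<mu> A + (\<Sum>k. \<mu> (R (k + n)))"]) auto
  qed
  have "\<mu> (C \<inter> A) + \<mu> ((UNIV - C) \<inter> A) = \<mu> A" for A
  proof (rule antisym)
    have e: "(UNIV - C) \<inter> A = A - C" by auto
    show "\<mu> (C \<inter> A) + \<mu> ((UNIV - C) \<inter> A) \<le> \<mu> A" using main[of A] e by simp
    have "\<mu> A \<le> \<mu> ((C \<inter> A) \<union> ((UNIV - C) \<inter> A))" by (rule om(2)) auto
    also have "\<dots> \<le> \<mu> (C \<inter> A) + \<mu> ((UNIV - C) \<inter> A)" by (rule om(3))
    finally show "\<mu> A \<le> \<mu> (C \<inter> A) + \<mu> ((UNIV - C) \<inter> A)" .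
  qed
  then show ?thesis by (simp add: lambda_system_def)
qed

lemma borel_subset_lambda_system:
  fixes \<mu> :: "'a::metric_space set \<Rightarrow> ennreal"
  assumes oms: "outer_measure_space UNIV \<mu>" and add: "metric_additive \<mu>"
  shows "sets borel \<subseteq> lambda_system UNIV UNIV \<mu>"
proof -
  interpret sigma_algebra UNIV "UNIV :: 'a set set" using sigma_algebra_Pow[of UNIV] by simp
  have "measure_space UNIV (lambda_system UNIV UNIV \<mu>) \<mu>"
    by (rule caratheodory_lemma[OF oms])
  then have "sigma_algebra UNIV (lambda_system UNIV UNIV \<mu>)" by (simp add: measure_space_def)
  then have "sigma_sets UNIV (Collect closed) \<subseteq> lambda_system UNIV UNIV \<mu>"
    by (rule sigma_algebra.sigma_sets_subset) (auto intro: closed_in_lambda_system[OF oms add])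
  then show ?thesis by (simp add: borel_eq_closed)
qed

section \<open>The Hausdorff measure as a Borel measure\<close>

text \<open>The inner infimum in the definition of \<open>hausdorff_outer\<close>, usually written \<open>H\<^sup>d\<^sub>\<delta>\<close>.\<close>

definition hausdorff_content :: "nat \<Rightarrow> real \<Rightarrow> 'a::euclidean_space set \<Rightarrow> ennreal" where
  "hausdorff_content d \<delta> A =
     (INF U\<in>{U :: nat \<Rightarrow> 'a set. (\<forall>i. bounded (U i) \<and> diameter (U i) \<le> \<delta>) \<and> A \<subseteq> (\<Union>i. U i)}.
        (\<Sum>i. hausdorff_premeasure d (U i)))"

lemma hausdorff_outer_eq_SUP_content:
  "hausdorff_outer d A = (SUP \<delta>\<in>{0<..}. hausdorff_content d \<delta> A)"
  by (simp add: hausdorff_outer_def hausdorff_content_def)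

lemma hausdorff_content_le:
  assumes "\<And>i. bounded (U i)" "\<And>i. diameter (U i) \<le> \<delta>" "A \<subseteq> (\<Union>i::nat. U i)"
  shows "hausdorff_content d \<delta> A \<le> (\<Sum>i. hausdorff_premeasure d (U i))"
  unfolding hausdorff_content_def using assms by (intro INF_lower) auto

lemma hausdorff_content_less_cover:
  assumes "hausdorff_content d \<delta> A < c"
  obtains U :: "nat \<Rightarrow> 'a::euclidean_space set"
  where "\<And>i. bounded (U i)" "\<And>i. diameter (U i) \<le> \<delta>" "A \<subseteq> (\<Union>i. U i)"
    "(\<Sum>i. hausdorff_premeasure d (U i)) < c"
  using assms unfolding hausdorff_content_def INF_less_iff by auto

lemma hausdorff_content_mono: "A \<subseteq> B \<Longrightarrow> hausdorff_content d \<delta> A \<le> hausdorff_content d \<delta> B"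
  unfolding hausdorff_content_def by (intro INF_superset_mono) auto

lemma hausdorff_content_antimono: "\<epsilon> \<le> \<delta> \<Longrightarrow> hausdorff_content d \<delta> A \<le> hausdorff_content d \<epsilon> A"
  unfolding hausdorff_content_def by (intro INF_superset_mono) (auto intro: order_trans)

lemma hausdorff_content_le_outer: "\<delta> > 0 \<Longrightarrow> hausdorff_content d \<delta> A \<le> hausdorff_outer d A"
  unfolding hausdorff_outer_eq_SUP_content by (intro SUP_upper) auto

lemma hausdorff_content_UN_le:
  "hausdorff_content d \<delta> (\<Union>i. A i) \<le> (\<Sum>i::nat. hausdorff_content d \<delta> (A i))"
proof (rule ennreal_le_epsilon)
  let ?O = "hausdorff_content d \<delta>" and ?f = "hausdorff_premeasure d"
  fix e :: real assume "0 < e" "(\<Sum>n. ?O (A n)) < top"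
  then have *: "?O (A n) < ?O (A n) + ennreal (e * (1/2) ^ Suc n)" for n
    by (auto simp add: less_top dest!: ennreal_suminf_lessD)
  have "\<exists>U. (\<forall>i. bounded (U i) \<and> diameter (U i) \<le> \<delta>) \<and> A n \<subseteq> (\<Union>i::nat. U i)
      \<and> (\<Sum>i. ?f (U i)) \<le> ?O (A n) + ennreal (e * (1/2) ^ Suc n)" for n
    by (rule hausdorff_content_less_cover[OF *[of n]]) (metis less_imp_le)
  then obtain B where B: "\<And>n i. bounded (B n i) \<and> diameter (B n i) \<le> \<delta>" "\<And>n. A n \<subseteq> (\<Union>i::nat. B n i)"
      "\<And>n. (\<Sum>i. ?f (B n i)) \<le> ?O (A n) + ennreal (e * (1/2) ^ Suc n)"
    by metis
  define V where "V = case_prod B \<circ> prod_decode"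
  have "(\<Union>i. A i) \<subseteq> (\<Union>i. V i)"
    using B(2) by (auto simp add: V_def subset_eq) (metis prod.case prod_encode_inverse)
  then have "?O (\<Union>i. A i) \<le> (\<Sum>i. ?f (V i))"
    by (intro hausdorff_content_le) (use B(1) in \<open>auto simp: V_def split_def\<close>)
  also have "\<dots> = (\<Sum>n. \<Sum>i. ?f (B n i))"
    unfolding V_def comp_def by (intro suminf_ennreal_2dimen) auto
  also have "\<dots> \<le> (\<Sum>n. ?O (A n) + ennreal (e * (1/2) ^ Suc n))"
    by (intro suminf_le B(3)) auto
  also have "\<dots> = (\<Sum>n. ?O (A n)) + (\<Sum>n. ennreal (e * (1/2) ^ Suc n))"
    by (rule suminf_add[symmetric]) auto
  also have "(\<Sum>n. ennreal (e * (1/2) ^ Suc n)) = ennreal e"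
    using sums_mult[OF power_half_series, of e] \<open>0 < e\<close> by (intro suminf_ennreal_eq) auto
  finally show "?O (\<Union>i. A i) \<le> (\<Sum>n. ?O (A n)) + ennreal e" .
qed

lemma hausdorff_outer_empty: "hausdorff_outer d {} = 0"
proof -
  have "hausdorff_content d \<delta> ({} :: 'a set) \<le> 0" if "\<delta> > 0" for \<delta>
    using hausdorff_content_le[of "\<lambda>_. {}" \<delta> "{}" d] that by (simp add: hausdorff_premeasure_def)
  then show ?thesis unfolding hausdorff_outer_eq_SUP_content
    by (intro antisym SUP_least) auto
qed

lemma outer_measure_space_hausdorff_outer:
  "outer_measure_space UNIV (hausdorff_outer d :: 'a::euclidean_space set \<Rightarrow> ennreal)"
  unfolding outer_measure_space_def
proof (intro conjI)
  show "positive UNIV (hausdorff_outer d :: 'a set \<Rightarrow> ennreal)" by (simp add: positive_def hausdorff_outer_empty)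
  show "increasing UNIV (hausdorff_outer d :: 'a set \<Rightarrow> ennreal)"
    unfolding increasing_def hausdorff_outer_eq_SUP_content
    by (auto intro!: SUP_mono' hausdorff_content_mono)
  show "countably_subadditive UNIV (hausdorff_outer d :: 'a set \<Rightarrow> ennreal)"
    unfolding countably_subadditive_def
  proof safe
    fix A :: "nat \<Rightarrow> 'a set"
    show "hausdorff_outer d (\<Union>i. A i) \<le> (\<Sum>i. hausdorff_outer d (A i))"
      unfolding hausdorff_outer_eq_SUP_content[of d "\<Union>i. A i"]
    proof (rule SUP_least)
      fix \<delta> :: real assume "\<delta> \<in> {0<..}"
      then show "hausdorff_content d \<delta> (\<Union>i. A i) \<le> (\<Sum>i. hausdorff_outer d (A i))"
        using hausdorff_content_UN_le[of d \<delta> A]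
        by (elim order_trans) (intro suminf_le hausdorff_content_le_outer, auto)
    qed
  qed
qed

text \<open>If \<open>A\<close> and \<open>B\<close> have distance at least \<open>e\<close>, a covering set of diameter less than \<open>e\<close> meets only one of them, so
  each cover of \<open>A \<union> B\<close> splits into a cover of \<open>A\<close> and a cover of \<open>B\<close>.\<close>

lemma metric_additive_hausdorff_outer: "metric_additive (hausdorff_outer d)"
  unfolding metric_additive_def
proof safe
  fix A B :: "'a set" and e :: real
  assume e: "e > 0" and sep: "\<forall>x\<in>A. \<forall>y\<in>B. e \<le> dist x y"
  have small: "hausdorff_content d \<delta> A + hausdorff_content d \<delta> B \<le> hausdorff_content d \<delta> (A \<union> B)"
    if "0 < \<delta>" "\<delta> < e" for \<delta>
    unfolding hausdorff_content_def[of d \<delta> "A \<union> B"]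
  proof (safe intro!: INF_greatest)
    fix U :: "nat \<Rightarrow> 'a set"
    assume bd: "\<forall>i. bounded (U i) \<and> diameter (U i) \<le> \<delta>" and cov: "A \<union> B \<subseteq> (\<Union>i. U i)"
    define V where "V i = (if U i \<inter> A = {} then {} else U i)" for i
    define W where "W i = (if U i \<inter> A = {} then U i else {})" for i
    have "hausdorff_content d \<delta> A \<le> (\<Sum>i. hausdorff_premeasure d (V i))"
    proof (intro hausdorff_content_le)
      show "A \<subseteq> (\<Union>i. V i)"
      proof
        fix x assume x: "x \<in> A"
        then obtain i where "x \<in> U i" using cov by blast
        then have "x \<in> V i" using x by (auto simp: V_def)
        then show "x \<in> (\<Union>i. V i)" by blast
      qed
    qed (use bd \<open>0 < \<delta>\<close> in \<open>auto simp: V_def\<close>)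
    moreover have "hausdorff_content d \<delta> B \<le> (\<Sum>i. hausdorff_premeasure d (W i))"
    proof (intro hausdorff_content_le)
      show "B \<subseteq> (\<Union>i. W i)"
      proof
        fix y assume y: "y \<in> B"
        then obtain i where i: "y \<in> U i" using cov by blast
        have "U i \<inter> A = {}"
        proof (rule ccontr)
          assume "U i \<inter> A \<noteq> {}"
          then obtain x where x: "x \<in> U i" "x \<in> A" by blast
          have "dist x y \<le> diameter (U i)" using bd x(1) i by (intro diameter_bounded_bound) auto
          then show False using sep x y bd \<open>\<delta> < e\<close> by (meson dual_order.trans not_le)
        qed
        then show "y \<in> (\<Union>i. W i)" using i by (auto simp: W_def)
      qed
    qed (use bd \<open>0 < \<delta>\<close> in \<open>auto simp: W_def\<close>)
    ultimately have "hausdorff_content d \<delta> A + hausdorff_content d \<delta> B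
        \<le> (\<Sum>i. hausdorff_premeasure d (V i)) + (\<Sum>i. hausdorff_premeasure d (W i))"
      by (rule add_mono)
    also have "\<dots> = (\<Sum>i. hausdorff_premeasure d (V i) + hausdorff_premeasure d (W i))"
      by (rule suminf_add) auto
    also have "\<dots> = (\<Sum>i. hausdorff_premeasure d (U i))"
      by (intro suminf_cong) (auto simp: V_def W_def hausdorff_premeasure_def)
    finally show "hausdorff_content d \<delta> A + hausdorff_content d \<delta> B \<le> (\<Sum>i. hausdorff_premeasure d (U i))" .
  qed
  have "hausdorff_outer d A + hausdorff_outer d B
      = (SUP \<delta>\<in>{0<..}. hausdorff_content d \<delta> A + hausdorff_content d \<delta> B)"
    unfolding hausdorff_outer_eq_SUP_content
  proof (rule SUP_add_directed_ennreal[symmetric])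
    fix i j :: real assume ij: "i \<in> {0<..}" "j \<in> {0<..}"
    show "\<exists>k\<in>{0<..}. hausdorff_content d i A + hausdorff_content d j B
        \<le> hausdorff_content d k A + hausdorff_content d k B"
      using ij by (intro bexI[of _ "min i j"] add_mono hausdorff_content_antimono) auto
  qed
  also have "\<dots> \<le> hausdorff_outer d (A \<union> B)"
  proof (rule SUP_least)
    fix \<delta> :: real assume d: "\<delta> \<in> {0<..}"
    \<comment> \<open>the content of sets of diameter at most \<open>\<delta>\<close> only grows when \<open>\<delta>\<close> is decreased below \<open>e\<close>\<close>
    define \<epsilon> where "\<epsilon> = min \<delta> (e / 2)"
    have "hausdorff_content d \<delta> A + hausdorff_content d \<delta> B
        \<le> hausdorff_content d \<epsilon> A + hausdorff_content d \<epsilon> B"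
      by (intro add_mono hausdorff_content_antimono) (auto simp: \<epsilon>_def)
    also have "\<dots> \<le> hausdorff_content d \<epsilon> (A \<union> B)"
      by (rule small) (use d e in \<open>auto simp: \<epsilon>_def min_def\<close>)
    also have "\<dots> \<le> hausdorff_outer d (A \<union> B)"
      by (rule hausdorff_content_le_outer) (use d e in \<open>auto simp: \<epsilon>_def\<close>)
    finally show "hausdorff_content d \<delta> A + hausdorff_content d \<delta> B \<le> hausdorff_outer d (A \<union> B)" .
  qed
  finally show "hausdorff_outer d A + hausdorff_outer d B \<le> hausdorff_outer d (A \<union> B)" .
qed

lemma space_hausdorff_measure [simp]: "space (hausdorff_measure d) = UNIV"
  unfolding hausdorff_measure_def by (simp add: space_measure_of_conv)

lemma measure_space_hausdorff_outer:
  "measure_space UNIV (lambda_system UNIV UNIV (hausdorff_outer d))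
     (hausdorff_outer d :: 'a::euclidean_space set \<Rightarrow> ennreal)"
proof -
  interpret sigma_algebra UNIV "UNIV :: 'a set set" using sigma_algebra_Pow[of UNIV] by simp
  show ?thesis by (rule caratheodory_lemma[OF outer_measure_space_hausdorff_outer])
qed

lemma sets_hausdorff_measure:
  "sets (hausdorff_measure d :: 'a::euclidean_space measure) = lambda_system UNIV UNIV (hausdorff_outer d)"
  using measure_space_hausdorff_outer[of d, where 'a='a] unfolding hausdorff_measure_def measure_space_def
  by (simp add: sets_measure_of sigma_algebra.sigma_sets_eq)

lemma emeasure_hausdorff_measure:
  assumes "(A :: 'a::euclidean_space set) \<in> sets (hausdorff_measure d)"
  shows "emeasure (hausdorff_measure d) A = hausdorff_outer d A"
  using measure_space_hausdorff_outer[of d, where 'a='a] assms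
  unfolding sets_hausdorff_measure unfolding hausdorff_measure_def measure_space_def
  by (intro emeasure_measure_of_sigma) auto

lemma borel_subset_sets_hausdorff_measure: "sets borel \<subseteq> sets (hausdorff_measure d)"
  unfolding sets_hausdorff_measure
  by (rule borel_subset_lambda_system[OF outer_measure_space_hausdorff_outer metric_additive_hausdorff_outer])

section \<open>Hausdorff measure on the sphere and Lebesgue measure of cones\<close>

text \<open>The Lebesgue measure of \<open>annular_cone A\<close> replaces the surface measure of \<open>A\<close>; restriction to an
  annulus makes it finite.\<close>

definition annular_cone :: "'a::euclidean_space set \<Rightarrow> 'a set" where
  "annular_cone A = {x. 1 < norm x \<and> norm x < 2 \<and> sgn x \<in> A}"

lemma annular_cone_borel [measurable]:
  "A \<in> sets borel \<Longrightarrow> annular_cone A \<in> sets (borel :: 'a::euclidean_space measure)"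
proof -
  assume A: "A \<in> sets borel"
  have "(sgn :: 'a \<Rightarrow> 'a) \<in> borel_measurable borel" unfolding sgn_div_norm by measurable
  then have [measurable]: "{x :: 'a. sgn x \<in> A} \<in> sets borel"
    using measurable_sets_borel[of sgn borel A] A by (simp add: vimage_def)
  have "annular_cone A = {x. 1 < norm x} \<inter> {x. norm x < 2} \<inter> {x. sgn x \<in> A}"
    by (auto simp: annular_cone_def)
  also have "\<dots> \<in> sets borel" by measurable
  finally show ?thesis .
qed

lemma annular_cone_mono: "A \<subseteq> B \<Longrightarrow> annular_cone A \<subseteq> annular_cone B"
  by (auto simp: annular_cone_def)

lemma emeasure_annular_cone_finite: "emeasure lborel (annular_cone A) < \<infinity>"
proof -
  have "emeasure lborel (annular_cone A) \<le> emeasure lborel (ball 0 2 :: 'a set)"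
    by (rule emeasure_mono) (auto simp: annular_cone_def)
  also have "\<dots> < \<infinity>" by (rule emeasure_lborel_ball_finite)
  finally show ?thesis .
qed

lemma norm_minus_norm_scaleR_le:
  fixes x u :: "'a::real_normed_vector"
  assumes "norm u = 1" "s \<ge> 0"
  shows "norm (x - norm x *\<^sub>R u) \<le> 2 * norm (x - s *\<^sub>R u)"
proof -
  have "norm (x - norm x *\<^sub>R u) = norm ((x - s *\<^sub>R u) - (norm x - s) *\<^sub>R u)"
    by (simp add: algebra_simps)
  also have "\<dots> \<le> norm (x - s *\<^sub>R u) + \<bar>norm x - s\<bar>"
    using norm_triangle_ineq4[of "x - s *\<^sub>R u" "(norm x - s) *\<^sub>R u"] assms by simp
  also have "\<bar>norm x - s\<bar> \<le> norm (x - s *\<^sub>R u)"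
    using norm_triangle_ineq3[of x "s *\<^sub>R u"] assms by simp
  finally show ?thesis by simp
qed

lemma dist_sgn:
  fixes x u :: "'a::real_normed_vector"
  assumes "x \<noteq> 0"
  shows "norm (x - norm x *\<^sub>R u) = norm x * dist (sgn x) u"
proof -
  have "x - norm x *\<^sub>R u = norm x *\<^sub>R (sgn x - u)"
    using assms by (simp add: sgn_div_norm algebra_simps)
  then show ?thesis by (simp add: dist_norm)
qed

text \<open>The cone over a cap of radius \<open>d\<close> stays within \<open>2 d\<close> of a segment of length 1, so \<open>O(1/d)\<close> balls of radius \<open>3 d\<close>
  with centres spaced by \<open>d\<close> along that segment cover it.\<close>

lemma emeasure_annular_cone_cball_le:
  fixes u :: "'a::euclidean_space"
  assumes u: "norm u = 1" and d: "0 < d" "d \<le> 1"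
  shows "emeasure lborel (annular_cone (cball u d))
           \<le> ennreal (2 * 3 ^ DIM('a) * unit_ball_vol (real DIM('a)) * d ^ (DIM('a) - 1))"
proof -
  define n where "n = nat \<lceil>1 / d\<rceil>"
  have n: "real n \<le> 2 / d"
  proof -
    have "real n \<le> 1 / d + 1" using d unfolding n_def by simp
    also have "\<dots> \<le> 2 / d" using d by (simp add: field_simps)
    finally show ?thesis .
  qed
  have "annular_cone (cball u d) \<subseteq> (\<Union>k<n. cball ((1 + real k * d) *\<^sub>R u) (3 * d))"
  proof
    fix x assume "x \<in> annular_cone (cball u d)"
    then have x: "1 < norm x" "norm x < 2" "dist (sgn x) u \<le> d"
      by (auto simp: annular_cone_def dist_commute)
    define k where "k = nat \<lfloor>(norm x - 1) / d\<rfloor>"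
    have k: "real k \<le> (norm x - 1) / d" "(norm x - 1) / d < real k + 1"
      using x d by (auto simp: k_def)
    have "(norm x - 1) / d < 1 / d" using x(2) d(1) by (intro divide_strict_right_mono) auto
    then have "real k < 1 / d" using k(1) by linarith
    then have "real k < real n" unfolding n_def by linarith
    then have kn: "k < n" by simp
    have "norm (x - (1 + real k * d) *\<^sub>R u)
        \<le> norm (x - norm x *\<^sub>R u) + norm ((norm x - (1 + real k * d)) *\<^sub>R u)"
      using norm_triangle_ineq[of "x - norm x *\<^sub>R u" "(norm x - (1 + real k * d)) *\<^sub>R u"]
      by (simp add: algebra_simps)
    also have "norm (x - norm x *\<^sub>R u) \<le> 2 * d"
    proof -
      have "norm (x - norm x *\<^sub>R u) = norm x * dist (sgn x) u" using x by (intro dist_sgn) auto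
      also have "\<dots> \<le> 2 * d" using x by (intro mult_mono) auto
      finally show ?thesis .
    qed
    also have "norm ((norm x - (1 + real k * d)) *\<^sub>R u) \<le> d"
    proof -
      have "real k * d \<le> norm x - 1" "norm x - 1 < (real k + 1) * d"
        using k d by (simp_all add: pos_le_divide_eq pos_divide_less_eq)
      then have "\<bar>norm x - (1 + real k * d)\<bar> \<le> d" by (simp add: abs_le_iff algebra_simps)
      then show ?thesis using u by (simp del: scaleR_left_diff_distrib)
    qed
    finally have "x \<in> cball ((1 + real k * d) *\<^sub>R u) (3 * d)"
      by (simp add: dist_norm norm_minus_commute)
    then show "x \<in> (\<Union>k<n. cball ((1 + real k * d) *\<^sub>R u) (3 * d))" using kn by blast
  qed
  then have "emeasure lborel (annular_cone (cball u d))
      \<le> emeasure lborel (\<Union>k<n. cball ((1 + real k * d) *\<^sub>R u) (3 * d))"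
    by (intro emeasure_mono) auto
  also have "\<dots> \<le> (\<Sum>k<n. emeasure lborel (cball ((1 + real k * d) *\<^sub>R u) (3 * d)))"
    by (intro emeasure_subadditive_finite) auto
  also have "\<dots> = ennreal (real n * (unit_ball_vol (real DIM('a)) * (3 * d) ^ DIM('a)))"
    using d by (simp add: emeasure_cball ennreal_mult'' ennreal_of_nat_eq_real_of_nat)
  also have "\<dots> \<le> ennreal (2 * 3 ^ DIM('a) * unit_ball_vol (real DIM('a)) * d ^ (DIM('a) - 1))"
  proof (rule ennreal_leI)
    have "d ^ DIM('a) = d ^ (DIM('a) - 1) * d" by (rule power_minus_mult[symmetric]) simp
    then have "2 / d * (unit_ball_vol (real DIM('a)) * (3 * d) ^ DIM('a))
        = 2 * 3 ^ DIM('a) * unit_ball_vol (real DIM('a)) * d ^ (DIM('a) - 1)"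
      using d by (simp add: power_mult_distrib)
    moreover have "real n * (unit_ball_vol (real DIM('a)) * (3 * d) ^ DIM('a))
        \<le> 2 / d * (unit_ball_vol (real DIM('a)) * (3 * d) ^ DIM('a))"
      using d by (intro mult_right_mono n) auto
    ultimately show "real n * (unit_ball_vol (real DIM('a)) * (3 * d) ^ DIM('a))
        \<le> 2 * 3 ^ DIM('a) * unit_ball_vol (real DIM('a)) * d ^ (DIM('a) - 1)" by simp
  qed
  finally show ?thesis .
qed

text \<open>The converse estimate: along the ray through \<open>u\<close> about \<open>1/r\<close> disjoint balls of radius \<open>r/2\<close> fit into the
  cone.\<close>

lemma emeasure_annular_cone_cball_ge:
  fixes u :: "'a::euclidean_space"
  assumes u: "norm u = 1" and r: "0 < r" "r \<le> 1"
  shows "ennreal (unit_ball_vol (real DIM('a)) / 2 ^ (DIM('a) + 1) * r ^ (DIM('a) - 1))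
           \<le> emeasure lborel (annular_cone (cball u r))"
proof -
  define \<rho> where "\<rho> = r / 2"
  define n where "n = nat \<lfloor>1 / r\<rfloor>"
  define s where "s k = 1 + (2 * real k + 1) * \<rho>" for k :: nat
  define B where "B k = ball (s k *\<^sub>R u) \<rho>" for k
  have \<rho>: "\<rho> > 0" using r by (simp add: \<rho>_def)
  have r1: "1 / r \<ge> 1" using r by simp
  have n_le: "real n \<le> 1 / r" using r by (simp add: n_def)
  have "1 / r < real n + 1" using r by (simp add: n_def)
  moreover have "real n \<ge> 1" using r1 by (simp add: n_def) linarith
  ultimately have n_ge: "1 / (2 * r) \<le> real n" by (simp add: field_simps)
  have sub: "B k \<subseteq> annular_cone (cball u r)" if "k < n" for k
  proof
    fix x assume "x \<in> B k"
    then have x: "norm (x - s k *\<^sub>R u) < \<rho>" by (simp add: B_def dist_norm norm_minus_commute)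
    have s0: "s k \<ge> 0" using \<rho> by (simp add: s_def)
    have "\<bar>norm x - s k\<bar> < \<rho>"
      using norm_triangle_ineq3[of x "s k *\<^sub>R u"] s0 u x by simp
    then have lo: "s k - \<rho> < norm x" and hi: "norm x < s k + \<rho>" by auto
    have "s k - \<rho> \<ge> 1" using \<rho> by (simp add: s_def algebra_simps)
    then have n1: "norm x > 1" using lo by simp
    have "real k + 1 \<le> 1 / r" using that n_le by linarith
    then have "(real k + 1) * r \<le> 1" using r by (simp add: field_simps)
    then have "s k + \<rho> \<le> 2" by (simp add: s_def \<rho>_def algebra_simps)
    then have n2: "norm x < 2" using hi by simp
    have "1 * dist (sgn x) u \<le> norm x * dist (sgn x) u" using n1 by (intro mult_right_mono) auto
    also have "\<dots> = norm (x - norm x *\<^sub>R u)" using n1 by (intro dist_sgn[symmetric]) auto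
    also have "\<dots> \<le> 2 * norm (x - s k *\<^sub>R u)" by (rule norm_minus_norm_scaleR_le[OF u s0])
    also have "\<dots> \<le> r" using x by (simp add: \<rho>_def)
    finally show "x \<in> annular_cone (cball u r)" using n1 n2 by (simp add: annular_cone_def dist_commute)
  qed
  have disj: "disjoint_family_on B {..<n}"
    unfolding disjoint_family_on_def
  proof safe
    fix j k :: nat and x assume "j \<noteq> k" "x \<in> B j" "x \<in> B k"
    then have "dist (s j *\<^sub>R u) (s k *\<^sub>R u) < 2 * \<rho>"
      using dist_triangle2[of "s j *\<^sub>R u" "s k *\<^sub>R u" x] by (simp add: B_def)
    moreover have "dist (s j *\<^sub>R u) (s k *\<^sub>R u) = \<bar>real j - real k\<bar> * (2 * \<rho>)"
    proof -
      have "s j *\<^sub>R u - s k *\<^sub>R u = ((real j - real k) * (2 * \<rho>)) *\<^sub>R u"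
        by (simp add: s_def algebra_simps)
      then show ?thesis using \<rho> u by (simp add: dist_norm abs_mult)
    qed
    moreover have "\<bar>real j - real k\<bar> \<ge> 1" using \<open>j \<noteq> k\<close> by linarith
    moreover have "1 * (2 * \<rho>) \<le> \<bar>real j - real k\<bar> * (2 * \<rho>)"
      using \<open>\<bar>real j - real k\<bar> \<ge> 1\<close> \<rho> by (intro mult_right_mono) auto
    ultimately have False by linarith
    then show "x \<in> {}" ..
  qed
  have "ennreal (unit_ball_vol (real DIM('a)) / 2 ^ (DIM('a) + 1) * r ^ (DIM('a) - 1))
      \<le> ennreal (real n * (unit_ball_vol (real DIM('a)) * \<rho> ^ DIM('a)))"
  proof (rule ennreal_leI)
    have "r ^ DIM('a) = r ^ (DIM('a) - 1) * r" by (rule power_minus_mult[symmetric]) simp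
    then have "unit_ball_vol (real DIM('a)) / 2 ^ (DIM('a) + 1) * r ^ (DIM('a) - 1)
        = 1 / (2 * r) * (unit_ball_vol (real DIM('a)) * \<rho> ^ DIM('a))"
      using r by (simp add: \<rho>_def power_divide)
    also have "\<dots> \<le> real n * (unit_ball_vol (real DIM('a)) * \<rho> ^ DIM('a))"
      using \<rho> by (intro mult_right_mono n_ge) auto
    finally show "unit_ball_vol (real DIM('a)) / 2 ^ (DIM('a) + 1) * r ^ (DIM('a) - 1)
        \<le> real n * (unit_ball_vol (real DIM('a)) * \<rho> ^ DIM('a))" .
  qed
  also have "\<dots> = (\<Sum>k<n. emeasure lborel (B k))"
    using \<rho> by (simp add: B_def emeasure_ball ennreal_mult'' ennreal_of_nat_eq_real_of_nat)
  also have "\<dots> = emeasure lborel (\<Union>k<n. B k)"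
    by (intro sum_emeasure disj) (auto simp: B_def)
  also have "\<dots> \<le> emeasure lborel (annular_cone (cball u r))"
    using sub by (intro emeasure_mono) auto
  finally show ?thesis .
qed

text \<open>A cover of \<open>A\<close> by sets \<open>U i\<close> induces a cover of its annular cone by cones over caps of radius
  \<open>diameter (U i)\<close>, whose volume is at most a constant times the premeasure of \<open>U i\<close>.\<close>

lemma annular_cone_null_if_hausdorff_null:
  fixes A :: "'a::euclidean_space set"
  assumes dim: "DIM('a) \<ge> 2" and A: "A \<subseteq> sphere 0 1"
    and null: "hausdorff_outer (DIM('a) - 1) A = 0" and meas: "annular_cone A \<in> sets lborel"
  shows "emeasure lborel (annular_cone A) = 0"
proof -
  define d where "d = DIM('a) - 1"
  have d1: "d \<ge> 1" using dim by (simp add: d_def)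
  define C where "C = 2 * 3 ^ DIM('a) * unit_ball_vol (real DIM('a)) * 2 ^ d / unit_ball_vol (real d)"
  have vol: "unit_ball_vol (real k) > 0" for k by (rule unit_ball_vol_pos) simp
  have C0: "C > 0" unfolding C_def by (intro divide_pos_pos mult_pos_pos vol zero_less_power) auto
  have piece: "\<exists>T\<in>sets lborel. annular_cone (U \<inter> A) \<subseteq> T \<and>
      emeasure lborel T \<le> ennreal C * hausdorff_premeasure d U"
    if bU: "bounded U" and dU: "diameter U \<le> 1/2" for U :: "'a set"
  proof (cases "U \<inter> A = {}")
    case True
    then show ?thesis by (intro bexI[of _ "{}"]) (auto simp: annular_cone_def)
  next
    case False
    then obtain u where u: "u \<in> U" "u \<in> A" by blast
    then have nu: "norm u = 1" using A by auto
    let ?D = "diameter U"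
    have D0: "?D \<ge> 0" by (rule diameter_ge_0[OF bU])
    define T where "T = annular_cone (cball u ?D)"
    have sub: "annular_cone (U \<inter> A) \<subseteq> T"
      unfolding T_def using diameter_bounded_bound[OF bU u(1)] by (intro annular_cone_mono) auto
    have Tm: "T \<in> sets lborel" unfolding T_def by measurable
    \<comment> \<open>the cap estimate needs a positive radius, but the diameter may be 0: approximate it from above\<close>
    have lim: "(\<lambda>n. ennreal (2 * 3 ^ DIM('a) * unit_ball_vol (real DIM('a)) * (?D + 1 / (real n + 2)) ^ d))
        \<longlonglongrightarrow> ennreal (2 * 3 ^ DIM('a) * unit_ball_vol (real DIM('a)) * (?D + 0) ^ d)"
    proof (intro tendsto_ennrealI tendsto_mult tendsto_const tendsto_power tendsto_add)
      show "(\<lambda>n. 1 / (real n + 2)) \<longlonglongrightarrow> 0" 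
        by (rule real_tendsto_sandwich[OF _ _ tendsto_const LIMSEQ_inverse_real_of_nat])
          (auto intro!: always_eventually simp: field_simps)
    qed
    have "emeasure lborel T \<le> ennreal (2 * 3 ^ DIM('a) * unit_ball_vol (real DIM('a)) * (?D + 0) ^ d)"
    proof (rule LIMSEQ_le_const[OF lim], intro exI allI impI)
      fix n :: nat
      have e: "1 / (real n + 2) > 0" "1 / (real n + 2) \<le> 1/2" by (auto simp: field_simps)
      have "emeasure lborel T \<le> emeasure lborel (annular_cone (cball u (?D + 1 / (real n + 2))))"
        unfolding T_def using e by (intro emeasure_mono annular_cone_mono subset_cball) auto
      also have "\<dots> \<le> ennreal (2 * 3 ^ DIM('a) * unit_ball_vol (real DIM('a)) * (?D + 1 / (real n + 2)) ^ d)"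
        unfolding d_def using e D0 dU
        by (intro emeasure_annular_cone_cball_le[OF nu]) linarith+
      finally show "emeasure lborel T \<le> ennreal (2 * 3 ^ DIM('a) * unit_ball_vol (real DIM('a)) * (?D + 1 / (real n + 2)) ^ d)" .
    qed
    also have "2 * 3 ^ DIM('a) * unit_ball_vol (real DIM('a)) * (?D + 0) ^ d
        = C * (unit_ball_vol (real d) * (?D / 2) ^ d)"
    proof -
      have alg: "2 * c * v * (t + 0) ^ k = 2 * c * v * 2 ^ k / w * (w * (t / 2) ^ k)"
        if "w > 0" for c v w t :: real and k :: nat
        using that by (simp add: power_divide)
      show ?thesis unfolding C_def by (rule alg) (rule vol)
    qed
    also have "ennreal (C * (unit_ball_vol (real d) * (?D / 2) ^ d)) = ennreal C * hausdorff_premeasure d U"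
      using u C0 D0 by (auto simp: hausdorff_premeasure_def ennreal_mult)
    finally show ?thesis using sub Tm by blast
  qed
  have "emeasure lborel (annular_cone A) \<le> ennreal C * ennreal e" if e: "e > 0" for e
  proof -
    have "hausdorff_content d (1/2) A < ennreal e"
      using hausdorff_content_le_outer[of "1/2" d A] null e by (simp add: d_def)
    then obtain U :: "nat \<Rightarrow> 'a set" where U: "\<And>i. bounded (U i)" "\<And>i. diameter (U i) \<le> 1/2"
        "A \<subseteq> (\<Union>i. U i)" "(\<Sum>i. hausdorff_premeasure d (U i)) < ennreal e"
      by (rule hausdorff_content_less_cover) auto
    obtain T where T: "\<And>i. T i \<in> sets lborel" "\<And>i. annular_cone (U i \<inter> A) \<subseteq> T i"
        "\<And>i. emeasure lborel (T i) \<le> ennreal C * hausdorff_premeasure d (U i)"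
      using piece[OF U(1,2)] by metis
    have "annular_cone A \<subseteq> (\<Union>i. T i)"
    proof
      fix x assume x: "x \<in> annular_cone A"
      then obtain i where "sgn x \<in> U i \<inter> A" using U(3) by (auto simp: annular_cone_def)
      then have "x \<in> annular_cone (U i \<inter> A)" using x by (auto simp: annular_cone_def)
      then show "x \<in> (\<Union>i. T i)" using T(2) by blast
    qed
    then have "emeasure lborel (annular_cone A) \<le> emeasure lborel (\<Union>i. T i)"
      using T(1) by (intro emeasure_mono) auto
    also have "\<dots> \<le> (\<Sum>i. emeasure lborel (T i))"
      using T(1) by (intro emeasure_subadditive_countably) auto
    also have "\<dots> \<le> (\<Sum>i. ennreal C * hausdorff_premeasure d (U i))"
      by (intro suminf_le T(3)) auto
    also have "\<dots> \<le> ennreal C * ennreal e" using U(4) by (simp add: mult_left_mono)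
    finally show ?thesis .
  qed
  from this[of "e / C" for e] have "emeasure lborel (annular_cone A) \<le> 0 + ennreal e" if "e > 0" for e
    using that C0 by (simp add: ennreal_mult[symmetric])
  then show ?thesis using ennreal_le_epsilon[of 0 "emeasure lborel (annular_cone A)"] by simp
qed

text \<open>The Vitali covering lemma selects disjoint small balls inside \<open>G\<close> whose fivefold enlargements cover \<open>A\<close>.
  The enlargements bound the Hausdorff content, while the cones over the disjoint balls are disjoint
  subsets of the annular cone over \<open>G\<close>.\<close>

lemma hausdorff_outer_le_annular_cone:
  fixes A G :: "'a::euclidean_space set"
  assumes A: "A \<subseteq> sphere 0 1" "A \<subseteq> G" and G: "open G"
  defines "K \<equiv> unit_ball_vol (real (DIM('a) - 1)) * 5 ^ (DIM('a) - 1) * 2 ^ (DIM('a) + 1) / unit_ball_vol (real DIM('a))"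
  shows "hausdorff_outer (DIM('a) - 1) A \<le> ennreal K * emeasure lborel (annular_cone G)"
  unfolding hausdorff_outer_eq_SUP_content
proof (rule SUP_least)
  fix \<delta> :: real assume "\<delta> \<in> {0<..}"
  then have \<delta>: "\<delta> > 0" by simp
  define d where "d = DIM('a) - 1"
  have vol: "unit_ball_vol (real k) > 0" for k by (rule unit_ball_vol_pos) simp
  have K0: "K > 0" unfolding K_def by (intro divide_pos_pos mult_pos_pos vol zero_less_power) auto
  have "\<exists>r. 0 < r \<and> r \<le> min 1 (\<delta> / 10) \<and> cball u r \<subseteq> G" if uA: "u \<in> A" for u
  proof -
    obtain e where e: "e > 0" "cball u e \<subseteq> G" using open_contains_cball[of G] G A(2) uA by blast
    show ?thesis
    proof (intro exI conjI)
      show "0 < min e (min 1 (\<delta> / 10))" "min e (min 1 (\<delta> / 10)) \<le> min 1 (\<delta> / 10)"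
        using e(1) \<delta> by auto
      have "cball u (min e (min 1 (\<delta> / 10))) \<subseteq> cball u e" by (intro subset_cball) simp
      then show "cball u (min e (min 1 (\<delta> / 10))) \<subseteq> G" using e(2) by blast
    qed
  qed
  then obtain r where r: "\<And>u. u \<in> A \<Longrightarrow> 0 < r u \<and> r u \<le> min 1 (\<delta> / 10) \<and> cball u (r u) \<subseteq> G"
    by metis
  have cov: "A \<subseteq> (\<Union>u\<in>A. cball u (r u))" 
  proof
    fix u assume u: "u \<in> A"
    then have "u \<in> cball u (r u)" using r by (simp add: less_imp_le)
    then show "u \<in> (\<Union>u\<in>A. cball u (r u))" using u by blast
  qed
  have r': "0 < r u \<and> r u \<le> min 1 (\<delta> / 10)" if "u \<in> A" for u using r[OF that] by blast
  obtain C where C: "countable C" "C \<subseteq> A"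
     "pairwise (\<lambda>i j. disjnt (cball i (r i)) (cball j (r j))) C"
     "A \<subseteq> (\<Union>i\<in>C. cball i (5 * r i))"
    by (rule Vitali_covering_lemma_cballs[where a="\<lambda>u. u" and r=r, OF cov r'])
  define J where "J = to_nat_on C ` C"
  define c where "c = from_nat_into C"
  have cC: "c n \<in> C" if "n \<in> J" for n
    using that C(1) by (auto simp: J_def c_def from_nat_into_to_nat_on)
  have inj: "inj_on c J"
    using C(1) by (auto simp: inj_on_def J_def c_def from_nat_into_to_nat_on)
  define U where "U n = (if n \<in> J then cball (c n) (5 * r (c n)) else {})" for n
  define V where "V n = (if n \<in> J then annular_cone (cball (c n) (r (c n))) else {})" for n
  have "A \<subseteq> (\<Union>n. U n)"
  proof
    fix x assume "x \<in> A"
    then obtain i where i: "i \<in> C" "x \<in> cball i (5 * r i)" using C(4) by blast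
    then have "x \<in> U (to_nat_on C i)"
      using C(1) by (auto simp: U_def J_def c_def from_nat_into_to_nat_on)
    then show "x \<in> (\<Union>n. U n)" by blast
  qed
  moreover have "bounded (U n)" "diameter (U n) \<le> \<delta>" for n
    using r cC[of n] C(2) \<delta> by (force simp: U_def)+
  ultimately have "hausdorff_content d \<delta> A \<le> (\<Sum>n. hausdorff_premeasure d (U n))"
    by (intro hausdorff_content_le)
  also have "\<dots> \<le> (\<Sum>n. ennreal K * emeasure lborel (V n))"
  proof (intro suminf_le allI)
    fix n
    show "hausdorff_premeasure d (U n) \<le> ennreal K * emeasure lborel (V n)"
    proof (cases "n \<in> J")
      case True
      let ?r = "r (c n)"
      have cA: "c n \<in> A" using cC True C(2) by blast
      have r0: "0 < ?r" "?r \<le> 1" using r[OF cA] by auto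
      have "hausdorff_premeasure d (U n) = ennreal (unit_ball_vol (real d) * (5 * ?r) ^ d)"
        using True r0 by (auto simp: U_def hausdorff_premeasure_def)
      also have "unit_ball_vol (real d) * (5 * ?r) ^ d
          = K * (unit_ball_vol (real DIM('a)) / 2 ^ (DIM('a) + 1) * ?r ^ (DIM('a) - 1))"
      proof -
        have alg: "w * (5 * t) ^ k = w * 5 ^ k * 2 ^ l / v * (v / 2 ^ l * t ^ k)"
          if "v > 0" for v w t :: real and k l :: nat
          using that by (simp add: power_mult_distrib)
        show ?thesis unfolding K_def d_def by (rule alg) (rule vol)
      qed
      also have "ennreal \<dots> = ennreal K * ennreal (unit_ball_vol (real DIM('a)) / 2 ^ (DIM('a) + 1) * ?r ^ (DIM('a) - 1))"
        using K0 r0 by (intro ennreal_mult) auto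
      also have "\<dots> \<le> ennreal K * emeasure lborel (annular_cone (cball (c n) ?r))"
        using cA A r0 by (intro mult_left_mono emeasure_annular_cone_cball_ge) auto
      also have "\<dots> = ennreal K * emeasure lborel (V n)" using True by (simp add: V_def)
      finally show ?thesis .
    qed (simp add: U_def hausdorff_premeasure_def)
  qed auto
  also have "\<dots> = ennreal K * (\<Sum>n. emeasure lborel (V n))" by simp
  also have "(\<Sum>n. emeasure lborel (V n)) = emeasure lborel (\<Union>n. V n)"
  proof (rule suminf_emeasure)
    show "disjoint_family V"
      unfolding disjoint_family_on_def
    proof safe
      fix m n x assume mn: "m \<noteq> n" "x \<in> V m" "x \<in> V n"
      then have "m \<in> J" "n \<in> J" by (auto simp: V_def split: if_splits)
      with mn inj have "c m \<noteq> c n" "c m \<in> C" "c n \<in> C" using cC by (auto simp: inj_on_def)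
      then have "disjnt (cball (c m) (r (c m))) (cball (c n) (r (c n)))"
        using C(3) by (auto simp: pairwise_def)
      then show "x \<in> {}" using mn \<open>m \<in> J\<close> \<open>n \<in> J\<close> by (auto simp: V_def annular_cone_def disjnt_iff)
    qed
  qed (auto simp: V_def)
  also have "emeasure lborel (\<Union>n. V n) \<le> emeasure lborel (annular_cone G)"
  proof (rule emeasure_mono)
    show "(\<Union>n. V n) \<subseteq> annular_cone G"
    proof (rule UN_least)
      fix n
      have "cball (c n) (r (c n)) \<subseteq> G" if "n \<in> J" using r cC[OF that] C(2) by blast
      then show "V n \<subseteq> annular_cone G" using annular_cone_mono[of "cball (c n) (r (c n))" G] by (simp add: V_def)
    qed
  qed (use G in auto)
  finally show "hausdorff_content (DIM('a) - 1) \<delta> A \<le> ennreal K * emeasure lborel (annular_cone G)"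
    by (simp add: mult_left_mono d_def)
qed

text \<open>The preceding estimate is applied to open \<open>G\<close> containing \<open>A\<close> with annular cones of small measure; they exist since the finite Borel
  measure \<open>G \<mapsto> emeasure lborel (annular_cone G)\<close> is outer regular.\<close>

lemma hausdorff_null_if_annular_cone_null:
  fixes A :: "'a::euclidean_space set"
  assumes A: "A \<subseteq> sphere 0 1" "A \<in> sets borel" and null: "emeasure lborel (annular_cone A) = 0"
  shows "hausdorff_outer (DIM('a) - 1) A = 0"
proof -
  define K :: real where "K = unit_ball_vol (real (DIM('a) - 1)) * 5 ^ (DIM('a) - 1) * 2 ^ (DIM('a) + 1) / unit_ball_vol (real DIM('a))"
  define m where "m = distr (density lborel (indicator (annular_cone (UNIV :: 'a set)))) borel sgn"
  have sgn [measurable]: "(sgn :: 'a \<Rightarrow> 'a) \<in> borel_measurable borel"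
    unfolding sgn_div_norm by measurable
  have em: "emeasure m B = emeasure lborel (annular_cone B)" if B: "B \<in> sets borel" for B
  proof -
    have "emeasure m B = emeasure (density lborel (indicator (annular_cone UNIV))) (sgn -` B)"
      unfolding m_def using B by (subst emeasure_distr) auto
    also have "\<dots> = (\<integral>\<^sup>+x. indicator (annular_cone UNIV) x * indicator (sgn -` B) x \<partial>lborel)"
      using measurable_sets[OF sgn B] by (subst emeasure_density) auto
    also have "\<dots> = (\<integral>\<^sup>+x. indicator (annular_cone B) x \<partial>lborel)"
      by (intro nn_integral_cong) (auto simp: indicator_def annular_cone_def)
    also have "\<dots> = emeasure lborel (annular_cone B)" using B by (intro nn_integral_indicator) auto
    finally show ?thesis .
  qed
  have "emeasure m A = (INF U\<in>{U. A \<subseteq> U \<and> open U}. emeasure m U)"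
  proof (rule outer_regular)
    show "emeasure m (space m) \<noteq> \<infinity>"
      using em[of UNIV] emeasure_annular_cone_finite[of "UNIV :: 'a set"] by (simp add: m_def less_top)
  qed (use A in \<open>auto simp: m_def\<close>)
  then have inf: "(INF U\<in>{U. A \<subseteq> U \<and> open U}. emeasure m U) = 0" using em A null by simp
  have "hausdorff_outer (DIM('a) - 1) A \<le> ennreal K * ennreal e" if "e > 0" for e
  proof -
    have "(INF U\<in>{U. A \<subseteq> U \<and> open U}. emeasure m U) < ennreal e" using inf that by simp
    then obtain U where U: "A \<subseteq> U" "open U" "emeasure m U < ennreal e" by (auto simp: INF_less_iff)
    have "hausdorff_outer (DIM('a) - 1) A \<le> ennreal K * emeasure lborel (annular_cone U)"
      unfolding K_def by (rule hausdorff_outer_le_annular_cone) (use A U in auto)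
    also have "\<dots> \<le> ennreal K * ennreal e" using U em[of U] by (intro mult_left_mono) auto
    finally show ?thesis .
  qed
  moreover have "K > 0"
    unfolding K_def by (intro divide_pos_pos mult_pos_pos unit_ball_vol_pos zero_less_power) auto
  ultimately have "hausdorff_outer (DIM('a) - 1) A \<le> 0 + ennreal e" if "e > 0" for e
  proof -
    have "ennreal K * ennreal (e / K) = ennreal e"
      using that \<open>K > 0\<close> by (simp add: ennreal_mult[symmetric])
    then show ?thesis
      using \<open>\<And>e. e > 0 \<Longrightarrow> hausdorff_outer (DIM('a) - 1) A \<le> ennreal K * ennreal e\<close>[of "e / K"] that \<open>K > 0\<close>
      by simp
  qed
  then show ?thesis using ennreal_le_epsilon[of 0 "hausdorff_outer (DIM('a) - 1) A"] by simp
qed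

lemma hausdorff_outer_sphere_finite:
  "hausdorff_outer (DIM('a::euclidean_space) - 1) (sphere 0 1 :: 'a set) < \<infinity>"
proof -
  have "hausdorff_outer (DIM('a::euclidean_space) - 1) (sphere 0 1 :: 'a set)
     \<le> ennreal (unit_ball_vol (real (DIM('a) - 1)) * 5 ^ (DIM('a) - 1) * 2 ^ (DIM('a) + 1) / unit_ball_vol (real DIM('a)))
       * emeasure lborel (annular_cone (UNIV :: 'a set))"
    by (rule hausdorff_outer_le_annular_cone) auto
  also have "\<dots> < \<infinity>"
    using emeasure_annular_cone_finite[of "UNIV :: 'a set"] by (simp add: ennreal_mult_less_top)
  finally show ?thesis .
qed

lemma hausdorff_outer_sphere_pos:
  assumes "DIM('a::euclidean_space) \<ge> 2"
  shows "hausdorff_outer (DIM('a) - 1) (sphere 0 1 :: 'a set) > 0"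
proof (rule ccontr)
  assume "\<not> ?thesis"
  then have 0: "hausdorff_outer (DIM('a) - 1) (sphere 0 1 :: 'a set) = 0" by (simp add: not_less)
  have "emeasure lborel (annular_cone (sphere 0 1 :: 'a set)) = 0"
    by (rule annular_cone_null_if_hausdorff_null[OF assms order_refl 0]) auto
  moreover have "emeasure lborel (annular_cone (sphere 0 1 :: 'a set)) \<noteq> 0"
  proof -
    obtain b :: 'a where b: "norm b = 1" using SOME_Basis norm_Basis by blast
    have "0 < unit_ball_vol (real DIM('a)) / 2 ^ (DIM('a) + 1)"
      by (intro divide_pos_pos unit_ball_vol_pos) auto
    then have "0 < ennreal (unit_ball_vol (real DIM('a)) / 2 ^ (DIM('a) + 1) * 1 ^ (DIM('a) - 1))"
      by (simp add: ennreal_less_zero_iff del: of_nat_diff)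
    also have "\<dots> \<le> emeasure lborel (annular_cone (cball b 1))"
      by (rule emeasure_annular_cone_cball_ge[OF b]) auto
    also have "\<dots> \<le> emeasure lborel (annular_cone (sphere 0 1 :: 'a set))"
      by (intro emeasure_mono) (auto simp: annular_cone_def norm_sgn)
    finally show ?thesis by simp
  qed
  ultimately show False by contradiction
qed

section \<open>Reduction of the affine energy to Lebesgue measure\<close>

lemma epow_measurable [measurable]:
  assumes "f \<in> borel_measurable M"
  shows "(\<lambda>x. epow (f x) a) \<in> borel_measurable M"
  using assms unfolding epow_def by measurable

lemma epow_eq_0_iff: "a \<noteq> 0 \<Longrightarrow> epow x a = 0 \<longleftrightarrow> (if a < 0 then x = \<infinity> else x = 0)"
  by (cases x) (auto simp: epow_def powr_eq_0_iff)

lemma epow_eq_top_iff: "a \<noteq> 0 \<Longrightarrow> epow x a = top \<longleftrightarrow> (if a < 0 then x = 0 else x = \<infinity>)"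
  by (cases x) (auto simp: epow_def)

text \<open>This reduces the affine energy to Lebesgue measure. As the measure of the sphere is
  finite and positive, the product is infinite exactly if the integral vanishes, that is, if \<open>I\<close> is infinite
  in almost every direction.\<close>

lemma affine_integral_finite_iff:
  fixes I :: "'a::euclidean_space \<Rightarrow> ennreal" and a b e :: real
  assumes dim: "DIM('a) \<ge> 2" and I [measurable]: "I \<in> borel_measurable borel"
    and hom: "\<And>c x. c > 0 \<Longrightarrow> I x < \<infinity> \<longleftrightarrow> I (c *\<^sub>R x) < \<infinity>"
    and pos: "a > 0" "b > 0" "e > 0"
  defines "H \<equiv> (hausdorff_measure (DIM('a) - 1) :: 'a measure)"
  shows "epow (emeasure H (sphere 0 1)) a
      * epow (\<integral>\<^sup>+\<xi>\<in>sphere 0 1. epow (I \<xi>) (- b) \<partial>H) (- e) < \<infinity>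
    \<longleftrightarrow> emeasure lborel {x. 1 < norm x \<and> norm x < 2 \<and> I x < \<infinity>} \<noteq> 0"
proof -
  define A where "A = {\<xi> \<in> sphere 0 1. I \<xi> < \<infinity>}"
  have Ab: "A \<in> sets borel"
  proof -
    have "A = sphere 0 1 \<inter> {\<xi>. I \<xi> < \<infinity>}" by (auto simp: A_def)
    also have "\<dots> \<in> sets borel" by (intro sets.Int) measurable
    finally show ?thesis .
  qed
  have sub: "sets borel \<subseteq> sets H" unfolding H_def by (rule borel_subset_sets_hausdorff_measure)
  \<comment> \<open>the Hausdorff measure has more measurable sets than the Borel measure\<close>
  have mH: "f \<in> borel_measurable H" if "f \<in> borel_measurable borel" for f :: "'a \<Rightarrow> ennreal"
  proof (rule measurableI)
    fix B :: "ennreal set" assume "B \<in> sets borel"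
    then have "f -` B \<inter> space borel \<in> sets borel" by (rule measurable_sets[OF that])
    then show "f -` B \<inter> space H \<in> sets H" using sub by (auto simp: H_def)
  qed simp
  have emH: "emeasure H B = hausdorff_outer (DIM('a) - 1) B" if "B \<in> sets borel" for B
    using that sub unfolding H_def by (intro emeasure_hausdorff_measure) auto
  have \<sigma>: "emeasure H (sphere 0 1) \<noteq> 0" "emeasure H (sphere 0 1) \<noteq> \<infinity>"
    using hausdorff_outer_sphere_pos[OF dim] hausdorff_outer_sphere_finite[where 'a='a]
    by (auto simp: emH)
  have "(\<integral>\<^sup>+\<xi>\<in>sphere 0 1. epow (I \<xi>) (- b) \<partial>H) = 0
      \<longleftrightarrow> emeasure H {\<xi> \<in> space H. epow (I \<xi>) (- b) * indicator (sphere 0 1) \<xi> \<noteq> 0} = 0"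
    by (intro nn_integral_0_iff mH borel_measurable_times_ennreal borel_measurable_indicator
        epow_measurable I borel_closed) auto
  also have "{\<xi> \<in> space H. epow (I \<xi>) (- b) * indicator (sphere 0 1) \<xi> \<noteq> 0} = A"
    using pos by (auto simp: A_def H_def epow_eq_0_iff less_top indicator_def)
  also have "emeasure H A = 0 \<longleftrightarrow> emeasure lborel (annular_cone A) = 0"
  proof -
    have "emeasure H A = hausdorff_outer (DIM('a) - 1) A" by (rule emH[OF Ab])
    moreover have "A \<subseteq> sphere 0 1" by (auto simp: A_def)
    ultimately show ?thesis
      using annular_cone_null_if_hausdorff_null[OF dim, of A] hausdorff_null_if_annular_cone_null[of A] Ab
      by auto
  qed
  also have "annular_cone A = {x. 1 < norm x \<and> norm x < 2 \<and> I x < \<infinity>}"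
  proof -
    have "I (sgn x) < \<infinity> \<longleftrightarrow> I x < \<infinity>" if "norm x > 1" for x
    proof -
      have "x \<noteq> 0" using that by auto
      then show ?thesis using hom[of "inverse (norm x)" x] by (simp add: sgn_div_norm)
    qed
    then show ?thesis by (auto simp: annular_cone_def A_def norm_sgn)
  qed
  finally have iff: "(\<integral>\<^sup>+\<xi>\<in>sphere 0 1. epow (I \<xi>) (- b) \<partial>H) = 0
      \<longleftrightarrow> emeasure lborel {x. 1 < norm x \<and> norm x < 2 \<and> I x < \<infinity>} = 0" .
  have "epow (emeasure H (sphere 0 1)) a \<noteq> 0" "epow (emeasure H (sphere 0 1)) a \<noteq> \<infinity>"
    using \<sigma> pos by (auto simp: epow_eq_0_iff epow_eq_top_iff)
  then have "epow (emeasure H (sphere 0 1)) a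
      * epow (\<integral>\<^sup>+\<xi>\<in>sphere 0 1. epow (I \<xi>) (- b) \<partial>H) (- e) < \<infinity>
    \<longleftrightarrow> epow (\<integral>\<^sup>+\<xi>\<in>sphere 0 1. epow (I \<xi>) (- b) \<partial>H) (- e) \<noteq> \<infinity>"
    by (auto simp: ennreal_mult_less_top less_top)
  also have "\<dots> \<longleftrightarrow> (\<integral>\<^sup>+\<xi>\<in>sphere 0 1. epow (I \<xi>) (- b) \<partial>H) \<noteq> 0"
    using pos by (simp add: epow_eq_top_iff)
  finally show ?thesis using iff by simp
qed

section \<open>Common translates into a set of positive measure\<close>

text \<open>Approximate \<open>E\<close> by a compact \<open>K\<close> from inside and \<open>K\<close> by an open \<open>U\<close> from outside, with the measures of
  \<open>K\<close> and \<open>U\<close> differing by less than \<open>1/n\<close> of that of \<open>K\<close>. All small translates of \<open>K\<close> lie in \<open>U\<close>, hence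
  \<open>n\<close> of them have a common point.\<close>

lemma exists_common_translate:
  fixes E :: "'a::euclidean_space set"
  assumes E: "E \<in> sets lebesgue" and pos: "emeasure lebesgue E \<noteq> 0"
  shows "\<exists>\<delta>>0. \<forall>T. finite T \<and> card T \<le> n \<and> T \<subseteq> ball 0 \<delta> \<longrightarrow> (\<exists>y. \<forall>h\<in>T. y + h \<in> E)"
proof -
  obtain r :: nat where r: "emeasure lebesgue (E \<inter> ball 0 (real r)) \<noteq> 0"
  proof (rule ccontr)
    assume "\<not> thesis"
    then have "emeasure lebesgue (E \<inter> ball 0 (real r)) = 0" for r :: nat using that by blast
    then have "(\<Union>r::nat. E \<inter> ball 0 (real r)) \<in> null_sets lebesgue"
      using E by (intro null_sets_UN) (auto simp: null_sets_def)
    also have "(\<Union>r::nat. E \<inter> ball 0 (real r)) = E"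
      using reals_Archimedean2 by auto
    finally show False using pos by auto
  qed
  define F where "F = E \<inter> ball 0 (real r)"
  have F: "F \<in> lmeasurable" unfolding F_def using E by (intro bounded_set_imp_lmeasurable) auto
  have mF: "measure lebesgue F > 0"
    using r F by (metis F_def emeasure_eq_measure2 ennreal_0 measure_nonneg order_le_less)
  obtain K where K: "closed K" "K \<subseteq> F" "F - K \<in> lmeasurable" "emeasure lebesgue (F - K) < ennreal (measure lebesgue F)"
    by (rule sets_lebesgue_inner_closed[OF fmeasurableD[OF F] mF])
  have "K \<subseteq> ball 0 (real r)" using K(2) by (auto simp: F_def)
  then have "bounded K" by (rule bounded_subset[OF bounded_ball])
  then have cK: "compact K" using K(1) by (simp add: compact_eq_bounded_closed)
  have lK: "K \<in> lmeasurable" using cK by (rule lmeasurable_compact)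
  have mK: "measure lebesgue K > 0"
  proof -
    have "measure lebesgue (F - K) < measure lebesgue F"
      using K(3,4) by (simp add: emeasure_eq_measure2 ennreal_less_iff)
    moreover have "measure lebesgue (F - K) = measure lebesgue F - measure lebesgue K"
      using F lK K(2) by (rule measurable_measure_Diff[OF _ fmeasurableD])
    ultimately show ?thesis by simp
  qed
  define \<epsilon> where "\<epsilon> = measure lebesgue K / real (Suc n)"
  have \<epsilon>: "\<epsilon> > 0" using mK by (simp add: \<epsilon>_def)
  obtain U where U: "open U" "K \<subseteq> U" "U - K \<in> lmeasurable" "emeasure lebesgue (U - K) < ennreal \<epsilon>"
    by (rule sets_lebesgue_outer_open[OF fmeasurableD[OF lK] \<epsilon>])
  have lU: "U \<in> lmeasurable"
    using fmeasurable.Un[OF lK U(3)] U(2) by (simp add: Un_absorb1)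
  have "measure lebesgue (U - K) < \<epsilon>"
    using U(3,4) by (simp add: emeasure_eq_measure2 ennreal_less_iff)
  moreover have "measure lebesgue (U - K) = measure lebesgue U - measure lebesgue K"
    using lU lK U(2) by (rule measurable_measure_Diff[OF _ fmeasurableD])
  ultimately have mU: "measure lebesgue U - measure lebesgue K < \<epsilon>" by simp
  obtain \<delta> where \<delta>: "\<delta> > 0" "(\<Union>x\<in>K. ball x \<delta>) \<subseteq> U"
    using compact_subset_open_imp_ball_epsilon_subset[OF cK U(1,2)] by blast
  show ?thesis
  proof (intro exI[of _ \<delta>] conjI allI impI)
    show "\<delta> > 0" by fact
    fix T :: "'a set" assume T: "finite T \<and> card T \<le> n \<and> T \<subseteq> ball 0 \<delta>"
    define S where "S h = (+) (- h) ` K" for h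
    have lS: "S h \<in> lmeasurable" "measure lebesgue (S h) = measure lebesgue K" for h
      unfolding S_def by (rule measurable_translation[OF lK], rule measure_translation)
    have SU: "S h \<subseteq> U" if "h \<in> T" for h
    proof -
      have "norm h < \<delta>" using that T by auto
      then have b: "- h + x \<in> ball x \<delta>" for x by (simp add: dist_norm)
      show ?thesis
      proof
        fix z assume "z \<in> S h"
        then obtain x where "x \<in> K" "z = - h + x" by (auto simp: S_def)
        then show "z \<in> U" using b[of x] \<delta>(2) by blast
      qed
    qed
    have "\<exists>y\<in>U. \<forall>h\<in>T. y \<in> S h"
    proof (rule ccontr)
      assume "\<not> ?thesis"
      then have "U \<subseteq> (\<Union>h\<in>T. U - S h)" by blast
      moreover have lD: "U - S h \<in> lmeasurable" for h using lU lS by (intro fmeasurable.Diff)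
      ultimately have "measure lebesgue U \<le> measure lebesgue (\<Union>h\<in>T. U - S h)"
        using lU T by (intro measure_mono_fmeasurable fmeasurable.finite_UN) (auto dest: fmeasurableD)
      also have "\<dots> \<le> (\<Sum>h\<in>T. measure lebesgue (U - S h))"
        using T lD by (intro measure_UNION_le) (auto dest: fmeasurableD)
      also have "\<dots> = (\<Sum>h\<in>T. measure lebesgue U - measure lebesgue K)"
      proof (rule sum.cong[OF refl])
        fix h assume "h \<in> T"
        then show "measure lebesgue (U - S h) = measure lebesgue U - measure lebesgue K"
          using lU lS SU by (subst measurable_measure_Diff) (auto dest: fmeasurableD)
      qed
      also have "\<dots> \<le> (\<Sum>h\<in>T. \<epsilon>)" using mU by (intro sum_mono) auto
      also have "\<dots> \<le> real n * \<epsilon>" using T \<epsilon> by (simp add: mult_right_mono)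
      also have "\<dots> < measure lebesgue K" using mK by (simp add: \<epsilon>_def field_simps)
      also have "\<dots> \<le> measure lebesgue U"
        using lU lK U(2) by (intro measure_mono_fmeasurable) (auto dest: fmeasurableD)
      finally show False by simp
    qed
    then obtain y where y: "\<forall>h\<in>T. y \<in> S h" by blast
    have "y + h \<in> E" if "h \<in> T" for h
    proof -
      obtain k where "k \<in> K" "y = - h + k" using y \<open>h \<in> T\<close> by (auto simp: S_def)
      then have "y + h = k" by simp
      then show ?thesis using \<open>k \<in> K\<close> K(2) by (auto simp: F_def)
    qed
    then show "\<exists>y. \<forall>h\<in>T. y + h \<in> E" by blast
  qed
qed

section \<open>Identities for iterated differences\<close>

lemma diff_op_power_eq:
  "(diff_op h ^^ m) f x = (\<Sum>k\<le>m. (-1) ^ (m + k) * real (m choose k) * f (x + real k *\<^sub>R h))"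
proof (induction m arbitrary: x)
  case 0
  then show ?case by simp
next
  case (Suc m)
  let ?a = "\<lambda>k. (-1) ^ (m + k) * real (m choose k) * f (x + real (Suc k) *\<^sub>R h)"
  let ?b = "\<lambda>k. (-1) ^ (m + k) * real (m choose k) * f (x + real k *\<^sub>R h)"
  let ?c = "\<lambda>k. (-1) ^ (Suc m + k) * real (Suc m choose k) * f (x + real k *\<^sub>R h)"
  have "(diff_op h ^^ Suc m) f x = (\<Sum>k\<le>m. ?a k) - (\<Sum>k\<le>m. ?b k)"
    by (simp add: diff_op_def Suc algebra_simps)
  also have "(\<Sum>k\<le>m. ?b k) = (\<Sum>k\<le>Suc m. ?b k)" by simp
  also have "\<dots> = ?b 0 + (\<Sum>k\<le>m. ?b (Suc k))" by (rule sum.atMost_Suc_shift)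
  also have "(\<Sum>k\<le>m. ?a k) - (?b 0 + (\<Sum>k\<le>m. ?b (Suc k))) = ?c 0 + (\<Sum>k\<le>m. ?a k - ?b (Suc k))"
  proof -
    have "?c 0 = - ?b 0" by simp
    then show ?thesis unfolding sum_subtractf by linarith
  qed
  also have "(\<Sum>k\<le>m. ?a k - ?b (Suc k)) = (\<Sum>k\<le>m. ?c (Suc k))"
    by (intro sum.cong) (auto simp: algebra_simps)
  also have "?c 0 + (\<Sum>k\<le>m. ?c (Suc k)) = (\<Sum>k\<le>Suc m. ?c k)" by (rule sum.atMost_Suc_shift[symmetric])
  finally show ?case .
qed

lemma sum_Pow_insert:
  fixes g :: "'b set \<Rightarrow> 'c::comm_monoid_add"
  assumes "finite A" "k \<notin> A"
  shows "(\<Sum>S\<in>Pow (insert k A). g S) = (\<Sum>S\<in>Pow A. g S + g (insert k S))"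
proof -
  have inj: "inj_on (insert k) (Pow A)" using assms by (auto simp: inj_on_def)
  have "(\<Sum>S\<in>Pow (insert k A). g S) = (\<Sum>S\<in>Pow A. g S) + (\<Sum>S\<in>insert k ` Pow A. g S)"
    unfolding Pow_insert using assms by (intro sum.union_disjoint) auto
  also have "(\<Sum>S\<in>insert k ` Pow A. g S) = (\<Sum>S\<in>Pow A. g (insert k S))"
    using inj by (simp add: sum.reindex)
  finally show ?thesis by (simp add: sum.distrib)
qed

text \<open>Both algebraic identities below, for differences and for polarisation, rest on this cancellation between \<open>S\<close> and \<open>insert k S\<close>.\<close>

lemma alternating_sum_Pow_eq_0:
  fixes g :: "'b set \<Rightarrow> real"
  assumes "finite A" "k \<in> A" "\<And>S. S \<subseteq> A - {k} \<Longrightarrow> g (insert k S) = g S"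
  shows "(\<Sum>S\<in>Pow A. (-1) ^ card S * g S) = 0"
proof -
  define B where "B = A - {k}"
  have A: "A = insert k B" "finite B" "k \<notin> B" using assms by (auto simp: B_def)
  have "(\<Sum>S\<in>Pow A. (-1) ^ card S * g S)
      = (\<Sum>S\<in>Pow B. (-1) ^ card S * g S + (-1) ^ card (insert k S) * g (insert k S))"
    unfolding A(1) by (rule sum_Pow_insert) (use A in auto)
  also have "\<dots> = 0"
  proof (rule sum.neutral, rule ballI)
    fix S assume S: "S \<in> Pow B"
    then have "finite S" "k \<notin> S" using A finite_subset by auto
    then show "(-1) ^ card S * g S + (-1) ^ card (insert k S) * g (insert k S) = 0"
      using assms(3)[of S] S by (simp add: B_def)
  qed
  finally show ?thesis .
qed

lemma sum_Pow_card:
  fixes g :: "nat \<Rightarrow> real"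
  assumes "finite A"
  shows "(\<Sum>S\<in>Pow A. g (card S)) = (\<Sum>k\<le>card A. real (card A choose k) * g k)"
proof -
  have "(\<Sum>S\<in>Pow A. g (card S)) = (\<Sum>k\<le>card A. \<Sum>S\<in>{S \<in> Pow A. card S = k}. g (card S))"
    using assms by (intro sum.group[symmetric]) (auto intro: card_mono)
  also have "\<dots> = (\<Sum>k\<le>card A. real (card A choose k) * g k)"
  proof (rule sum.cong[OF refl])
    fix k
    have "(\<Sum>S\<in>{S \<in> Pow A. card S = k}. g (card S)) = real (card {S. S \<subseteq> A \<and> card S = k}) * g k"
      by simp
    then show "(\<Sum>S\<in>{S \<in> Pow A. card S = k}. g (card S)) = real (card A choose k) * g k"
      using n_subsets[OF assms, of k] by simp
  qed
  finally show ?thesis .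
qed

text \<open>A variant of Kemperman's identity. Expand the differences on the right by the binomial formula: the
  term with index \<open>k\<close> evaluates \<open>f\<close> at \<open>x + k y + (\<Sum>j\<in>S. 1 - k/j) h\<close>. For \<open>k \<ge> 1\<close> the summand \<open>j = k\<close>
  vanishes, so the alternating sum over \<open>S\<close> cancels; the terms with \<open>k = 0\<close> do not involve \<open>y\<close> and form
  the binomial expansion of the left-hand side. That \<open>y\<close> is arbitrary is what allows all steps \<open>y - c S h\<close> to be
  moved into a prescribed set of positive measure.\<close>

lemma diff_op_power_decomposition:
  fixes f :: "'a::euclidean_space \<Rightarrow> real" and x y h :: 'a
  defines "c \<equiv> \<lambda>S. \<Sum>j\<in>S. 1 / real j"
  shows "(diff_op h ^^ m) f x =
    (\<Sum>S\<in>Pow {1..m}. (-1) ^ card S * (diff_op (y - c S *\<^sub>R h) ^^ m) f (x + real (card S) *\<^sub>R h))"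
proof -
  define G where "G k S = f (x + real (card S) *\<^sub>R h + real k *\<^sub>R (y - c S *\<^sub>R h))" for k S
  have zero: "(\<Sum>S\<in>Pow {1..m}. (-1) ^ card S * G k S) = 0" if k: "k \<in> {1..m}" for k
  proof (rule alternating_sum_Pow_eq_0[OF _ k])
    fix S assume S: "S \<subseteq> {1..m} - {k}"
    then have "finite S" "k \<notin> S" using finite_subset by auto
    then have "card (insert k S) = Suc (card S)" "c (insert k S) = 1 / real k + c S"
      by (auto simp: c_def)
    then show "G k (insert k S) = G k S" using k by (simp add: G_def algebra_simps)
  qed simp
  have "(\<Sum>S\<in>Pow {1..m}. (-1) ^ card S * (diff_op (y - c S *\<^sub>R h) ^^ m) f (x + real (card S) *\<^sub>R h))
      = (\<Sum>S\<in>Pow {1..m}. \<Sum>k\<le>m. ((-1) ^ (m + k) * real (m choose k)) * ((-1) ^ card S * G k S))"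
    by (simp add: diff_op_power_eq G_def sum_distrib_left ac_simps)
  also have "\<dots> = (\<Sum>k\<le>m. \<Sum>S\<in>Pow {1..m}. ((-1) ^ (m + k) * real (m choose k)) * ((-1) ^ card S * G k S))"
    by (rule sum.swap)
  also have "\<dots> = (\<Sum>k\<le>m. ((-1) ^ (m + k) * real (m choose k)) * (\<Sum>S\<in>Pow {1..m}. (-1) ^ card S * G k S))"
    by (simp add: sum_distrib_left)
  also have "\<dots> = (\<Sum>k\<in>{0}. ((-1) ^ (m + k) * real (m choose k)) * (\<Sum>S\<in>Pow {1..m}. (-1) ^ card S * G k S))"
    by (rule sum.mono_neutral_right) (use zero in auto)
  also have "\<dots> = (-1) ^ m * (\<Sum>S\<in>Pow {1..m}. (-1) ^ card S * f (x + real (card S) *\<^sub>R h))"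
    by (simp add: G_def)
  also have "\<dots> = (-1) ^ m * (\<Sum>k\<le>m. real (m choose k) * ((-1) ^ k * f (x + real k *\<^sub>R h)))"
    using sum_Pow_card[of "{1..m}" "\<lambda>k. (-1) ^ k * f (x + real k *\<^sub>R h)"] by simp
  also have "\<dots> = (diff_op h ^^ m) f x"
    by (simp add: diff_op_power_eq sum_distrib_left power_add ac_simps)
  finally show ?thesis by simp
qed

text \<open>A crude substitute for Minkowski's inequality that works under the integral sign.\<close>

lemma powr_abs_sum_le:
  fixes a :: "'b \<Rightarrow> real"
  assumes "finite A" "p \<ge> 0"
  shows "\<bar>\<Sum>i\<in>A. a i\<bar> powr p \<le> real (card A) powr p * (\<Sum>i\<in>A. \<bar>a i\<bar> powr p)"
proof (cases "A = {}")
  case True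
  then show ?thesis by simp
next
  case False
  define M where "M = Max ((\<lambda>i. \<bar>a i\<bar>) ` A)"
  have "M \<in> (\<lambda>i. \<bar>a i\<bar>) ` A" unfolding M_def using assms False by (intro Max_in) auto
  then obtain j where j: "j \<in> A" "M = \<bar>a j\<bar>" by blast
  have "\<bar>\<Sum>i\<in>A. a i\<bar> \<le> (\<Sum>i\<in>A. \<bar>a i\<bar>)" by (rule sum_abs)
  also have "\<dots> \<le> (\<Sum>i\<in>A. M)" unfolding M_def using assms by (intro sum_mono Max_ge) auto
  also have "\<dots> = real (card A) * M" by simp
  finally have "\<bar>\<Sum>i\<in>A. a i\<bar> powr p \<le> (real (card A) * M) powr p"
    using assms by (intro powr_mono2) auto
  also have "\<dots> = real (card A) powr p * \<bar>a j\<bar> powr p" using j by (simp add: powr_mult)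
  also have "\<dots> \<le> real (card A) powr p * (\<Sum>i\<in>A. \<bar>a i\<bar> powr p)"
    using assms j by (intro mult_left_mono member_le_sum) auto
  finally show ?thesis .
qed

section \<open>Energies of differences along rays\<close>

lemma nn_integral_lborel_translate:
  fixes f :: "'a::euclidean_space \<Rightarrow> ennreal"
  assumes [measurable]: "f \<in> borel_measurable borel"
  shows "(\<integral>\<^sup>+x. f (x + c) \<partial>lborel) = (\<integral>\<^sup>+x. f x \<partial>lborel)"
proof -
  have "(\<integral>\<^sup>+x. f x \<partial>lborel) = (\<integral>\<^sup>+x. f x \<partial>distr lborel borel ((+) c))"
    by (simp add: lborel_distr_plus)
  also have "\<dots> = (\<integral>\<^sup>+x. f (c + x) \<partial>lborel)" by (rule nn_integral_distr) auto
  finally show ?thesis by (simp add: add.commute)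
qed

lemma nn_integral_lborel_scaleR:
  fixes f :: "'a::euclidean_space \<Rightarrow> ennreal"
  assumes [measurable]: "f \<in> borel_measurable borel" and c: "c > 0"
  shows "(\<integral>\<^sup>+x. f x \<partial>lborel) = ennreal (c ^ DIM('a)) * (\<integral>\<^sup>+x. f (c *\<^sub>R x) \<partial>lborel)"
proof -
  have "(\<integral>\<^sup>+x. f x \<partial>lborel)
      = (\<integral>\<^sup>+x. f x \<partial>density (distr lborel borel (\<lambda>x. 0 + c *\<^sub>R x)) (\<lambda>_. ennreal (\<bar>c\<bar> ^ DIM('a))))"
    using c by (subst lborel_affine[of c 0]) auto
  also have "\<dots> = ennreal (c ^ DIM('a)) * (\<integral>\<^sup>+x. f (c *\<^sub>R x) \<partial>lborel)"
    using c by (simp add: nn_integral_density nn_integral_distr nn_integral_cmult)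
  finally show ?thesis .
qed

definition diff_energy :: "nat \<Rightarrow> real \<Rightarrow> ('a::euclidean_space \<Rightarrow> real) \<Rightarrow> 'a \<Rightarrow> ennreal" where
  "diff_energy m p f h = (\<integral>\<^sup>+x. ennreal (\<bar>(diff_op h ^^ m) f x\<bar> powr p) \<partial>lborel)"

text \<open>The direction energy for non-integer \<open>s\<close>, with \<open>m = \<lfloor>s\<rfloor> + 1\<close> and \<open>q = s p\<close>.\<close>

definition ray_energy :: "nat \<Rightarrow> real \<Rightarrow> real \<Rightarrow> ('a::euclidean_space \<Rightarrow> real) \<Rightarrow> 'a \<Rightarrow> ennreal" where
  "ray_energy m p q f x =
     (\<integral>\<^sup>+t\<in>{0<..}. (ennreal (t powr (- q - 1)) * diff_energy m p f (t *\<^sub>R x)) \<partial>lborel)"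

lemma diff_op_power_measurable [measurable]:
  fixes f :: "'a::euclidean_space \<Rightarrow> real"
  assumes [measurable]: "f \<in> borel_measurable borel" "g \<in> borel_measurable M" "k \<in> borel_measurable M"
  shows "(\<lambda>z. (diff_op (g z) ^^ m) f (k z)) \<in> borel_measurable M"
  unfolding diff_op_power_eq by measurable

lemma diff_energy_measurable [measurable]:
  assumes [measurable]: "f \<in> borel_measurable borel"
  shows "diff_energy m p f \<in> borel_measurable borel"
  unfolding diff_energy_def by measurable

lemma ray_energy_measurable [measurable]:
  assumes [measurable]: "f \<in> borel_measurable borel"
  shows "ray_energy m p q f \<in> borel_measurable borel"
  unfolding ray_energy_def by measurable

lemma diff_energy_le:
  fixes f :: "'a::euclidean_space \<Rightarrow> real" and y h :: 'a
  assumes [measurable]: "f \<in> borel_measurable borel" and p: "p \<ge> 0"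
  shows "diff_energy m p f h
    \<le> ennreal ((2 ^ m) powr p) * (\<Sum>S\<in>Pow {1..m}. diff_energy m p f (y - (\<Sum>j\<in>S. 1 / real j) *\<^sub>R h))"
proof -
  define k where "k S = y - (\<Sum>j\<in>S. 1 / real j) *\<^sub>R h" for S
  have card: "real (card (Pow {1..m})) = 2 ^ m" by (simp add: card_Pow)
  have "diff_energy m p f h
      \<le> (\<integral>\<^sup>+x. ennreal ((2 ^ m) powr p) * (\<Sum>S\<in>Pow {1..m}. ennreal (\<bar>(diff_op (k S) ^^ m) f (x + real (card S) *\<^sub>R h)\<bar> powr p)) \<partial>lborel)"
    unfolding diff_energy_def
  proof (rule nn_integral_mono)
    fix x
    have "\<bar>(diff_op h ^^ m) f x\<bar> powr p
      = \<bar>\<Sum>S\<in>Pow {1..m}. (-1) ^ card S * (diff_op (k S) ^^ m) f (x + real (card S) *\<^sub>R h)\<bar> powr p"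
      unfolding k_def by (subst diff_op_power_decomposition[where y=y]) simp
    also have "\<dots> \<le> (2 ^ m) powr p * (\<Sum>S\<in>Pow {1..m}. \<bar>(-1) ^ card S * (diff_op (k S) ^^ m) f (x + real (card S) *\<^sub>R h)\<bar> powr p)"
      using powr_abs_sum_le[of "Pow {1..m}" p "\<lambda>S. (-1) ^ card S * (diff_op (k S) ^^ m) f (x + real (card S) *\<^sub>R h)"] p
      unfolding card by simp
    finally have "ennreal (\<bar>(diff_op h ^^ m) f x\<bar> powr p)
       \<le> ennreal ((2 ^ m) powr p * (\<Sum>S\<in>Pow {1..m}. \<bar>(diff_op (k S) ^^ m) f (x + real (card S) *\<^sub>R h)\<bar> powr p))"
      by (intro ennreal_leI) (simp add: abs_mult)
    then show "ennreal (\<bar>(diff_op h ^^ m) f x\<bar> powr p)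
       \<le> ennreal ((2 ^ m) powr p) * (\<Sum>S\<in>Pow {1..m}. ennreal (\<bar>(diff_op (k S) ^^ m) f (x + real (card S) *\<^sub>R h)\<bar> powr p))"
      by (simp add: ennreal_mult sum_nonneg)
  qed
  also have "\<dots> = ennreal ((2 ^ m) powr p) * (\<Sum>S\<in>Pow {1..m}. \<integral>\<^sup>+x. ennreal (\<bar>(diff_op (k S) ^^ m) f (x + real (card S) *\<^sub>R h)\<bar> powr p) \<partial>lborel)"
    by (subst nn_integral_cmult) (simp_all add: nn_integral_sum del: sum_ennreal)
  also have "\<dots> = ennreal ((2 ^ m) powr p) * (\<Sum>S\<in>Pow {1..m}. diff_energy m p f (k S))"
    unfolding diff_energy_def
    by (subst nn_integral_lborel_translate) simp_all
  finally show ?thesis unfolding k_def .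
qed

text \<open>The decomposition of \<open>m\<close>-th differences is linear in the steps, so it can be used at all scales \<open>t\<close> with the
  same \<open>y\<close>, scaled by \<open>t\<close>.\<close>

lemma ray_energy_le:
  fixes f :: "'a::euclidean_space \<Rightarrow> real" and y h :: 'a
  assumes [measurable]: "f \<in> borel_measurable borel" and p: "p \<ge> 0"
  shows "ray_energy m p q f h
    \<le> ennreal ((2 ^ m) powr p) * (\<Sum>S\<in>Pow {1..m}. ray_energy m p q f (y - (\<Sum>j\<in>S. 1 / real j) *\<^sub>R h))"
proof -
  define k where "k S = y - (\<Sum>j\<in>S. 1 / real j) *\<^sub>R h" for S
  define w where "w t = ennreal (t powr (- q - 1)) * indicator {0<..} t" for t :: real
  have [measurable]: "w \<in> borel_measurable borel" unfolding w_def by measurable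
  have ray: "ray_energy m p q f x = (\<integral>\<^sup>+t. w t * diff_energy m p f (t *\<^sub>R x) \<partial>lborel)" for x
    unfolding ray_energy_def w_def by (simp add: ac_simps)
  have "ray_energy m p q f h
      \<le> (\<integral>\<^sup>+t. ennreal ((2 ^ m) powr p) * (\<Sum>S\<in>Pow {1..m}. w t * diff_energy m p f (t *\<^sub>R k S)) \<partial>lborel)"
    unfolding ray
  proof (rule nn_integral_mono)
    fix t :: real
    have "w t * diff_energy m p f (t *\<^sub>R h) \<le> w t * (ennreal ((2 ^ m) powr p) *
        (\<Sum>S\<in>Pow {1..m}. diff_energy m p f (t *\<^sub>R y - (\<Sum>j\<in>S. 1 / real j) *\<^sub>R (t *\<^sub>R h))))"
      by (intro mult_left_mono diff_energy_le p) auto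
    also have "\<dots> = ennreal ((2 ^ m) powr p) * (\<Sum>S\<in>Pow {1..m}. w t * diff_energy m p f (t *\<^sub>R k S))"
      by (simp add: k_def scaleR_right_diff_distrib sum_distrib_left ac_simps)
    finally show "w t * diff_energy m p f (t *\<^sub>R h)
      \<le> ennreal ((2 ^ m) powr p) * (\<Sum>S\<in>Pow {1..m}. w t * diff_energy m p f (t *\<^sub>R k S))" .
  qed
  also have "\<dots> = ennreal ((2 ^ m) powr p) * (\<Sum>S\<in>Pow {1..m}. ray_energy m p q f (k S))"
    unfolding ray by (subst nn_integral_cmult) (simp_all add: nn_integral_sum)
  finally show ?thesis unfolding k_def .
qed

lemma ray_energy_scaleR:
  fixes f :: "'a::euclidean_space \<Rightarrow> real"
  assumes [measurable]: "f \<in> borel_measurable borel" and c: "c > 0"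
  shows "ray_energy m p q f (c *\<^sub>R x) = ennreal (c powr q) * ray_energy m p q f x"
proof -
  have "ray_energy m p q f x
      = ennreal c * (\<integral>\<^sup>+t. ennreal ((c * t) powr (- q - 1)) * diff_energy m p f ((c * t) *\<^sub>R x) * indicator {0<..} (c * t) \<partial>lborel)"
    unfolding ray_energy_def using c by (subst nn_integral_real_affine[where c=c and t=0]) auto
  also have "\<dots> = ennreal c * (\<integral>\<^sup>+t. ennreal (c powr (- q - 1)) * (ennreal (t powr (- q - 1)) * diff_energy m p f (t *\<^sub>R (c *\<^sub>R x)) * indicator {0<..} t) \<partial>lborel)"
  proof (rule arg_cong2[where f="(*)", OF refl], rule nn_integral_cong)
    fix t :: real
    show "ennreal ((c * t) powr (- q - 1)) * diff_energy m p f ((c * t) *\<^sub>R x) * indicator {0<..} (c * t)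
      = ennreal (c powr (- q - 1)) * (ennreal (t powr (- q - 1)) * diff_energy m p f (t *\<^sub>R (c *\<^sub>R x)) * indicator {0<..} t)"
    proof (cases "t > 0")
      case True
      then have "(c * t) powr (- q - 1) = c powr (- q - 1) * t powr (- q - 1)"
        using c by (simp add: powr_mult)
      moreover have tc: "t *\<^sub>R (c *\<^sub>R x) = (c * t) *\<^sub>R x" by (simp add: mult.commute)
      ultimately show ?thesis unfolding tc using True c by (simp add: ennreal_mult mult.assoc)
    next
      case False
      then have "\<not> c * t > 0" using c by (simp add: zero_less_mult_iff)
      then show ?thesis using False by simp
    qed
  qed
  also have "\<dots> = ennreal c * (ennreal (c powr (- q - 1)) * ray_energy m p q f (c *\<^sub>R x))"
    unfolding ray_energy_def by (subst nn_integral_cmult) auto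
  also have "\<dots> = ennreal (c powr (- q)) * ray_energy m p q f (c *\<^sub>R x)"
  proof -
    have "c powr (- q) = c * c powr (- q - 1)" using c by (simp add: powr_mult_base)
    then show ?thesis using c by (simp add: ennreal_mult mult.assoc)
  qed
  finally have "ennreal (c powr q) * ray_energy m p q f x
      = ennreal (c powr q) * ennreal (c powr (- q)) * ray_energy m p q f (c *\<^sub>R x)"
    by (simp add: mult.assoc)
  also have "ennreal (c powr q) * ennreal (c powr (- q)) = 1"
    using c by (simp add: ennreal_mult[symmetric] powr_add[symmetric])
  finally show ?thesis by simp
qed

lemma nn_integral_dyadic_shell:
  fixes a r :: real
  defines "g \<equiv> \<lambda>r. \<integral>\<^sup>+t. ennreal (t powr a) * indicator {r / 2<..<r} t \<partial>lborel"
  assumes r: "r > 0"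
  shows "g r = ennreal (r powr (a + 1)) * g 1"
proof -
  have "g r = ennreal r * (\<integral>\<^sup>+t. ennreal ((r * t) powr a) * indicator {r / 2<..<r} (r * t) \<partial>lborel)"
    unfolding g_def using r by (subst nn_integral_real_affine[where c=r and t=0]) auto
  also have "\<dots> = ennreal r * (\<integral>\<^sup>+t. ennreal (r powr a) * (ennreal (t powr a) * indicator {1 / 2<..<1} t) \<partial>lborel)"
  proof (rule arg_cong2[where f="(*)", OF refl], rule nn_integral_cong)
    fix t :: real
    have "r * t \<in> {r / 2<..<r} \<longleftrightarrow> t \<in> {1 / 2<..<1}" using r by (auto simp: field_simps)
    then have "indicator {r / 2<..<r} (r * t) = (indicator {1 / 2<..<1} t :: ennreal)"
      by (simp only: indicator_def)
    moreover have "ennreal ((r * t) powr a) = ennreal (r powr a) * ennreal (t powr a)" if "t > 1/2"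
      using that r by (simp add: powr_mult ennreal_mult)
    ultimately show "ennreal ((r * t) powr a) * indicator {r / 2<..<r} (r * t)
        = ennreal (r powr a) * (ennreal (t powr a) * indicator {1 / 2<..<1} t)"
      by (cases "t > 1/2") (simp_all add: mult.assoc)
  qed
  also have "\<dots> = ennreal r * (ennreal (r powr a) * g 1)"
    unfolding g_def by (subst nn_integral_cmult) auto
  also have "\<dots> = ennreal (r powr (a + 1)) * g 1"
  proof -
    have "r powr (a + 1) = r * r powr a" using r by (simp add: powr_mult_base add.commute)
    then show ?thesis using r by (simp add: ennreal_mult mult.assoc)
  qed
  finally show ?thesis .
qed

lemma nn_integral_dyadic_shell_1:
  assumes "a \<le> 0"
  shows "(\<integral>\<^sup>+t. ennreal (t powr a) * indicator {1 / 2<..<1::real} t \<partial>lborel) \<noteq> 0"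
    "(\<integral>\<^sup>+t. ennreal (t powr a) * indicator {1 / 2<..<1::real} t \<partial>lborel) < \<infinity>"
proof -
  let ?I = "\<integral>\<^sup>+t. ennreal (t powr a) * indicator {1 / 2<..<1::real} t \<partial>lborel"
  have "ennreal (1/2) = (\<integral>\<^sup>+t. indicator {1 / 2<..<1::real} t \<partial>lborel)" by simp
  also have "\<dots> \<le> ?I"
  proof (rule nn_integral_mono)
    fix t :: real
    have "1 \<le> t powr a" if "1/2 < t" "t < 1"
      using powr_mono'[of a 0 t] that assms by simp
    then show "indicator {1 / 2<..<1} t \<le> ennreal (t powr a) * indicator {1 / 2<..<1} t"
      by (auto simp: indicator_def)
  qed
  finally have "ennreal (1/2) \<le> ?I" .
  moreover have "0 < ennreal (1/2)" by (subst ennreal_less_zero_iff) simp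
  ultimately show "?I \<noteq> 0" by (metis not_less order_refl)
  have "?I \<le> (\<integral>\<^sup>+t. ennreal ((1/2) powr a) * indicator {1 / 2<..<1::real} t \<partial>lborel)"
  proof (rule nn_integral_mono)
    fix t :: real
    have "t powr a \<le> (1/2) powr a" if "1/2 < t" "t < 1"
      using that assms by (intro powr_mono2') auto
    then show "ennreal (t powr a) * indicator {1 / 2<..<1} t \<le> ennreal ((1/2) powr a) * indicator {1 / 2<..<1} t"
      by (auto simp: indicator_def intro: ennreal_leI)
  qed
  also have "\<dots> = ennreal ((1/2) powr a) * ennreal (1/2)" by (subst nn_integral_cmult) auto
  also have "\<dots> = ennreal ((1/2) powr a * (1/2))" by (rule ennreal_mult[symmetric]) auto
  finally show "?I < \<infinity>" using ennreal_less_top le_less_trans by (metis infinity_ennreal_def)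
qed

text \<open>Exchange the integrals over \<open>x\<close> and \<open>t\<close>, substitute \<open>y = t x\<close> and exchange again. For fixed \<open>y\<close>, the
  scales with \<open>1 < norm (y/t) < 2\<close> form the dyadic shell \<open>norm y / 2 < t < norm y\<close>, over which a power of \<open>t\<close> integrates
  to a constant times a power of \<open>norm y\<close>.\<close>

lemma ray_energy_annulus_integral:
  fixes f :: "'a::euclidean_space \<Rightarrow> real"
  assumes f [measurable]: "f \<in> borel_measurable borel"
  defines "a \<equiv> \<lambda>q. - q - 1 - real DIM('a)"
  shows "(\<integral>\<^sup>+x\<in>{x. 1 < norm x \<and> norm x < 2}. ray_energy m p q f x \<partial>lborel)
    = (\<integral>\<^sup>+t. ennreal (t powr a q) * indicator {1 / 2<..<1} t \<partial>lborel)
      * (\<integral>\<^sup>+h. diff_energy m p f h / ennreal (norm h powr (q + real DIM('a))) \<partial>lborel)"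
proof -
  define F where "F = diff_energy m p f"
  have [measurable]: "F \<in> borel_measurable borel" unfolding F_def by measurable
  define w where "w t = ennreal (t powr (- q - 1)) * indicator {0<..} t" for t :: real
  have [measurable]: "w \<in> borel_measurable borel" unfolding w_def by measurable
  define A where "A = {x :: 'a. 1 < norm x \<and> norm x < 2}"
  have [measurable]: "A \<in> sets borel" unfolding A_def by measurable
  define c where "c = (\<integral>\<^sup>+t. ennreal (t powr a q) * indicator {1 / 2<..<1::real} t \<partial>lborel)"
  have "(\<integral>\<^sup>+x\<in>A. ray_energy m p q f x \<partial>lborel)
      = (\<integral>\<^sup>+x. \<integral>\<^sup>+t. w t * F (t *\<^sub>R x) * indicator A x \<partial>lborel \<partial>lborel)"
  proof (rule nn_integral_cong)
    fix x :: 'a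
    have "ray_energy m p q f x = (\<integral>\<^sup>+t. w t * F (t *\<^sub>R x) \<partial>lborel)"
      by (simp add: ray_energy_def w_def F_def ac_simps)
    then show "ray_energy m p q f x * indicator A x = (\<integral>\<^sup>+t. w t * F (t *\<^sub>R x) * indicator A x \<partial>lborel)"
      by (simp add: nn_integral_multc)
  qed
  also have "\<dots> = (\<integral>\<^sup>+t. \<integral>\<^sup>+x. w t * F (t *\<^sub>R x) * indicator A x \<partial>lborel \<partial>lborel)"
    by (rule lborel_pair.Fubini') measurable
  also have "\<dots> = (\<integral>\<^sup>+t. \<integral>\<^sup>+y. F y * (ennreal (t powr a q) * indicator {norm y / 2<..<norm y} t) \<partial>lborel \<partial>lborel)"
  proof (rule nn_integral_cong)
    fix t :: real
    show "(\<integral>\<^sup>+x. w t * F (t *\<^sub>R x) * indicator A x \<partial>lborel)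
        = (\<integral>\<^sup>+y. F y * (ennreal (t powr a q) * indicator {norm y / 2<..<norm y} t) \<partial>lborel)"
    proof (cases "t > 0")
      case False
      then have "indicator {norm y / 2<..<norm y} t = (0::ennreal)" for y :: 'a
        using norm_ge_zero[of y] by (auto simp: indicator_def)
      then show ?thesis using False by (simp add: w_def)
    next
      case t: True
      have pw: "t ^ DIM('a) * t powr a q = t powr (- q - 1)"
        using t by (simp add: a_def powr_realpow[symmetric] powr_add[symmetric])
      have "(\<integral>\<^sup>+y. F y * (ennreal (t powr a q) * indicator {norm y / 2<..<norm y} t) \<partial>lborel)
          = ennreal (t ^ DIM('a)) * (\<integral>\<^sup>+x. F (t *\<^sub>R x) * (ennreal (t powr a q) * indicator {norm (t *\<^sub>R x) / 2<..<norm (t *\<^sub>R x)} t) \<partial>lborel)"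
      proof (rule nn_integral_lborel_scaleR[OF _ t])
        have eq: "indicator {norm y / 2<..<norm y} t = (indicator {y. norm y / 2 < t \<and> t < norm y} y :: ennreal)" for y :: 'a
          by (simp add: indicator_def)
        show "(\<lambda>y. F y * (ennreal (t powr a q) * indicator {norm y / 2<..<norm y} t)) \<in> borel_measurable borel"
          unfolding eq by measurable
      qed
      also have "\<dots> = ennreal (t ^ DIM('a)) * (\<integral>\<^sup>+x. ennreal (t powr a q) * (F (t *\<^sub>R x) * indicator A x) \<partial>lborel)"
      proof (rule arg_cong2[where f="(*)", OF refl], rule nn_integral_cong)
        fix x :: 'a
        have "t \<in> {norm (t *\<^sub>R x) / 2<..<norm (t *\<^sub>R x)} \<longleftrightarrow> x \<in> A"
          using t by (auto simp: A_def)
        then have "indicator {norm (t *\<^sub>R x) / 2<..<norm (t *\<^sub>R x)} t = (indicator A x :: ennreal)"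
          by (simp only: indicator_def)
        then show "F (t *\<^sub>R x) * (ennreal (t powr a q) * indicator {norm (t *\<^sub>R x) / 2<..<norm (t *\<^sub>R x)} t)
            = ennreal (t powr a q) * (F (t *\<^sub>R x) * indicator A x)"
          by (simp only: mult.left_commute)
      qed
      also have "\<dots> = ennreal (t ^ DIM('a)) * ennreal (t powr a q) * (\<integral>\<^sup>+x. F (t *\<^sub>R x) * indicator A x \<partial>lborel)"
        by (subst nn_integral_cmult) (auto simp: mult.assoc)
      also have "ennreal (t ^ DIM('a)) * ennreal (t powr a q) = w t"
        using t pw by (simp add: w_def ennreal_mult[symmetric])
      also have "w t * (\<integral>\<^sup>+x. F (t *\<^sub>R x) * indicator A x \<partial>lborel) = (\<integral>\<^sup>+x. w t * F (t *\<^sub>R x) * indicator A x \<partial>lborel)"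
        by (subst nn_integral_cmult[symmetric]) (auto simp: mult.assoc)
      finally show ?thesis by simp
    qed
  qed
  also have "\<dots> = (\<integral>\<^sup>+y. \<integral>\<^sup>+t. F y * (ennreal (t powr a q) * indicator {norm y / 2<..<norm y} t) \<partial>lborel \<partial>lborel)"
  proof (rule lborel_pair.Fubini')
    have eq: "indicator {norm y / 2<..<norm y} t = (indicator {z. norm (fst z) / 2 < snd z \<and> snd z < norm (fst z)} (y, t) :: ennreal)"
      for t and y :: 'a
      by (simp add: indicator_def)
    show "(\<lambda>(y, t). F y * (ennreal (t powr a q) * indicator {norm y / 2<..<norm y} t)) \<in> borel_measurable (lborel \<Otimes>\<^sub>M lborel)"
      unfolding eq by measurable
  qed
  also have "\<dots> = (\<integral>\<^sup>+y. c * (F y / ennreal (norm y powr (q + real DIM('a)))) \<partial>lborel)"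
  proof (rule nn_integral_cong_AE)
    have "AE y in lborel. y \<noteq> (0::'a)" by (rule AE_lborel_singleton)
    then show "AE y in lborel. (\<integral>\<^sup>+t. F y * (ennreal (t powr a q) * indicator {norm y / 2<..<norm y} t) \<partial>lborel)
        = c * (F y / ennreal (norm y powr (q + real DIM('a))))"
    proof eventually_elim
      case (elim y)
      have "(\<integral>\<^sup>+t. F y * (ennreal (t powr a q) * indicator {norm y / 2<..<norm y} t) \<partial>lborel)
          = F y * (ennreal (norm y powr (a q + 1)) * c)"
        using nn_integral_dyadic_shell[of "norm y" "a q"] elim by (subst nn_integral_cmult) (auto simp: c_def)
      also have "ennreal (norm y powr (a q + 1)) = inverse (ennreal (norm y powr (q + real DIM('a))))"
      proof -
        have "norm y powr (a q + 1) = inverse (norm y powr (q + real DIM('a)))"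
          by (simp add: a_def powr_minus[symmetric])
        then show ?thesis using elim by (simp add: inverse_ennreal)
      qed
      finally show ?case by (simp add: divide_ennreal_def ac_simps)
    qed
  qed
  also have "\<dots> = c * (\<integral>\<^sup>+y. F y / ennreal (norm y powr (q + real DIM('a))) \<partial>lborel)"
    by (rule nn_integral_cmult) measurable
  finally show ?thesis unfolding A_def c_def F_def .
qed

section \<open>Non-integer order\<close>

lemma L1_loc_measurable:
  fixes f :: "'a::euclidean_space \<Rightarrow> real"
  assumes "f \<in> L1_loc"
  shows "f \<in> borel_measurable lebesgue"
proof (rule borel_measurable_LIMSEQ_real)
  fix n :: nat
  have "f absolutely_integrable_on cball 0 (real n)" using assms by (simp add: L1_loc_def)
  then have "integrable lebesgue (\<lambda>x. indicat_real (cball 0 (real n)) x *\<^sub>R f x)"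
    by (simp add: set_integrable_def)
  then show "(\<lambda>x. indicat_real (cball 0 (real n)) x *\<^sub>R f x) \<in> borel_measurable lebesgue"
    by (rule borel_measurable_integrable)
next
  fix x :: 'a
  obtain N :: nat where N: "norm x \<le> real N" using real_arch_simple by blast
  have "\<forall>\<^sub>F n in sequentially. indicat_real (cball 0 (real n)) x *\<^sub>R f x = f x"
    using eventually_ge_at_top[of N]
  proof eventually_elim
    case (elim n)
    then show ?case using N by (simp add: indicator_def)
  qed
  then show "(\<lambda>n. indicat_real (cball 0 (real n)) x *\<^sub>R f x) \<longlonglongrightarrow> f x"
    by (rule tendsto_eventually)
qed

text \<open>Joint measurability of \<open>f (x + h)\<close> in \<open>(x, h)\<close> is available for Borel functions only, hence the passage to a
  Borel representative.\<close>

lemma L1_loc_borel_version: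
  fixes f :: "'a::euclidean_space \<Rightarrow> real"
  assumes "f \<in> L1_loc"
  obtains g where "g \<in> borel_measurable borel" "AE x in lborel. f x = g x"
  using completion_ex_borel_measurable_real[OF L1_loc_measurable[OF assms]] by auto

lemma AE_lborel_translate:
  fixes c :: "'a::euclidean_space"
  assumes "AE x in lborel. P x"
  shows "AE x in lborel. P (x + c)"
proof -
  obtain N where N: "N \<in> null_sets lborel" "{x. \<not> P x} \<subseteq> N"
    using assms by (auto elim!: AE_E simp: null_sets_def)
  then have [measurable]: "N \<in> sets borel" by auto
  have "(\<lambda>x. x + c) -` N \<in> sets borel" using measurable_sets_borel[of "\<lambda>x. x + c" borel N] by simp
  moreover have "emeasure lborel ((\<lambda>x. x + c) -` N) = 0"
  proof -
    have "emeasure lborel N = emeasure (distr lborel borel ((+) c)) N" by (simp add: lborel_distr_plus)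
    also have "\<dots> = emeasure lborel ((\<lambda>x. x + c) -` N)"
      by (subst emeasure_distr) (auto simp: add.commute[of c, abs_def] vimage_def)
    finally show ?thesis using N(1) by auto
  qed
  ultimately have "(\<lambda>x. x + c) -` N \<in> null_sets lborel" by (simp add: null_sets_def)
  then show ?thesis using N(2) by (intro AE_I'[of "(\<lambda>x. x + c) -` N"]) auto
qed

lemma diff_energy_cong_AE:
  fixes f g :: "'a::euclidean_space \<Rightarrow> real"
  assumes "AE x in lborel. f x = g x"
  shows "diff_energy m p f = diff_energy m p g"
proof
  fix h
  have "AE x in lborel. \<forall>k\<in>{..m}. f (x + real k *\<^sub>R h) = g (x + real k *\<^sub>R h)"
    by (intro AE_finite_allI AE_lborel_translate[OF assms]) auto
  then show "diff_energy m p f h = diff_energy m p g h"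
    unfolding diff_energy_def
    by (intro nn_integral_cong_AE) (auto elim!: eventually_mono simp: diff_op_power_eq)
qed

lemma epow_epow_inverse: "p > 0 \<Longrightarrow> epow (epow X (1 / p)) p = X"
  by (cases X) (auto simp: epow_def powr_powr ennreal_eq_0_iff powr_eq_0_iff)

lemma Lp_norm_diff_op_power:
  "p > 0 \<Longrightarrow> epow (Lp_norm p ((diff_op h ^^ m) f)) p = diff_energy m p f h"
  by (simp add: Lp_norm_def epow_epow_inverse diff_energy_def nn_integral_completion)

lemma direction_energy_nonint:
  assumes "s \<notin> \<int>" "p > 0"
  shows "direction_energy s p f = ray_energy (nat \<lfloor>s\<rfloor> + 1) p (s * p) f"
  using assms unfolding direction_energy_def ray_energy_def
  by (auto simp: nn_integral_completion Lp_norm_diff_op_power simp del: funpow.simps)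

lemma epow_less_top_iff: "a > 0 \<Longrightarrow> epow x a < \<infinity> \<longleftrightarrow> x < \<infinity>"
  using epow_eq_top_iff[of a x] by (simp add: less_top[symmetric])

lemma W_seminorm_nonint_finite_iff:
  fixes f :: "'a::euclidean_space \<Rightarrow> real"
  assumes "s \<notin> \<int>" "p > 0"
  shows "W_seminorm s p f < \<infinity> \<longleftrightarrow>
    (\<integral>\<^sup>+h. diff_energy (nat \<lfloor>s\<rfloor> + 1) p f h / ennreal (norm h powr (s * p + real DIM('a))) \<partial>lborel) < \<infinity>"
  using assms unfolding W_seminorm_def
  by (subst epow_less_top_iff) (auto simp: nn_integral_completion Lp_norm_diff_op_power simp del: funpow.simps)

text \<open>Some sublevel set \<open>E k\<close> of the energy has positive measure. For each \<open>h\<close> of a fixed small norm \<open>r\<close> some \<open>y\<close>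
  puts all steps \<open>y - c S h\<close> into \<open>E k\<close>, which bounds the energy at \<open>h\<close> uniformly; homogeneity carries the bound
  over to the annulus.\<close>

lemma ray_energy_bounded_on_annulus:
  fixes f :: "'a::euclidean_space \<Rightarrow> real"
  assumes [measurable]: "f \<in> borel_measurable borel" and p: "p \<ge> 0" and q: "q \<ge> 0"
    and pos: "emeasure lborel {x. 1 < norm x \<and> norm x < 2 \<and> ray_energy m p q f x < \<infinity>} \<noteq> 0"
  obtains B where "B < \<infinity>" "\<And>x. 1 < norm x \<Longrightarrow> norm x < 2 \<Longrightarrow> ray_energy m p q f x \<le> B"
proof -
  define I where "I = ray_energy m p q f"
  have [measurable]: "I \<in> borel_measurable borel" unfolding I_def by measurable
  define E where "E k = {x. 1 < norm x \<and> norm x < 2 \<and> I x \<le> of_nat k}" for k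
  have [measurable]: "E k \<in> sets borel" for k unfolding E_def by measurable
  obtain k where k: "emeasure lborel (E k) \<noteq> 0"
  proof (rule ccontr)
    assume "\<not> thesis"
    then have *: "E k \<in> null_sets lborel" for k using that by (auto simp: null_sets_def)
    have null: "(\<Union>k. E k) \<in> null_sets lborel" by (intro null_sets_UN *)
    have sub: "{x. 1 < norm x \<and> norm x < 2 \<and> I x < \<infinity>} \<subseteq> (\<Union>k. E k)"
    proof
      fix x assume x: "x \<in> {x. 1 < norm x \<and> norm x < 2 \<and> I x < \<infinity>}"
      then obtain k where "I x < of_nat k" using ennreal_Ex_less_of_nat[of "I x"] by auto
      then show "x \<in> (\<Union>k. E k)" using x by (auto simp: E_def intro!: exI[of _ k])
    qed
    have "{x. 1 < norm x \<and> norm x < 2 \<and> I x < \<infinity>} \<in> null_sets lborel"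
      by (rule null_sets_subset[OF null _ sub]) measurable
    then show False using pos by (auto simp: I_def)
  qed
  \<comment> \<open>one step for each subset of \<open>{1..m}\<close>\<close>
  have "\<exists>\<delta>>0. \<forall>T. finite T \<and> card T \<le> 2 ^ m \<and> T \<subseteq> ball 0 \<delta> \<longrightarrow> (\<exists>y. \<forall>h\<in>T. y + h \<in> E k)"
    by (rule exists_common_translate) (use k in auto)
  then obtain \<delta> where \<delta>: "\<delta> > 0"
    "\<forall>T. finite T \<and> card T \<le> 2 ^ m \<and> T \<subseteq> ball 0 \<delta> \<longrightarrow> (\<exists>y. \<forall>h\<in>T. y + h \<in> E k)"
    by (elim exE conjE) (rule that)
  \<comment> \<open>\<open>c S \<le> m\<close> below, so the multiples \<open>c S h\<close> of a vector of norm \<open>r\<close> stay in the ball of radius \<open>\<delta>\<close>\<close>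
  define r where "r = \<delta> / (real m + 1)"
  have r: "r > 0" using \<delta>(1) by (simp add: r_def)
  define c where "c S = (\<Sum>j\<in>S. 1 / real j)" for S :: "nat set"
  define C where "C = ennreal ((2 ^ m) powr p) * (\<Sum>S\<in>Pow {1..m}. of_nat k)"
  have small: "I h \<le> C" if h: "norm h = r" for h
  proof -
    define T where "T = (\<lambda>S. - (c S *\<^sub>R h)) ` Pow {1..m}"
    have "finite T" by (simp add: T_def)
    moreover have "card T \<le> 2 ^ m"
      unfolding T_def using card_image_le[of "Pow {1..m}" "\<lambda>S. - (c S *\<^sub>R h)"] by (simp add: card_Pow)
    moreover have "T \<subseteq> ball 0 \<delta>"
    proof
      fix t assume "t \<in> T"
      then obtain S where S: "S \<subseteq> {1..m}" "t = - (c S *\<^sub>R h)" by (auto simp: T_def)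
      have "c S \<le> (\<Sum>j\<in>S. 1)" unfolding c_def using S(1) by (intro sum_mono) auto
      also have "\<dots> \<le> real m" using card_mono[OF _ S(1)] by simp
      finally have c: "c S \<le> real m" .
      have "c S \<ge> 0" unfolding c_def by (intro sum_nonneg) auto
      then have "norm t = c S * r" using S(2) h by simp
      also have "\<dots> \<le> real m * r" using c r by (intro mult_right_mono) auto
      also have "\<dots> < \<delta>" using \<delta>(1) by (simp add: r_def field_simps)
      finally show "t \<in> ball 0 \<delta>" by simp
    qed
    ultimately have "\<exists>y. \<forall>t\<in>T. y + t \<in> E k" using \<delta>(2)[rule_format, of T] by simp
    then obtain y where y: "\<forall>t\<in>T. y + t \<in> E k" ..
    have "I h \<le> ennreal ((2 ^ m) powr p) * (\<Sum>S\<in>Pow {1..m}. I (y - c S *\<^sub>R h))"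
      unfolding I_def c_def by (rule ray_energy_le[OF _ p]) auto
    also have "\<dots> \<le> C"
      unfolding C_def
    proof (intro mult_left_mono sum_mono)
      fix S assume "S \<in> Pow {1..m}"
      then have "y + - (c S *\<^sub>R h) \<in> E k" using y by (auto simp: T_def)
      then show "I (y - c S *\<^sub>R h) \<le> of_nat k" by (simp add: E_def)
    qed auto
    finally show ?thesis .
  qed
  show thesis
  proof (rule that[of "ennreal ((2 / r) powr q) * C"])
    have "(\<Sum>S\<in>Pow {1..m}. of_nat k :: ennreal) = (\<Sum>S\<in>Pow {1..m}. ennreal (real k))"
      by (simp only: ennreal_of_nat_eq_real_of_nat)
    also have "\<dots> = ennreal (\<Sum>S\<in>Pow {1..m}. real k)" by (rule sum_ennreal) simp
    finally have "C = ennreal ((2 ^ m) powr p) * ennreal (\<Sum>S\<in>Pow {1..m}. real k)"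
      unfolding C_def by (rule arg_cong)
    then have "C < \<infinity>"
      unfolding infinity_ennreal_def by (simp only: ennreal_mult_less_top ennreal_less_top simp_thms)
    then show "ennreal ((2 / r) powr q) * C < \<infinity>" by (simp add: ennreal_mult_less_top)
    fix x :: 'a assume x: "1 < norm x" "norm x < 2"
    define h where "h = (r / norm x) *\<^sub>R x"
    have "norm h = r" "x = (norm x / r) *\<^sub>R h" using x r by (auto simp: h_def)
    from this(2) have "I x = I ((norm x / r) *\<^sub>R h)" by (rule arg_cong)
    also have "\<dots> = ennreal ((norm x / r) powr q) * I h"
      unfolding I_def by (intro ray_energy_scaleR divide_pos_pos assms(1) r order.strict_trans[OF zero_less_one x(1)])
    also have "\<dots> \<le> ennreal ((2 / r) powr q) * C"
      using small[OF \<open>norm h = r\<close>] x r q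
      by (intro mult_mono ennreal_leI powr_mono2 divide_right_mono) auto
    finally show "ray_energy m p q f x \<le> ennreal ((2 / r) powr q) * C" by (simp add: I_def)
  qed
qed

text \<open>Finiteness of the semi-norm amounts to integrability of the ray energy over the annulus. Integrability gives
  finiteness almost everywhere; conversely, finiteness on a set of positive measure already gives
  boundedness.\<close>

lemma finite_seminorm_iff_finite_affine_energy_nonint:
  fixes f :: "'a::euclidean_space \<Rightarrow> real"
  assumes dim: "DIM('a) \<ge> 2" and p: "p \<ge> 1" and s: "s > 0" "s \<notin> \<int>" and f: "f \<in> L1_loc"
  shows "W_seminorm s p f < \<infinity> \<longleftrightarrow> affine_energy s p f < \<infinity>"
proof -
  define m where "m = nat \<lfloor>s\<rfloor> + 1"
  define q where "q = s * p"
  have q: "q > 0" using s p by (simp add: q_def)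
  obtain g where g [measurable]: "g \<in> borel_measurable borel" and fg: "AE x in lborel. f x = g x"
    using L1_loc_borel_version[OF f] .
  have D: "diff_energy m p f = diff_energy m p g" by (rule diff_energy_cong_AE[OF fg])
  then have dir: "direction_energy s p f = ray_energy m p q g"
    using direction_energy_nonint[OF s(2), of p f] p unfolding ray_energy_def m_def q_def by auto
  define I where "I = ray_energy m p q g"
  have [measurable]: "I \<in> borel_measurable borel" unfolding I_def by measurable
  define A where "A = {x :: 'a. 1 < norm x \<and> norm x < 2}"
  have [measurable]: "A \<in> sets borel" unfolding A_def by measurable
  have Afin: "emeasure lborel A < \<infinity>"
  proof -
    have "emeasure lborel A \<le> emeasure lborel (ball 0 2 :: 'a set)" by (rule emeasure_mono) (auto simp: A_def)
    then show ?thesis using emeasure_lborel_ball_finite[of "0::'a" 2] by (simp add: le_less_trans)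
  qed
  have Apos: "emeasure lborel A \<noteq> 0"
  proof -
    obtain b :: 'a where b: "norm b = 1" using SOME_Basis norm_Basis by blast
    have "open A" unfolding A_def
      by (intro open_Collect_conj open_Collect_less continuous_intros)
    moreover have "(3/2) *\<^sub>R b \<in> A" using b by (simp add: A_def)
    ultimately have "\<not> negligible A" using open_not_negligible by blast
    then show ?thesis by (simp add: negligible_iff_null_sets null_sets_def)
  qed
  have "W_seminorm s p f < \<infinity> \<longleftrightarrow>
    (\<integral>\<^sup>+h. diff_energy m p g h / ennreal (norm h powr (q + real DIM('a))) \<partial>lborel) < \<infinity>"
    using W_seminorm_nonint_finite_iff[OF s(2), of p f] p D unfolding m_def q_def by simp
  also have "\<dots> \<longleftrightarrow> (\<integral>\<^sup>+x\<in>A. I x \<partial>lborel) < \<infinity>"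
    unfolding A_def I_def ray_energy_annulus_integral[OF g]
    using nn_integral_dyadic_shell_1[of "- q - 1 - real DIM('a)"] q
    by (auto simp: ennreal_mult_less_top less_top)
  also have "\<dots> \<longleftrightarrow> emeasure lborel {x. 1 < norm x \<and> norm x < 2 \<and> I x < \<infinity>} \<noteq> 0"
  proof
    assume fin: "(\<integral>\<^sup>+x\<in>A. I x \<partial>lborel) < \<infinity>"
    have "AE x in lborel. I x * indicator A x \<noteq> \<infinity>"
      by (rule nn_integral_PInf_AE) (use fin in auto)
    then have "emeasure lborel {x. 1 < norm x \<and> norm x < 2 \<and> I x < \<infinity>} = emeasure lborel A"
      by (intro emeasure_eq_AE) (auto simp: A_def less_top indicator_def elim!: eventually_mono)
    then show "emeasure lborel {x. 1 < norm x \<and> norm x < 2 \<and> I x < \<infinity>} \<noteq> 0" using Apos by simp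
  next
    assume "emeasure lborel {x. 1 < norm x \<and> norm x < 2 \<and> I x < \<infinity>} \<noteq> 0"
    then obtain B where B: "B < \<infinity>" "\<And>x. 1 < norm x \<Longrightarrow> norm x < 2 \<Longrightarrow> I x \<le> B"
      unfolding I_def using ray_energy_bounded_on_annulus[OF g, of p q m] p q by auto
    have "(\<integral>\<^sup>+x\<in>A. I x \<partial>lborel) \<le> (\<integral>\<^sup>+x\<in>A. B \<partial>lborel)"
      using B(2) by (intro nn_integral_mono) (auto simp: A_def indicator_def)
    also have "\<dots> = B * emeasure lborel A" by (simp add: nn_integral_cmult_indicator)
    also have "\<dots> < \<infinity>" using B(1) Afin by (simp add: ennreal_mult_less_top)
    finally show "(\<integral>\<^sup>+x\<in>A. I x \<partial>lborel) < \<infinity>" .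
  qed
  also have "\<dots> \<longleftrightarrow> affine_energy s p f < \<infinity>"
  proof -
    have "I x < \<infinity> \<longleftrightarrow> I (c *\<^sub>R x) < \<infinity>" if "c > 0" for c x
      using ray_energy_scaleR[OF g that, of m p q x] that
      by (auto simp: I_def ennreal_mult_less_top)
    from affine_integral_finite_iff[OF dim \<open>I \<in> borel_measurable borel\<close> this,
        of "(real DIM('a) + s * p) / (real DIM('a) * p)" "real DIM('a) / (s * p)" "s / real DIM('a)"]
    show ?thesis
      using s p unfolding affine_energy_def Let_def dir I_def by (simp add: add_pos_pos)
  qed
  finally show ?thesis .
qed

section \<open>Commuting directional derivatives\<close>

lemma dir_deriv_eqI: "(f has_derivative f') (at x) \<Longrightarrow> dir_deriv v f x = f' v"
  unfolding dir_deriv_def using frechet_derivative_at by metis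

lemma has_derivative_dir_deriv:
  "f differentiable (at x) \<Longrightarrow> (f has_derivative (\<lambda>v. dir_deriv v f x)) (at x)"
  unfolding dir_deriv_def by (simp add: frechet_derivative_works)

lemma C_diff_continuous: "C_diff k f \<Longrightarrow> continuous_on UNIV f"
  by (cases k) (auto intro!: continuous_at_imp_continuous_on differentiable_imp_continuous_within)

lemma C_diff_Suc_D: "C_diff (Suc k) f \<Longrightarrow> C_diff k f"
proof (induction k arbitrary: f)
  case 0
  then show ?case using C_diff_continuous by (auto simp del: C_diff.simps(2))
next
  case (Suc k)
  then show ?case using C_diff.simps(2) by blast
qed

lemma C_diff_const [simp]: "C_diff k (\<lambda>_. c)"
proof (induction k arbitrary: c)
  case (Suc k)
  have "dir_deriv v (\<lambda>_::'a. c) = (\<lambda>_. 0)" for v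
    by (auto simp: dir_deriv_def)
  then show ?case using Suc by simp
qed simp

lemma C_diff_add: "C_diff k f \<Longrightarrow> C_diff k g \<Longrightarrow> C_diff k (\<lambda>x. f x + g x)"
proof (induction k arbitrary: f g)
  case 0
  then show ?case by (auto intro: continuous_intros)
next
  case (Suc k)
  have "dir_deriv v (\<lambda>x. f x + g x) = (\<lambda>x. dir_deriv v f x + dir_deriv v g x)" for v
  proof
    fix x
    show "dir_deriv v (\<lambda>x. f x + g x) x = dir_deriv v f x + dir_deriv v g x"
      by (rule dir_deriv_eqI[OF has_derivative_add]; rule has_derivative_dir_deriv) (use Suc in auto)
  qed
  then show ?case using Suc by (auto intro: differentiable_add)
qed

lemma C_diff_mult: "C_diff k f \<Longrightarrow> C_diff k g \<Longrightarrow> C_diff k (\<lambda>x. f x * g x)"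
proof (induction k arbitrary: f g)
  case 0
  then show ?case by (auto intro: continuous_intros)
next
  case (Suc k)
  have "dir_deriv v (\<lambda>x. f x * g x) = (\<lambda>x. f x * dir_deriv v g x + dir_deriv v f x * g x)" for v
  proof
    fix x
    show "dir_deriv v (\<lambda>x. f x * g x) x = f x * dir_deriv v g x + dir_deriv v f x * g x"
      by (rule dir_deriv_eqI[OF has_derivative_mult]; rule has_derivative_dir_deriv) (use Suc in auto)
  qed
  moreover have "C_diff k f" "C_diff k g" using Suc.prems by (auto dest: C_diff_Suc_D simp del: C_diff.simps)
  ultimately show ?case using Suc by (auto intro!: C_diff_add)
qed

lemma C_diff_prod: "finite A \<Longrightarrow> (\<And>i. i \<in> A \<Longrightarrow> C_diff k (f i)) \<Longrightarrow> C_diff k (\<lambda>x. \<Prod>i\<in>A. f i x)"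
  by (induction A rule: finite_induct) (auto intro!: C_diff_mult simp del: C_diff.simps)

lemma DERIV_along_line:
  fixes f :: "'a::euclidean_space \<Rightarrow> real"
  assumes "f differentiable (at (x + s *\<^sub>R v))"
  shows "((\<lambda>s. f (x + s *\<^sub>R v)) has_real_derivative dir_deriv v f (x + s *\<^sub>R v)) (at s)"
proof -
  have f': "(f has_derivative frechet_derivative f (at (x + s *\<^sub>R v))) (at (x + s *\<^sub>R v))"
    using assms by (simp add: frechet_derivative_works)
  have "((\<lambda>s. x + s *\<^sub>R v) has_derivative (\<lambda>r. r *\<^sub>R v)) (at s)"
    by (auto intro!: derivative_eq_intros)
  from has_derivative_compose[OF this f']
  show ?thesis
    using linear_frechet_derivative[OF assms]
    by (simp add: has_field_derivative_def dir_deriv_def linear_scale mult_commute_abs)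
qed

text \<open>Applying the mean value theorem first in direction \<open>v\<close> and then in direction \<open>w\<close> leads to the mixed derivative in this
  order; the left-hand side is symmetric in \<open>v\<close> and \<open>w\<close>.\<close>

lemma second_difference_mean_value:
  fixes f :: "'a::euclidean_space \<Rightarrow> real"
  assumes f: "\<And>x. f differentiable (at x)" "\<And>x. dir_deriv v f differentiable (at x)" and h: "h > 0"
  obtains s t where "0 < s" "s < h" "0 < t" "t < h"
    "f (x + h *\<^sub>R v + h *\<^sub>R w) - f (x + h *\<^sub>R v) - f (x + h *\<^sub>R w) + f x
       = h * h * dir_deriv w (dir_deriv v f) (x + s *\<^sub>R v + t *\<^sub>R w)"
proof -
  let ?\<phi> = "\<lambda>s. f (x + h *\<^sub>R w + s *\<^sub>R v) - f (x + s *\<^sub>R v)"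
  obtain s where s: "0 < s" "s < h"
    "?\<phi> h - ?\<phi> 0 = (h - 0) * (dir_deriv v f (x + h *\<^sub>R w + s *\<^sub>R v) - dir_deriv v f (x + s *\<^sub>R v))"
    using MVT2[OF h, of ?\<phi> "\<lambda>s. dir_deriv v f (x + h *\<^sub>R w + s *\<^sub>R v) - dir_deriv v f (x + s *\<^sub>R v)"]
      DERIV_diff[OF DERIV_along_line DERIV_along_line] f(1) by blast
  obtain t where t: "0 < t" "t < h"
    "dir_deriv v f (x + s *\<^sub>R v + h *\<^sub>R w) - dir_deriv v f (x + s *\<^sub>R v + 0 *\<^sub>R w)
      = (h - 0) * dir_deriv w (dir_deriv v f) (x + s *\<^sub>R v + t *\<^sub>R w)"
    using MVT2[OF h, of "\<lambda>t. dir_deriv v f (x + s *\<^sub>R v + t *\<^sub>R w)"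
        "\<lambda>t. dir_deriv w (dir_deriv v f) (x + s *\<^sub>R v + t *\<^sub>R w)"]
      DERIV_along_line f(2) by blast
  show thesis
    by (rule that[OF s(1,2) t(1,2)]) (use s(3) t(3) in \<open>simp add: algebra_simps\<close>)
qed

text \<open>Divide the mean value formula for the second difference by \<open>h\<^sup>2\<close> and let \<open>h\<close> tend to 0, for both orders of
  differentiation.\<close>

lemma dir_deriv_commute:
  fixes f :: "'a::euclidean_space \<Rightarrow> real"
  assumes f: "C_diff 2 f"
  shows "dir_deriv v (dir_deriv w f) = dir_deriv w (dir_deriv v f)"
proof
  fix x
  have f1: "f differentiable (at x)" "dir_deriv u f differentiable (at x)" for x u
    using f by (auto simp: numeral_2_eq_2)
  have cont: "isCont (dir_deriv u (dir_deriv u' f)) x" for u u'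
    using f by (auto simp: numeral_2_eq_2 continuous_on_eq_continuous_at)
  define h where "h n = inverse (real (Suc n))" for n
  have h: "h n > 0" for n by (simp add: h_def)
  have h0: "h \<longlonglongrightarrow> 0" unfolding h_def by (rule LIMSEQ_inverse_real_of_nat)
  define \<Delta> where "\<Delta> u u' n = f (x + h n *\<^sub>R u + h n *\<^sub>R u') - f (x + h n *\<^sub>R u) - f (x + h n *\<^sub>R u') + f x" for u u' n
  have lim: "(\<lambda>n. \<Delta> u u' n / (h n * h n)) \<longlonglongrightarrow> dir_deriv u' (dir_deriv u f) x" for u u'
  proof -
    have "\<exists>s t. 0 < s \<and> s < h n \<and> 0 < t \<and> t < h n \<and>
        \<Delta> u u' n = h n * h n * dir_deriv u' (dir_deriv u f) (x + s *\<^sub>R u + t *\<^sub>R u')" for n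
    proof -
      obtain s t where st: "0 < s" "s < h n" "0 < t" "t < h n"
        "f (x + h n *\<^sub>R u + h n *\<^sub>R u') - f (x + h n *\<^sub>R u) - f (x + h n *\<^sub>R u') + f x
          = h n * h n * dir_deriv u' (dir_deriv u f) (x + s *\<^sub>R u + t *\<^sub>R u')"
        by (rule second_difference_mean_value[where f=f and v=u and w=u' and x=x and h="h n", OF f1 h])
      show ?thesis unfolding \<Delta>_def by (intro exI conjI) (fact st)+
    qed
    then obtain s t where st: "\<And>n. 0 < s n" "\<And>n. s n < h n" "\<And>n. 0 < t n" "\<And>n. t n < h n"
      "\<And>n. \<Delta> u u' n = h n * h n * dir_deriv u' (dir_deriv u f) (x + s n *\<^sub>R u + t n *\<^sub>R u')"
      by metis
    have s0: "s \<longlonglongrightarrow> 0"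
      by (rule tendsto_sandwich[OF _ _ tendsto_const h0]) (auto intro!: always_eventually less_imp_le st)
    have t0: "t \<longlonglongrightarrow> 0"
      by (rule tendsto_sandwich[OF _ _ tendsto_const h0]) (auto intro!: always_eventually less_imp_le st)
    have "(\<lambda>n. x + s n *\<^sub>R u + t n *\<^sub>R u') \<longlonglongrightarrow> x + 0 *\<^sub>R u + 0 *\<^sub>R u'"
      by (intro tendsto_intros s0 t0)
    then have "(\<lambda>n. dir_deriv u' (dir_deriv u f) (x + s n *\<^sub>R u + t n *\<^sub>R u')) \<longlonglongrightarrow> dir_deriv u' (dir_deriv u f) x"
      by (intro isCont_tendsto_compose[OF cont]) simp
    moreover have "\<Delta> u u' n / (h n * h n) = dir_deriv u' (dir_deriv u f) (x + s n *\<^sub>R u + t n *\<^sub>R u')" for n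
      using h[of n] by (simp add: st(5))
    ultimately show ?thesis by simp
  qed
  have "\<Delta> v w n = \<Delta> w v n" for n by (simp add: \<Delta>_def algebra_simps)
  then show "dir_deriv v (dir_deriv w f) x = dir_deriv w (dir_deriv v f) x"
    using LIMSEQ_unique[OF lim[of v w]] lim[of w v] by simp
qed

definition smooth :: "('a::euclidean_space \<Rightarrow> real) \<Rightarrow> bool" where
  "smooth \<phi> \<longleftrightarrow> (\<forall>k. C_diff k \<phi>)"

lemma smooth_dir_deriv: "smooth \<phi> \<Longrightarrow> smooth (dir_deriv v \<phi>)"
  unfolding smooth_def using C_diff.simps(2) by blast

lemma smooth_foldr_dir_deriv: "smooth \<phi> \<Longrightarrow> smooth (foldr dir_deriv bs \<phi>)"
  by (induction bs) (auto intro: smooth_dir_deriv)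

lemma foldr_dir_deriv_remove1:
  "smooth \<phi> \<Longrightarrow> b \<in> set bs \<Longrightarrow> foldr dir_deriv bs \<phi> = dir_deriv b (foldr dir_deriv (remove1 b bs) \<phi>)"
proof (induction bs)
  case (Cons a bs)
  show ?case
  proof (cases "a = b")
    case False
    then have "foldr dir_deriv (a # bs) \<phi> = dir_deriv a (dir_deriv b (foldr dir_deriv (remove1 b bs) \<phi>))"
      using Cons by simp
    also have "\<dots> = dir_deriv b (dir_deriv a (foldr dir_deriv (remove1 b bs) \<phi>))"
      using smooth_foldr_dir_deriv[OF Cons.prems(1)] by (intro dir_deriv_commute) (simp add: smooth_def)
    finally show ?thesis using False by simp
  qed simp
qed simp

lemma foldr_dir_deriv_perm:
  "smooth \<phi> \<Longrightarrow> mset bs = mset cs \<Longrightarrow> foldr dir_deriv bs \<phi> = foldr dir_deriv cs \<phi>"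
proof (induction bs arbitrary: cs)
  case (Cons b bs)
  have b: "b \<in> set cs" using Cons.prems(2) by (metis list.set_intros(1) mset_eq_setD)
  have "mset bs = mset (remove1 b cs)" using Cons.prems(2) by (metis mset_remove1 remove1.simps(2))
  then have "foldr dir_deriv bs \<phi> = foldr dir_deriv (remove1 b cs) \<phi>"
    by (rule Cons.IH[OF Cons.prems(1)])
  then show ?case using foldr_dir_deriv_remove1[OF Cons.prems(1) b] by simp
qed simp

section \<open>Bump functions\<close>

text \<open>The exponent \<open>k\<close> makes the family closed under differentiation up to linear
  combinations; \<open>flat 0\<close> is the standard smooth function that vanishes on the negative half-line.\<close>

definition flat :: "nat \<Rightarrow> real \<Rightarrow> real" where
  "flat k t = (if t > 0 then exp (- (1 / t)) / t ^ k else 0)"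

text \<open>From \<open>(u/n)^n \<le> exp u\<close> with \<open>u = 1/t\<close> and \<open>n = k + 2\<close>; it gives differentiability at 0.\<close>

lemma flat_le_square: "\<bar>flat k t\<bar> \<le> real (k + 2) ^ (k + 2) * t\<^sup>2"
proof (cases "t > 0")
  case t: True
  let ?n = "k + 2"
  have "((1 / t) / real ?n) ^ ?n \<le> (1 + (1 / t) / real ?n) ^ ?n" using t by (intro power_mono) auto
  also have "\<dots> \<le> exp (1 / t)" using t by (intro exp_ge_one_plus_x_over_n_power_n) (auto intro: order_trans[of _ 0])
  finally have "((1 / t) / real ?n) ^ ?n * (real ?n * t) ^ ?n \<le> exp (1 / t) * (real ?n * t) ^ ?n"
    using t by (intro mult_right_mono) auto
  also have "((1 / t) / real ?n) ^ ?n * (real ?n * t) ^ ?n = ((1 / t) / real ?n * (real ?n * t)) ^ ?n"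
    by (rule power_mult_distrib[symmetric])
  also have "(1 / t) / real ?n * (real ?n * t) = 1" using t by (simp del: of_nat_add)
  finally have "1 \<le> exp (1 / t) * (real ?n * t) ^ ?n" by simp
  then have "exp (- (1 / t)) \<le> (real ?n * t) ^ ?n" by (simp add: exp_minus inverse_eq_divide divide_le_eq mult.commute del: of_nat_add power_Suc)
  also have "\<dots> = real ?n ^ ?n * t\<^sup>2 * t ^ k" by (simp add: power_mult_distrib power_add power2_eq_square)
  finally show ?thesis using t by (simp add: flat_def divide_le_eq)
qed (simp add: flat_def)

lemma DERIV_flat: "(flat k has_real_derivative (flat (k + 2) t - real k * flat (k + 1) t)) (at t)"
proof (cases t "0::real" rule: linorder_cases)
  case less
  have "((\<lambda>_. 0) has_real_derivative 0) (at t)" by simp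
  then have "(flat k has_real_derivative 0) (at t)"
    by (rule has_field_derivative_transform_within_open[where S="{..<0}"]) (use less in \<open>auto simp: flat_def\<close>)
  then show ?thesis using less by (simp add: flat_def)
next
  case equal
  define C where "C = real (k + 2) ^ (k + 2)"
  have "((\<lambda>h. flat k h / h) \<longlongrightarrow> 0) (at 0)"
  proof (rule Lim_null_comparison)
    show "\<forall>\<^sub>F h in at 0. norm (flat k h / h) \<le> C * \<bar>h\<bar>"
    proof (intro always_eventually allI)
      fix h :: real
      show "norm (flat k h / h) \<le> C * \<bar>h\<bar>"
      proof (cases "h = 0")
        case False
        have "\<bar>flat k h\<bar> \<le> C * \<bar>h\<bar> * \<bar>h\<bar>"
          using flat_le_square[of k h] by (simp add: C_def power2_eq_square abs_mult[symmetric] mult.assoc)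
        then show ?thesis using False by (simp add: divide_le_eq)
      qed simp
    qed
    have "((\<lambda>h. C * \<bar>h\<bar>) \<longlongrightarrow> C * \<bar>0\<bar>) (at 0)" by (intro tendsto_intros)
    then show "((\<lambda>h. C * \<bar>h\<bar>) \<longlongrightarrow> 0) (at 0)" by simp
  qed
  then show ?thesis using equal by (simp add: DERIV_def flat_def)
next
  case greater
  have "((\<lambda>t. exp (- (1 / t)) / t ^ k) has_real_derivative
      exp (- (1 / t)) / t ^ (k + 2) - real k * (exp (- (1 / t)) / t ^ (k + 1))) (at t)"
  proof -
    have "((\<lambda>t. exp (- (1 / t))) has_real_derivative exp (- (1 / t)) / t\<^sup>2) (at t)"
      using greater by (auto intro!: derivative_eq_intros simp: power2_eq_square)
    from DERIV_divide[OF this DERIV_pow[of k t]]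
    have "((\<lambda>t. exp (- (1 / t)) / t ^ k) has_real_derivative
        (exp (- (1 / t)) / t\<^sup>2 * t ^ k - exp (- (1 / t)) * (real k * t ^ (k - Suc 0))) / (t ^ k * t ^ k)) (at t)"
      using greater by simp
    moreover have "(exp (- (1 / t)) / t\<^sup>2 * t ^ k - exp (- (1 / t)) * (real k * t ^ (k - Suc 0))) / (t ^ k * t ^ k)
        = exp (- (1 / t)) / t ^ (k + 2) - real k * (exp (- (1 / t)) / t ^ (k + 1))"
      using greater by (cases k) (auto simp: power2_eq_square field_simps)
    ultimately show ?thesis by simp
  qed
  then have "(flat k has_real_derivative
      exp (- (1 / t)) / t ^ (k + 2) - real k * (exp (- (1 / t)) / t ^ (k + 1))) (at t)"
    by (rule has_field_derivative_transform_within_open[where S="{0<..}"]) (use greater in \<open>auto simp: flat_def\<close>)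
  then show ?thesis using greater by (simp add: flat_def)
qed

lemma C_diff_flat_affine:
  fixes v :: "'a::euclidean_space"
  shows "C_diff n (\<lambda>x. flat k (x \<bullet> v + c))"
proof (induction n arbitrary: k)
  have der: "((\<lambda>x. flat k (x \<bullet> v + c)) has_derivative
      (\<lambda>w. (w \<bullet> v) * (flat (k + 2) (x \<bullet> v + c) - real k * flat (k + 1) (x \<bullet> v + c)))) (at x)" for k x
  proof -
    have 1: "((\<lambda>x. x \<bullet> v + c) has_derivative (\<lambda>w. w \<bullet> v)) (at x)"
      by (auto intro!: derivative_eq_intros)
    have "(flat k has_derivative (*) (flat (k + 2) (x \<bullet> v + c) - real k * flat (k + 1) (x \<bullet> v + c))) (at (x \<bullet> v + c))"
      using DERIV_flat[of k "x \<bullet> v + c"] by (simp add: has_field_derivative_def)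
    from has_derivative_compose[OF 1 this] show ?thesis by (simp add: mult.commute)
  qed
  then have dif: "(\<lambda>x. flat k (x \<bullet> v + c)) differentiable (at x)" for k x
    unfolding differentiable_def by blast
  {
    case 0
    show ?case using dif by (auto intro!: continuous_at_imp_continuous_on differentiable_imp_continuous_within)
  next
    case (Suc n)
    have "dir_deriv w (\<lambda>x. flat k (x \<bullet> v + c))
      = (\<lambda>x. (w \<bullet> v) * (flat (k + 2) (x \<bullet> v + c) + (- real k) * flat (k + 1) (x \<bullet> v + c)))" for w
      using dir_deriv_eqI[OF der] by (auto simp: fun_eq_iff)
    note dd = this
    show ?case
      unfolding C_diff.simps dd
      by (intro conjI allI dif C_diff_mult C_diff_add C_diff_const Suc)
  }
qed

text \<open>As \<open>n\<close> grows these functions converge to the indicator of \<open>box a b\<close>, so they can replace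
  mollified indicators.\<close>

definition bump :: "nat \<Rightarrow> 'a::euclidean_space \<Rightarrow> 'a \<Rightarrow> 'a \<Rightarrow> real" where
  "bump n a b x = (\<Prod>i\<in>Basis. flat 0 (real n * (x \<bullet> i - a \<bullet> i)) * flat 0 (real n * (b \<bullet> i - x \<bullet> i)))"

lemma flat_0_bounds: "0 \<le> flat 0 t" "flat 0 t \<le> 1"
  by (auto simp: flat_def)

lemma bump_bounds: "0 \<le> bump n a b x" "bump n a b x \<le> 1"
  unfolding bump_def by (auto intro!: prod_nonneg prod_le_1 mult_nonneg_nonneg mult_le_one flat_0_bounds)

lemma bump_outside_box: "x \<notin> box a b \<Longrightarrow> bump n a b x = 0"
proof -
  assume "x \<notin> box a b"
  then obtain i where i: "i \<in> Basis" "x \<bullet> i \<le> a \<bullet> i \<or> b \<bullet> i \<le> x \<bullet> i"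
    by (auto simp: box_def not_less)
  then have "real n * (x \<bullet> i - a \<bullet> i) \<le> 0 \<or> real n * (b \<bullet> i - x \<bullet> i) \<le> 0"
    by (auto intro!: mult_nonneg_nonpos)
  then have "flat 0 (real n * (x \<bullet> i - a \<bullet> i)) * flat 0 (real n * (b \<bullet> i - x \<bullet> i)) = 0"
    by (auto simp: flat_def)
  then show ?thesis using i(1) unfolding bump_def by (intro prod_zero) auto
qed

lemma bump_tendsto_indicator: "(\<lambda>n. bump n a b x) \<longlonglongrightarrow> indicat_real (box a b) x"
proof (cases "x \<in> box a b")
  case False
  then show ?thesis by (simp add: bump_outside_box)
next
  case True
  have lim: "(\<lambda>n. flat 0 (real n * d)) \<longlonglongrightarrow> 1" if "d > 0" for d
  proof -
    have "(\<lambda>n. exp (- (1 / d) * (1 / real n))) \<longlonglongrightarrow> exp (- (1 / d) * 0)"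
      by (intro tendsto_intros lim_1_over_n)
    moreover have "\<forall>\<^sub>F n in sequentially. exp (- (1 / d) * (1 / real n)) = flat 0 (real n * d)"
      using eventually_gt_at_top[of 0] by eventually_elim (use that in \<open>simp add: flat_def field_simps\<close>)
    ultimately show ?thesis by (simp add: tendsto_cong)
  qed
  have "(\<lambda>n. bump n a b x) \<longlonglongrightarrow> (\<Prod>i\<in>(Basis::'a set). 1 * 1)"
    unfolding bump_def by (intro tendsto_prod tendsto_mult lim) (use True in \<open>auto simp: box_def\<close>)
  then show ?thesis using True by simp
qed

lemma bump_test_function: "bump n a b \<in> test_functions"
proof -
  have "C_diff k (\<lambda>x. \<Prod>i\<in>Basis. flat 0 (real n * (x \<bullet> i - a \<bullet> i)) * flat 0 (real n * (b \<bullet> i - x \<bullet> i)))" for k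
  proof (intro C_diff_prod C_diff_mult)
    fix i
    show "C_diff k (\<lambda>x. flat 0 (real n * (x \<bullet> i - a \<bullet> i)))"
      using C_diff_flat_affine[of k 0 "real n *\<^sub>R i" "- real n * (a \<bullet> i)"] by (simp add: algebra_simps)
    show "C_diff k (\<lambda>x. flat 0 (real n * (b \<bullet> i - x \<bullet> i)))"
      using C_diff_flat_affine[of k 0 "- (real n *\<^sub>R i)" "real n * (b \<bullet> i)"] by (simp add: algebra_simps)
  qed simp
  then have "C_diff k (bump n a b)" for k unfolding bump_def[abs_def] .
  moreover have "compact (closure {x. bump n a b x \<noteq> 0})"
  proof -
    have "{x. bump n a b x \<noteq> 0} \<subseteq> cbox a b" using bump_outside_box box_subset_cbox by blast
    then show ?thesis by (meson bounded_cbox bounded_subset compact_closure)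
  qed
  ultimately show ?thesis by (simp add: test_functions_def)
qed

section \<open>Uniqueness and symmetry of weak derivatives\<close>

lemma L1_loc_diff: "f \<in> L1_loc \<Longrightarrow> g \<in> L1_loc \<Longrightarrow> (\<lambda>x. f x - g x) \<in> L1_loc"
  unfolding L1_loc_def by (auto intro: set_integral_diff(1))

lemma test_function_measurable: "\<phi> \<in> test_functions \<Longrightarrow> \<phi> \<in> borel_measurable borel"
  using C_diff_continuous[of 0 \<phi>] by (auto simp: test_functions_def intro: borel_measurable_continuous_onI)

lemma integrable_L1_loc_test:
  fixes u :: "'a::euclidean_space \<Rightarrow> real"
  assumes u: "u \<in> L1_loc" and \<phi>: "\<phi> \<in> test_functions"
  shows "integrable lebesgue (\<lambda>x. u x * \<phi> x)"
proof -
  define K where "K = closure {x. \<phi> x \<noteq> 0}"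
  have K: "compact K" using \<phi> by (simp add: K_def test_functions_def)
  have "continuous_on UNIV \<phi>" using \<phi> C_diff_continuous[of 0 \<phi>] by (auto simp: test_functions_def)
  then have "compact (\<phi> ` K)" by (intro compact_continuous_image K) (auto intro: continuous_on_subset)
  then obtain B where B: "\<And>x. x \<in> K \<Longrightarrow> \<bar>\<phi> x\<bar> \<le> B"
    using compact_imp_bounded bounded_iff by (metis imageI real_norm_def)
  have "u absolutely_integrable_on K" using u K by (simp add: L1_loc_def)
  then have int: "integrable lebesgue (\<lambda>x. B * (indicat_real K x *\<^sub>R u x))"
    unfolding set_integrable_def by (rule integrable_mult_right)
  show ?thesis
  proof (rule Bochner_Integration.integrable_bound[OF int])
    have "\<phi> \<in> borel_measurable lebesgue" using test_function_measurable[OF \<phi>] by (simp add: measurable_completion)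
    then show "(\<lambda>x. u x * \<phi> x) \<in> borel_measurable lebesgue" using L1_loc_measurable[OF u] by measurable
    show "AE x in lebesgue. norm (u x * \<phi> x) \<le> norm (B * (indicat_real K x *\<^sub>R u x))"
    proof (rule AE_I2)
      fix x
      show "norm (u x * \<phi> x) \<le> norm (B * (indicat_real K x *\<^sub>R u x))"
      proof (cases "x \<in> K")
        case True
        then have "\<bar>\<phi> x\<bar> \<le> \<bar>B\<bar>" using B[of x] by linarith
        then show ?thesis using True by (simp add: abs_mult mult.commute mult_right_mono)
      next
        case False
        then have "\<phi> x = 0" using closure_subset[of "{x. \<phi> x \<noteq> 0}"] by (auto simp: K_def)
        then show ?thesis by simp
      qed
    qed
  qed
qed

lemma integral_box_eq_0_if_test_integrals_eq_0:
  fixes u :: "'a::euclidean_space \<Rightarrow> real"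
  assumes u: "u \<in> L1_loc" and zero: "\<And>\<phi>. \<phi> \<in> test_functions \<Longrightarrow> (\<integral>x. u x * \<phi> x \<partial>lebesgue) = 0"
  shows "integrable lebesgue (\<lambda>x. u x * indicat_real (box a b) x)"
    "(\<integral>x. u x * indicat_real (box a b) x \<partial>lebesgue) = 0"
proof -
  have um: "u \<in> borel_measurable lebesgue" by (rule L1_loc_measurable[OF u])
  have "u absolutely_integrable_on cbox a b" using u by (simp add: L1_loc_def)
  then have w: "integrable lebesgue (\<lambda>x. norm (indicat_real (cbox a b) x *\<^sub>R u x))"
    unfolding set_integrable_def by (rule integrable_norm)
  have bm: "bump n a b \<in> borel_measurable lebesgue" for n
    by (rule measurable_completion) (use test_function_measurable[OF bump_test_function] in simp)
  have bx: "indicat_real (box a b) \<in> borel_measurable lebesgue"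
    by (intro borel_measurable_indicator) simp
  have m: "(\<lambda>x. u x * indicat_real (box a b) x) \<in> borel_measurable lebesgue"
    using um bx by (rule borel_measurable_times)
  have ms: "(\<lambda>x. u x * bump n a b x) \<in> borel_measurable lebesgue" for n
    using um bm by (rule borel_measurable_times)
  have lim: "AE x in lebesgue. (\<lambda>n. u x * bump n a b x) \<longlonglongrightarrow> u x * indicat_real (box a b) x"
    by (intro AE_I2 tendsto_mult tendsto_const bump_tendsto_indicator)
  have bnd: "AE x in lebesgue. norm (u x * bump n a b x) \<le> norm (indicat_real (cbox a b) x *\<^sub>R u x)" for n
  proof (rule AE_I2)
    fix x
    show "norm (u x * bump n a b x) \<le> norm (indicat_real (cbox a b) x *\<^sub>R u x)"
    proof (cases "x \<in> box a b")
      case True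
      then have "x \<in> cbox a b" using box_subset_cbox by blast
      then show ?thesis using bump_bounds[of n a b x] by (simp add: abs_mult mult_left_le)
    qed (simp add: bump_outside_box)
  qed
  show "integrable lebesgue (\<lambda>x. u x * indicat_real (box a b) x)"
    by (rule integrable_dominated_convergence[OF m ms w lim bnd])
  have "(\<lambda>n. \<integral>x. u x * bump n a b x \<partial>lebesgue) \<longlonglongrightarrow> (\<integral>x. u x * indicat_real (box a b) x \<partial>lebesgue)"
    by (rule integral_dominated_convergence[OF m ms w lim bnd])
  then show "(\<integral>x. u x * indicat_real (box a b) x \<partial>lebesgue) = 0"
    using zero[OF bump_test_function] LIMSEQ_unique[OF _ tendsto_const] by simp
qed

text \<open>The measures with densities \<open>v\<close> and \<open>- v\<close> (that is, with the positive and the negative part of \<open>v\<close>) agree on boxes, which generate the Borel sets.\<close>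

lemma AE_eq_0_if_box_integrals_eq_0:
  fixes v :: "'a::euclidean_space \<Rightarrow> real"
  assumes [measurable]: "v \<in> borel_measurable borel"
    and int: "\<And>a b. integrable lborel (\<lambda>x. v x * indicat_real (box a b) x)"
    and zero: "\<And>a b. (\<integral>x. v x * indicat_real (box a b) x \<partial>lborel) = 0"
  shows "AE x in lborel. v x = 0"
proof -
  define M where "M = density lborel (\<lambda>x. ennreal (v x))"
  define N where "N = density lborel (\<lambda>x. ennreal (- v x))"
  have M: "emeasure M (box a b) = (\<integral>\<^sup>+x. ennreal (v x * indicat_real (box a b) x) \<partial>lborel)" for a b
    unfolding M_def by (subst emeasure_density) (auto intro!: nn_integral_cong simp: indicator_def)
  have N: "emeasure N (box a b) = (\<integral>\<^sup>+x. ennreal (- (v x * indicat_real (box a b) x)) \<partial>lborel)" for a b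
    unfolding N_def by (subst emeasure_density) (auto intro!: nn_integral_cong simp: indicator_def)
  have fin: "emeasure M (box a b) \<noteq> \<infinity>" "emeasure N (box a b) \<noteq> \<infinity>" for a b
    unfolding M N using int[of a b] by (simp_all add: real_integrable_def)
  have eq: "emeasure M (box a b) = emeasure N (box a b)" for a b
  proof -
    have "enn2real (emeasure M (box a b)) - enn2real (emeasure N (box a b)) = 0"
      unfolding M N using real_lebesgue_integral_def[OF int[of a b]] zero[of a b] by simp
    then show ?thesis using fin[of a b] by (metis ennreal_enn2real_if eq_iff_diff_eq_0 infinity_ennreal_def)
  qed
  have "M = N"
  proof (rule measure_eqI_generator_eq)
    let ?E = "range (\<lambda>(a, b). box a b::'a set)"
    show "Int_stable ?E" by (auto simp: Int_stable_def box_Int_box)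
    show "?E \<subseteq> Pow UNIV" "sets M = sigma_sets UNIV ?E" "sets N = sigma_sets UNIV ?E"
      by (simp_all add: borel_eq_box M_def N_def)
    let ?A = "\<lambda>n::nat. box (- (real n *\<^sub>R One)) (real n *\<^sub>R One) :: 'a set"
    show "range ?A \<subseteq> ?E" "(\<Union>i. ?A i) = UNIV" unfolding UN_box_eq_UNIV by auto
    show "emeasure M (?A i) \<noteq> \<infinity>" for i by (rule fin)
    show "emeasure M X = emeasure N X" if "X \<in> ?E" for X using that eq by auto
  qed
  then have "AE x in lborel. ennreal (v x) = ennreal (- v x)"
    unfolding M_def N_def by (intro sigma_finite_measure.density_unique[OF lborel.sigma_finite_measure_axioms]) auto
  then show ?thesis
  proof eventually_elim
    case (elim x)
    then show ?case
      by (cases "v x" "0::real" rule: linorder_cases) (auto simp: ennreal_eq_0_iff ennreal_neg eq_commute[of 0])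
  qed
qed

text \<open>The fundamental lemma of the calculus of variations.\<close>

lemma AE_eq_0_if_test_integrals_eq_0:
  fixes u :: "'a::euclidean_space \<Rightarrow> real"
  assumes u: "u \<in> L1_loc" and zero: "\<And>\<phi>. \<phi> \<in> test_functions \<Longrightarrow> (\<integral>x. u x * \<phi> x \<partial>lebesgue) = 0"
  shows "AE x in lebesgue. u x = 0"
proof -
  obtain v where v [measurable]: "v \<in> borel_measurable borel" and uv: "AE x in lborel. u x = v x"
    using L1_loc_borel_version[OF u] .
  have um: "u \<in> borel_measurable lebesgue" by (rule L1_loc_measurable[OF u])
  have bx: "indicat_real (box a b) \<in> borel_measurable lebesgue" for a b :: 'a
    by (intro borel_measurable_indicator) simp
  have vm: "(\<lambda>x. v x * indicat_real (box a b) x) \<in> borel_measurable lborel" for a b by measurable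
  have ae: "AE x in lebesgue. u x * indicat_real (box a b) x = v x * indicat_real (box a b) x" for a b
    using AE_completion[OF uv] by eventually_elim simp
  have m1: "(\<lambda>x. u x * indicat_real (box a b) x) \<in> borel_measurable lebesgue" for a b
    using um bx by (rule borel_measurable_times)
  have m2: "(\<lambda>x. v x * indicat_real (box a b) x) \<in> borel_measurable lebesgue" for a b
    using vm by (rule measurable_completion)
  have "integrable lborel (\<lambda>x. v x * indicat_real (box a b) x)" for a b
    using integral_box_eq_0_if_test_integrals_eq_0(1)[OF u zero, of a b]
      integrable_cong_AE[OF m1 m2 ae, of a b] integrable_completion[OF vm, of a b] by simp
  moreover have "(\<integral>x. v x * indicat_real (box a b) x \<partial>lborel) = 0" for a b
    using integral_box_eq_0_if_test_integrals_eq_0(2)[OF u zero, of a b]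
      integral_cong_AE[OF m1 m2 ae, of a b] integral_completion[OF vm, of a b] by simp
  ultimately have "AE x in lborel. v x = 0" by (intro AE_eq_0_if_box_integrals_eq_0) auto
  with uv have "AE x in lborel. u x = 0" by eventually_elim simp
  then show ?thesis by (rule AE_completion)
qed

text \<open>Contains both the almost everywhere uniqueness of weak derivatives and their symmetry, since both derivatives are tested
  against the same derivative of \<open>\<phi>\<close>.\<close>

lemma weak_deriv_unique_perm:
  fixes f :: "'a::euclidean_space \<Rightarrow> real"
  assumes g: "has_weak_deriv bs f g" and h: "has_weak_deriv cs f h" and perm: "mset bs = mset cs"
  shows "AE x in lebesgue. g x = h x"
proof -
  have L: "g \<in> L1_loc" "h \<in> L1_loc" using g h by (auto simp: has_weak_deriv_def)
  have "AE x in lebesgue. g x - h x = 0"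
  proof (rule AE_eq_0_if_test_integrals_eq_0)
    show "(\<lambda>x. g x - h x) \<in> L1_loc" by (rule L1_loc_diff[OF L])
    fix \<phi> :: "'a \<Rightarrow> real" assume \<phi>: "\<phi> \<in> test_functions"
    then have "smooth \<phi>" by (simp add: smooth_def test_functions_def)
    then have foldr: "foldr dir_deriv bs \<phi> = foldr dir_deriv cs \<phi>" using perm by (rule foldr_dir_deriv_perm)
    have len: "length bs = length cs" using perm by (rule mset_eq_length)
    have "(-1) ^ length bs * (\<integral>x. g x * \<phi> x \<partial>lebesgue) = (\<integral>x. f x * foldr dir_deriv bs \<phi> x \<partial>lebesgue)"
      using g \<phi> by (simp add: has_weak_deriv_def)
    also have "\<dots> = (-1) ^ length bs * (\<integral>x. h x * \<phi> x \<partial>lebesgue)"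
      using h \<phi> unfolding foldr len by (simp add: has_weak_deriv_def)
    finally have "(-1) ^ length bs * (\<integral>x. g x * \<phi> x \<partial>lebesgue) = (-1) ^ length bs * (\<integral>x. h x * \<phi> x \<partial>lebesgue)" .
    then have "(\<integral>x. g x * \<phi> x \<partial>lebesgue) = (\<integral>x. h x * \<phi> x \<partial>lebesgue)" by simp
    then show "(\<integral>x. (g x - h x) * \<phi> x \<partial>lebesgue) = 0"
      using integrable_L1_loc_test[OF L(1) \<phi>] integrable_L1_loc_test[OF L(2) \<phi>]
      by (simp add: left_diff_distrib)
  qed
  then show ?thesis by eventually_elim simp
qed

lemma weak_partial_has_weak_deriv:
  assumes "f \<in> W1_loc k" "set bs \<subseteq> Basis" "length bs \<le> k"
  shows "has_weak_deriv bs f (weak_partial bs f)"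
proof -
  have "\<exists>g. has_weak_deriv bs f g" using assms unfolding W1_loc_def by blast
  then show ?thesis unfolding weak_partial_def by (rule someI_ex)
qed

lemma weak_partial_L1_loc:
  assumes "f \<in> W1_loc k" "set bs \<subseteq> Basis" "length bs \<le> k"
  shows "weak_partial bs f \<in> L1_loc"
  using weak_partial_has_weak_deriv[OF assms] by (simp add: has_weak_deriv_def)

section \<open>Polarisation and integer order\<close>

text \<open>Expand the product into a sum over all ways \<open>\<tau>\<close> to choose, for each factor \<open>j\<close>, either \<open>\<alpha> j\<close> (coded as \<open>\<tau> j = k\<close>)
  or some \<open>\<beta> i j\<close> with \<open>i \<in> S\<close>. A choice that misses an index \<open>i < k\<close> is counted with opposite signs for \<open>S\<close> and \<open>insert i S\<close>
  and cancels; the remaining choices are the permutations, which only occur for the full set \<open>S\<close>.\<close>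

lemma alternating_sum_prod_affine:
  fixes \<alpha> :: "nat \<Rightarrow> real" and \<beta> :: "nat \<Rightarrow> nat \<Rightarrow> real"
  shows "(\<Sum>S\<in>Pow {..<k}. (-1) ^ card S * (\<Prod>j<k. \<alpha> j + (\<Sum>i\<in>S. \<beta> i j)))
    = (-1) ^ k * (\<Sum>\<tau>\<in>{\<tau> \<in> {..<k} \<rightarrow>\<^sub>E {..<k}. bij_betw \<tau> {..<k} {..<k}}. \<Prod>j<k. \<beta> (\<tau> j) j)"
proof -
  define \<gamma> where "\<gamma> i j = (if i = k then \<alpha> j else \<beta> i j)" for i j
  define T where "T = ({..<k} \<rightarrow>\<^sub>E {..k} :: (nat \<Rightarrow> nat) set)"
  define B where "B = {\<tau> \<in> {..<k} \<rightarrow>\<^sub>E {..<k}. bij_betw \<tau> {..<k} {..<k}}"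
  define J where "J \<tau> S = (if \<tau> ` {..<k} \<subseteq> insert k S then 1 else 0 :: real)" for \<tau> :: "nat \<Rightarrow> nat" and S
  define P where "P \<tau> = (\<Prod>j<k. \<gamma> (\<tau> j) j)" for \<tau>
  have fT: "finite T" unfolding T_def by (intro finite_PiE) auto
  have expand: "(\<Prod>j<k. \<alpha> j + (\<Sum>i\<in>S. \<beta> i j)) = (\<Sum>\<tau>\<in>T. J \<tau> S * P \<tau>)" if S: "S \<subseteq> {..<k}" for S
  proof -
    have fS: "finite S" "k \<notin> S" using S finite_subset by auto
    have "\<alpha> j + (\<Sum>i\<in>S. \<beta> i j) = (\<Sum>i\<in>insert k S. \<gamma> i j)" for j
    proof -
      have "(\<Sum>i\<in>S. \<gamma> i j) = (\<Sum>i\<in>S. \<beta> i j)" using fS by (intro sum.cong) (auto simp: \<gamma>_def)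
      then show ?thesis using fS by (simp add: \<gamma>_def)
    qed
    then have "(\<Prod>j<k. \<alpha> j + (\<Sum>i\<in>S. \<beta> i j)) = (\<Prod>j<k. \<Sum>i\<in>insert k S. \<gamma> i j)" by simp
    also have "\<dots> = (\<Sum>\<tau>\<in>{..<k} \<rightarrow>\<^sub>E insert k S. P \<tau>)"
      unfolding P_def using fS by (intro prod_sum_PiE) auto
    also have "\<dots> = (\<Sum>\<tau>\<in>{..<k} \<rightarrow>\<^sub>E insert k S. J \<tau> S * P \<tau>)"
      by (intro sum.cong) (auto simp: J_def PiE_iff)
    also have "\<dots> = (\<Sum>\<tau>\<in>T. J \<tau> S * P \<tau>)"
    proof (rule sum.mono_neutral_left[OF fT])
      show "{..<k} \<rightarrow>\<^sub>E insert k S \<subseteq> T" unfolding T_def using S by (intro PiE_mono) auto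
      show "\<forall>\<tau>\<in>T - ({..<k} \<rightarrow>\<^sub>E insert k S). J \<tau> S * P \<tau> = 0"
        by (auto simp: T_def J_def PiE_iff image_subset_iff)
    qed
    finally show ?thesis .
  qed
  have inner: "(\<Sum>S\<in>Pow {..<k}. (-1) ^ card S * J \<tau> S) = (if \<tau> \<in> B then (-1) ^ k else 0)" if \<tau>: "\<tau> \<in> T" for \<tau>
  proof (cases "{..<k} \<subseteq> \<tau> ` {..<k}")
    case False
    then obtain i where i: "i < k" "i \<notin> \<tau> ` {..<k}" by auto
    have "(\<Sum>S\<in>Pow {..<k}. (-1) ^ card S * J \<tau> S) = 0"
    proof (rule alternating_sum_Pow_eq_0)
      show "i \<in> {..<k}" using i by simp
      show "J \<tau> (insert i S) = J \<tau> S" for S using i(2) by (auto simp: J_def)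
    qed simp
    moreover have "\<tau> \<notin> B" using False by (auto simp: B_def bij_betw_def)
    ultimately show ?thesis by simp
  next
    case True
    have "card (\<tau> ` {..<k}) \<le> card {..<k}" by (rule card_image_le) simp
    then have im: "\<tau> ` {..<k} = {..<k}" using card_seteq[OF _ True] by simp
    then have "inj_on \<tau> {..<k}" by (intro eq_card_imp_inj_on) auto
    then have bij: "bij_betw \<tau> {..<k} {..<k}" using im by (simp add: bij_betw_def)
    have "\<tau> \<in> {..<k} \<rightarrow>\<^sub>E {..<k}" using \<tau> im by (auto simp: T_def PiE_iff)
    then have "\<tau> \<in> B" using bij by (simp add: B_def)
    moreover have "(\<Sum>S\<in>Pow {..<k}. (-1) ^ card S * J \<tau> S) = (\<Sum>S\<in>{{..<k}}. (-1) ^ card S * J \<tau> S)"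
      by (rule sum.mono_neutral_right) (auto simp: J_def im)
    moreover have "(\<Sum>S\<in>{{..<k}}. (-1) ^ card S * J \<tau> S) = (-1) ^ k" by (auto simp: J_def im)
    ultimately show ?thesis by simp
  qed
  have "(\<Sum>S\<in>Pow {..<k}. (-1) ^ card S * (\<Prod>j<k. \<alpha> j + (\<Sum>i\<in>S. \<beta> i j)))
      = (\<Sum>S\<in>Pow {..<k}. \<Sum>\<tau>\<in>T. P \<tau> * ((-1) ^ card S * J \<tau> S))"
    by (intro sum.cong refl) (simp add: expand sum_distrib_left ac_simps)
  also have "\<dots> = (\<Sum>\<tau>\<in>T. P \<tau> * (\<Sum>S\<in>Pow {..<k}. (-1) ^ card S * J \<tau> S))"
    by (subst sum.swap) (simp add: sum_distrib_left)
  also have "\<dots> = (\<Sum>\<tau>\<in>T. P \<tau> * (if \<tau> \<in> B then (-1) ^ k else 0))"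
    by (intro sum.cong refl) (simp add: inner)
  also have "\<dots> = (\<Sum>\<tau>\<in>B. P \<tau> * (if \<tau> \<in> B then (-1) ^ k else 0))"
  proof (rule sum.mono_neutral_right[OF fT])
    have "({..<k} \<rightarrow>\<^sub>E {..<k}) \<subseteq> T" unfolding T_def by (rule PiE_mono) auto
    then show "B \<subseteq> T" unfolding B_def by auto
  qed auto
  also have "\<dots> = (-1) ^ k * (\<Sum>\<tau>\<in>B. P \<tau>)" by (simp add: sum_distrib_right mult.commute)
  also have "(\<Sum>\<tau>\<in>B. P \<tau>) = (\<Sum>\<tau>\<in>B. \<Prod>j<k. \<beta> (\<tau> j) j)"
  proof (intro sum.cong refl)
    fix \<tau> assume "\<tau> \<in> B"
    then have "\<tau> j < k" if "j < k" for j using that by (auto simp: B_def PiE_iff)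
    then show "P \<tau> = (\<Prod>j<k. \<beta> (\<tau> j) j)" unfolding P_def by (intro prod.cong) (auto simp: \<gamma>_def)
  qed
  finally show ?thesis unfolding B_def .
qed

definition basis_lists :: "nat \<Rightarrow> 'a::euclidean_space list set" where
  "basis_lists k = {bs. set bs \<subseteq> Basis \<and> length bs = k}"

lemma finite_basis_lists: "finite (basis_lists k :: 'a::euclidean_space list set)"
  unfolding basis_lists_def by (rule finite_lists_length_eq) simp

text \<open>The value at \<open>(\<xi>, \<dots>, \<xi>)\<close> of the \<open>k\<close>-linear form with coefficients \<open>g\<close>.\<close>

definition diag_form :: "nat \<Rightarrow> ('a::euclidean_space list \<Rightarrow> real) \<Rightarrow> 'a \<Rightarrow> real" where
  "diag_form k g \<xi> = (\<Sum>c\<in>basis_lists k. (\<Prod>j<k. \<xi> \<bullet> c ! j) * g c)"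

lemma diag_form_scaleR: "diag_form k g (r *\<^sub>R \<xi>) = r ^ k * diag_form k g \<xi>"
  by (simp add: diag_form_def prod.distrib sum_distrib_left mult.assoc)

lemma weak_D_replicate: "weak_D k f x (replicate k \<xi>) = diag_form k (\<lambda>c. weak_partial c f x) \<xi>"
  by (simp add: weak_D_def diag_form_def basis_lists_def)

text \<open>The identity for products gives the sum of the coefficients of all rearrangements of \<open>b\<close>, each of which equals
  \<open>g b\<close>. The number \<open>M\<close> counts the permutations. As for differences, the base point \<open>y\<close> is arbitrary, so all
  evaluation points can be moved into a prescribed set of positive measure.\<close>

lemma diag_form_polarization:
  fixes g :: "'a::euclidean_space list \<Rightarrow> real"
  assumes b: "b \<in> basis_lists k"
    and sym: "\<And>c c'. c \<in> basis_lists k \<Longrightarrow> c' \<in> basis_lists k \<Longrightarrow> mset c = mset c' \<Longrightarrow> g c = g c'"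
  obtains M :: nat where "M > 0" "\<And>y \<delta>.
    (\<Sum>S\<in>Pow {..<k}. (-1) ^ card S * diag_form k g (y + (\<Sum>i\<in>S. \<delta> *\<^sub>R b ! i))) = (-1) ^ k * real M * \<delta> ^ k * g b"
proof -
  define B where "B = {\<tau> \<in> {..<k} \<rightarrow>\<^sub>E {..<k}. bij_betw \<tau> {..<k} {..<k}}"
  define e where "e \<tau> = map (\<lambda>j. b ! \<tau> j) [0..<k]" for \<tau>
  have bB: "set b \<subseteq> Basis" "length b = k" using b by (auto simp: basis_lists_def)
  have fB: "finite B" unfolding B_def by (intro finite_subset[OF _ finite_PiE[of "{..<k}" "\<lambda>_. {..<k}"]]) auto
  have e: "e \<tau> \<in> basis_lists k" "g (e \<tau>) = g b" if "\<tau> \<in> B" for \<tau>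
  proof -
    have bij: "bij_betw \<tau> {..<k} {..<k}" using that by (simp add: B_def)
    then have lt: "\<tau> j < k" if "j < k" for j using that by (auto simp: bij_betw_def)
    show 1: "e \<tau> \<in> basis_lists k" using bB lt nth_mem by (fastforce simp: e_def basis_lists_def)
    have "mset (e \<tau>) = image_mset (\<lambda>j. b ! \<tau> j) (mset_set {..<k})"
      unfolding e_def by (simp add: atLeast0LessThan)
    also have "\<dots> = image_mset ((!) b) (image_mset \<tau> (mset_set {..<k}))"
      by (simp add: image_mset.compositionality comp_def)
    also have "image_mset \<tau> (mset_set {..<k}) = mset_set {..<k}"
      using bij by (simp add: bij_betw_def image_mset_mset_set)
    also have "image_mset ((!) b) (mset_set {..<k}) = mset b"
    proof -
      have "mset b = mset (map ((!) b) [0..<k])" using bB(2) map_nth[of b] by simp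
      then show ?thesis by (simp add: atLeast0LessThan)
    qed
    finally show "g (e \<tau>) = g b" using sym[OF 1 b] by simp
  qed
  have "restrict id {..<k} \<in> B" by (auto simp: B_def bij_betw_def inj_on_def)
  then have pos: "card B > 0" using fB card_gt_0_iff by blast
  have prod: "(\<Prod>j<k. \<delta> *\<^sub>R (b ! \<tau> j) \<bullet> c ! j) = (if c = e \<tau> then \<delta> ^ k else 0)"
    if \<tau>: "\<tau> \<in> B" and c: "c \<in> basis_lists k" for \<tau> c \<delta>
  proof (cases "c = e \<tau>")
    case True
    have "b ! \<tau> j \<in> Basis" if "j < k" for j
    proof -
      have "\<tau> j < k" using \<tau> that by (auto simp: B_def PiE_iff)
      then show ?thesis using bB nth_mem by blast
    qed
    then show ?thesis using True by (simp add: e_def)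
  next
    case False
    have l: "length c = k" "set c \<subseteq> Basis" using c by (auto simp: basis_lists_def)
    have "\<exists>j<k. c ! j \<noteq> b ! \<tau> j"
    proof (rule ccontr)
      assume "\<not> ?thesis"
      then have "c = e \<tau>" using l(1) by (intro nth_equalityI) (auto simp: e_def)
      then show False using False by simp
    qed
    then obtain j where j: "j < k" "c ! j \<noteq> b ! \<tau> j" by blast
    have "\<tau> j < k" using \<tau> j(1) by (auto simp: B_def PiE_iff)
    then have "b ! \<tau> j \<in> set b" "c ! j \<in> set c" using bB(2) l(1) j(1) by simp_all
    then have "b ! \<tau> j \<in> Basis" "c ! j \<in> Basis" using bB(1) l(2) by auto
    then have "\<delta> *\<^sub>R (b ! \<tau> j) \<bullet> c ! j = 0" using j(2) by (simp add: inner_Basis)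
    then show ?thesis using False j(1) by auto
  qed
  show thesis
  proof (rule that[OF pos])
    fix y :: 'a and \<delta> :: real
    have "(\<Sum>S\<in>Pow {..<k}. (-1) ^ card S * diag_form k g (y + (\<Sum>i\<in>S. \<delta> *\<^sub>R b ! i)))
      = (\<Sum>S\<in>Pow {..<k}. \<Sum>c\<in>basis_lists k.
          g c * ((-1) ^ card S * (\<Prod>j<k. y \<bullet> c ! j + (\<Sum>i\<in>S. \<delta> *\<^sub>R (b ! i) \<bullet> c ! j))))"
      by (simp add: diag_form_def sum_distrib_left inner_add_left inner_sum_left ac_simps)
    also have "\<dots> = (\<Sum>c\<in>basis_lists k. g c * (\<Sum>S\<in>Pow {..<k}.
          (-1) ^ card S * (\<Prod>j<k. y \<bullet> c ! j + (\<Sum>i\<in>S. \<delta> *\<^sub>R (b ! i) \<bullet> c ! j))))"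
      by (subst sum.swap) (simp only: sum_distrib_left)
    also have "\<dots> = (\<Sum>c\<in>basis_lists k. g c * ((-1) ^ k * (\<Sum>\<tau>\<in>B. \<Prod>j<k. \<delta> *\<^sub>R (b ! \<tau> j) \<bullet> c ! j)))"
    proof (rule sum.cong[OF refl])
      fix c
      show "g c * (\<Sum>S\<in>Pow {..<k}. (-1) ^ card S * (\<Prod>j<k. y \<bullet> c ! j + (\<Sum>i\<in>S. \<delta> *\<^sub>R (b ! i) \<bullet> c ! j)))
          = g c * ((-1) ^ k * (\<Sum>\<tau>\<in>B. \<Prod>j<k. \<delta> *\<^sub>R (b ! \<tau> j) \<bullet> c ! j))"
        unfolding B_def
        using alternating_sum_prod_affine[where k=k and \<alpha>="\<lambda>j. y \<bullet> c ! j"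
            and \<beta>="\<lambda>i j. \<delta> *\<^sub>R (b ! i) \<bullet> c ! j"] by (rule arg_cong)
    qed
    also have "\<dots> = (\<Sum>c\<in>basis_lists k. \<Sum>\<tau>\<in>B. (-1) ^ k * (if c = e \<tau> then \<delta> ^ k * g c else 0))"
    proof (rule sum.cong[OF refl])
      fix c :: "'a list" assume c: "c \<in> basis_lists k"
      show "g c * ((-1) ^ k * (\<Sum>\<tau>\<in>B. \<Prod>j<k. \<delta> *\<^sub>R (b ! \<tau> j) \<bullet> c ! j))
          = (\<Sum>\<tau>\<in>B. (-1) ^ k * (if c = e \<tau> then \<delta> ^ k * g c else 0))"
        unfolding sum_distrib_left by (rule sum.cong[OF refl]) (simp only: prod[OF _ c], simp)
    qed
    also have "\<dots> = (\<Sum>\<tau>\<in>B. (-1) ^ k * (\<Sum>c\<in>basis_lists k. if c = e \<tau> then \<delta> ^ k * g c else 0))"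
      by (subst sum.swap) (simp only: sum_distrib_left)
    also have "\<dots> = (\<Sum>\<tau>\<in>B. (-1) ^ k * (\<delta> ^ k * g b))"
      using e finite_basis_lists[where k=k and 'a='a] by (intro sum.cong refl) (simp add: sum.delta)
    also have "\<dots> = (-1) ^ k * real (card B) * \<delta> ^ k * g b" by simp
    finally show "(\<Sum>S\<in>Pow {..<k}. (-1) ^ card S * diag_form k g (y + (\<Sum>i\<in>S. \<delta> *\<^sub>R b ! i)))
      = (-1) ^ k * real (card B) * \<delta> ^ k * g b" .
  qed
qed

lemma abs_weak_D_le:
  assumes "length vs = k" "\<forall>v\<in>set vs. norm v \<le> 1"
  shows "\<bar>weak_D k f x vs\<bar> \<le> (\<Sum>c\<in>basis_lists k. \<bar>weak_partial c f x\<bar>)"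
proof -
  have "\<bar>weak_D k f x vs\<bar> \<le> (\<Sum>c\<in>basis_lists k. \<bar>(\<Prod>i<k. vs ! i \<bullet> c ! i) * weak_partial c f x\<bar>)"
    unfolding weak_D_def basis_lists_def by (rule sum_abs)
  also have "\<dots> \<le> (\<Sum>c\<in>basis_lists k. \<bar>weak_partial c f x\<bar>)"
  proof (rule sum_mono)
    fix c :: "'a list" assume c: "c \<in> basis_lists k"
    have "\<bar>\<Prod>i<k. vs ! i \<bullet> c ! i\<bar> \<le> 1"
      unfolding abs_prod
    proof (rule prod_le_1, rule conjI)
      fix i assume "i \<in> {..<k}"
      then have i: "vs ! i \<in> set vs" "c ! i \<in> Basis" using assms(1) c nth_mem by (auto simp: basis_lists_def)
      have "\<bar>vs ! i \<bullet> c ! i\<bar> \<le> norm (vs ! i)" by (rule Basis_le_norm[OF i(2)])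
      then show "\<bar>vs ! i \<bullet> c ! i\<bar> \<le> 1" using assms(2) i(1) by force
    qed simp
    then show "\<bar>(\<Prod>i<k. vs ! i \<bullet> c ! i) * weak_partial c f x\<bar> \<le> \<bar>weak_partial c f x\<bar>"
      unfolding abs_mult by (rule mult_left_le_one_le[OF abs_ge_zero abs_ge_zero])
  qed
  finally show ?thesis .
qed

lemma form_norm_weak_D_le: "form_norm k (weak_D k f x) \<le> (\<Sum>c\<in>basis_lists k. \<bar>weak_partial c f x\<bar>)"
proof -
  have "replicate k 0 \<in> {vs. length vs = k \<and> (\<forall>v\<in>set vs. norm v \<le> 1)}" by simp
  then have "{vs. length vs = k \<and> (\<forall>v\<in>set vs. norm v \<le> 1)} \<noteq> ({} :: 'a list set)" by blast
  then show ?thesis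
    unfolding form_norm_def using abs_weak_D_le by (intro cSUP_least) auto
qed

lemma abs_weak_D_le_form_norm:
  assumes "length vs = k" "\<forall>v\<in>set vs. norm v \<le> 1"
  shows "\<bar>weak_D k f x vs\<bar> \<le> form_norm k (weak_D k f x)"
  unfolding form_norm_def
proof (rule cSUP_upper)
  show "bdd_above ((\<lambda>vs. \<bar>weak_D k f x vs\<bar>) ` {vs. length vs = k \<and> (\<forall>v\<in>set vs. norm v \<le> 1)})"
    by (rule bdd_aboveI2[where M="\<Sum>c\<in>basis_lists k. \<bar>weak_partial c f x\<bar>"]) (auto intro: abs_weak_D_le)
qed (use assms in auto)

text \<open>Tonelli's theorem, after passing to Borel representatives of the finitely many coefficients.\<close>

lemma nn_integral_diag_form_measurable:
  fixes g :: "'a::euclidean_space list \<Rightarrow> 'b::euclidean_space \<Rightarrow> real"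
  assumes g: "\<And>c. c \<in> basis_lists k \<Longrightarrow> g c \<in> L1_loc"
  shows "(\<lambda>\<xi>. \<integral>\<^sup>+x. ennreal (\<bar>diag_form k (\<lambda>c. g c x) \<xi>\<bar> powr p) \<partial>lebesgue) \<in> borel_measurable borel"
proof -
  have "\<exists>v. v \<in> borel_measurable borel \<and> (c \<in> basis_lists k \<longrightarrow> (AE x in lborel. g c x = v x))" for c
  proof (cases "c \<in> basis_lists k")
    case True
    then show ?thesis using L1_loc_borel_version[OF g] by metis
  qed (auto intro: exI[of _ "\<lambda>_. 0"])
  then obtain v where v [measurable]: "\<And>c. v c \<in> borel_measurable borel"
    and gv: "\<And>c. c \<in> basis_lists k \<Longrightarrow> AE x in lborel. g c x = v c x" by metis
  have "AE x in lborel. \<forall>c\<in>basis_lists k. g c x = v c x"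
    by (intro AE_finite_allI finite_basis_lists gv)
  then have "(\<integral>\<^sup>+x. ennreal (\<bar>diag_form k (\<lambda>c. g c x) \<xi>\<bar> powr p) \<partial>lebesgue)
      = (\<integral>\<^sup>+x. ennreal (\<bar>diag_form k (\<lambda>c. v c x) \<xi>\<bar> powr p) \<partial>lborel)" for \<xi>
    unfolding nn_integral_completion
    by (intro nn_integral_cong_AE) (auto elim!: eventually_mono simp: diag_form_def)
  then show ?thesis unfolding diag_form_def by simp
qed

text \<open>If the energy is finite on a set \<open>E\<close> of positive measure, then for each list \<open>b\<close> of basis vectors some \<open>y\<close>
  puts all points \<open>y + (\<Sum>i\<in>S. \<delta> b\<^sub>i)\<close> into \<open>E\<close>, and polarisation bounds the \<open>L\<^sup>p\<close> norm of the partial derivative with index \<open>b\<close>.\<close>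

lemma finite_seminorm_iff_finite_affine_energy_int:
  fixes f :: "'a::euclidean_space \<Rightarrow> real"
  assumes dim: "DIM('a) \<ge> 2" and p: "p \<ge> 1" and k: "k \<ge> 1" and f: "f \<in> W1_loc k"
  shows "W_seminorm (real k) p f < \<infinity> \<longleftrightarrow> affine_energy (real k) p f < \<infinity>"
proof -
  define g where "g c = weak_partial c f" for c
  define I where "I \<xi> = (\<integral>\<^sup>+x. ennreal (\<bar>diag_form k (\<lambda>c. g c x) \<xi>\<bar> powr p) \<partial>lebesgue)" for \<xi>
  have dir: "direction_energy (real k) p f = I"
    unfolding direction_energy_def I_def g_def by (auto simp: weak_D_replicate)
  have gL: "g c \<in> L1_loc" if "c \<in> basis_lists k" for c
    unfolding g_def using that by (intro weak_partial_L1_loc[OF f]) (auto simp: basis_lists_def)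
  have gm: "g c \<in> borel_measurable lebesgue" if "c \<in> basis_lists k" for c
    by (rule L1_loc_measurable[OF gL[OF that]])
  have Im [measurable]: "I \<in> borel_measurable borel"
    unfolding I_def by (rule nn_integral_diag_form_measurable[OF gL])
  have hom: "I (r *\<^sub>R \<xi>) = ennreal ((r ^ k) powr p) * I \<xi>" if "r > 0" for r \<xi>
  proof -
    have dm: "(\<lambda>x. diag_form k (\<lambda>c. g c x) \<xi>) \<in> borel_measurable lebesgue"
      unfolding diag_form_def by (intro borel_measurable_sum borel_measurable_times borel_measurable_const gm)
    have "I (r *\<^sub>R \<xi>) = (\<integral>\<^sup>+x. ennreal ((r ^ k) powr p) * ennreal (\<bar>diag_form k (\<lambda>c. g c x) \<xi>\<bar> powr p) \<partial>lebesgue)"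
      unfolding I_def diag_form_scaleR using that by (simp add: abs_mult powr_mult ennreal_mult)
    also have "\<dots> = ennreal ((r ^ k) powr p) * I \<xi>"
      unfolding I_def using dm by (intro nn_integral_cmult) measurable
    finally show ?thesis .
  qed
  have homfin: "I \<xi> < \<infinity> \<longleftrightarrow> I (r *\<^sub>R \<xi>) < \<infinity>" if "r > 0" for r \<xi>
    using hom[OF that, of \<xi>] that by (auto simp: ennreal_mult_less_top)
  define E where "E = {x :: 'a. 1 < norm x \<and> norm x < 2 \<and> I x < \<infinity>}"
  have [measurable]: "E \<in> sets borel" unfolding E_def by measurable
  have aff: "affine_energy (real k) p f < \<infinity> \<longleftrightarrow> emeasure lborel E \<noteq> 0"
    using affine_integral_finite_iff[OF dim Im homfin,
        of "(real DIM('a) + real k * p) / (real DIM('a) * p)" "real DIM('a) / (real k * p)" "real k / real DIM('a)"]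
      k p unfolding affine_energy_def Let_def dir E_def by (simp add: add_pos_pos)
  have W: "W_seminorm (real k) p f < \<infinity> \<longleftrightarrow>
      (\<integral>\<^sup>+x. ennreal (form_norm k (weak_D k f x) powr p) \<partial>lebesgue) < \<infinity>"
    unfolding W_seminorm_def using p by (subst epow_less_top_iff) auto
  show ?thesis
    unfolding W aff
  proof
    assume fin: "(\<integral>\<^sup>+x. ennreal (form_norm k (weak_D k f x) powr p) \<partial>lebesgue) < \<infinity>"
    have "I \<xi> < \<infinity>" if "norm \<xi> \<le> 1" for \<xi>
    proof -
      have "I \<xi> \<le> (\<integral>\<^sup>+x. ennreal (form_norm k (weak_D k f x) powr p) \<partial>lebesgue)"
        unfolding I_def g_def weak_D_replicate[symmetric]
        using that p by (intro nn_integral_mono ennreal_leI powr_mono2 abs_weak_D_le_form_norm) auto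
      then show ?thesis using fin by simp
    qed
    then have "I \<xi> < \<infinity>" if "norm \<xi> < 2" for \<xi>
      using homfin[of "1/2" \<xi>] that by simp
    then have "E = {x. 1 < norm x \<and> norm x < 2}" by (auto simp: E_def)
    then have "annular_cone UNIV = E" by (auto simp: annular_cone_def)
    moreover have "emeasure lborel (annular_cone (UNIV :: 'a set)) \<noteq> 0"
    proof
      assume 0: "emeasure lborel (annular_cone (UNIV :: 'a set)) = 0"
      have "emeasure lborel (annular_cone (sphere 0 1 :: 'a set)) \<le> emeasure lborel (annular_cone (UNIV :: 'a set))"
        by (intro emeasure_mono annular_cone_mono) auto
      then have "hausdorff_outer (DIM('a) - 1) (sphere 0 1 :: 'a set) = 0"
        using 0 by (intro hausdorff_null_if_annular_cone_null) auto
      then show False using hausdorff_outer_sphere_pos[OF dim] by simp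
    qed
    ultimately show "emeasure lborel E \<noteq> 0" by simp
  next
    assume "emeasure lborel E \<noteq> 0"
    then have "\<exists>\<delta>>0. \<forall>T. finite T \<and> card T \<le> 2 ^ k \<and> T \<subseteq> ball 0 \<delta> \<longrightarrow> (\<exists>y. \<forall>h\<in>T. y + h \<in> E)"
      by (intro exists_common_translate) auto
    then obtain \<delta>\<^sub>0 where \<delta>\<^sub>0: "\<delta>\<^sub>0 > 0"
      "\<forall>T. finite T \<and> card T \<le> 2 ^ k \<and> T \<subseteq> ball 0 \<delta>\<^sub>0 \<longrightarrow> (\<exists>y. \<forall>h\<in>T. y + h \<in> E)"
      by (elim exE conjE) (rule that)
    \<comment> \<open>sums of at most \<open>k\<close> vectors of norm \<open>\<delta>\<close> stay in the ball of radius \<open>\<delta>\<^sub>0\<close>\<close>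
    define \<delta> where "\<delta> = \<delta>\<^sub>0 / (real k + 1)"
    have \<delta>: "\<delta> > 0" "real k * \<delta> < \<delta>\<^sub>0" using \<delta>\<^sub>0(1) by (auto simp: \<delta>_def field_simps)
    have "AE x in lebesgue. \<forall>c\<in>basis_lists k. \<forall>c'\<in>basis_lists k. mset c = mset c' \<longrightarrow> g c x = g c' x"
    proof (intro AE_finite_allI finite_basis_lists)
      fix c c' :: "'a list" assume c: "c \<in> basis_lists k" "c' \<in> basis_lists k"
      show "AE x in lebesgue. mset c = mset c' \<longrightarrow> g c x = g c' x"
      proof (cases "mset c = mset c'")
        case True
        have "AE x in lebesgue. g c x = g c' x"
          unfolding g_def using c
          by (intro weak_deriv_unique_perm[OF weak_partial_has_weak_deriv[OF f] weak_partial_has_weak_deriv[OF f] True])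
            (auto simp: basis_lists_def)
        then show ?thesis by eventually_elim simp
      qed simp
    qed
    then have sym: "AE x in lebesgue. \<forall>c c'. c \<in> basis_lists k \<longrightarrow> c' \<in> basis_lists k \<longrightarrow> mset c = mset c' \<longrightarrow> g c x = g c' x"
      by eventually_elim blast
    have gfin: "(\<integral>\<^sup>+x. ennreal (\<bar>g b x\<bar> powr p) \<partial>lebesgue) < \<infinity>" if b: "b \<in> basis_lists k" for b
    proof -
      define z where "z S = (\<Sum>i\<in>S. \<delta> *\<^sub>R b ! i)" for S
      have "card (z ` Pow {..<k}) \<le> 2 ^ k"
        using card_image_le[of "Pow {..<k}" z] by (simp add: card_Pow)
      moreover have "z ` Pow {..<k} \<subseteq> ball 0 \<delta>\<^sub>0"
      proof
        fix t assume "t \<in> z ` Pow {..<k}"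
        then obtain S where S: "S \<subseteq> {..<k}" "t = z S" by auto
        have "norm (z S) \<le> (\<Sum>i\<in>S. norm (\<delta> *\<^sub>R b ! i))" unfolding z_def by (rule norm_sum)
        also have "\<dots> \<le> (\<Sum>i\<in>S. \<delta>)"
        proof (rule sum_mono)
          fix i assume "i \<in> S"
          then have "b ! i \<in> Basis" using S b nth_mem by (auto simp: basis_lists_def)
          then show "norm (\<delta> *\<^sub>R b ! i) \<le> \<delta>" using \<delta> by simp
        qed
        also have "\<dots> \<le> real k * \<delta>" using card_mono[OF _ S(1)] \<delta> by (simp add: mult_right_mono)
        finally show "t \<in> ball 0 \<delta>\<^sub>0" using \<delta> S by simp
      qed
      ultimately have "\<exists>y. \<forall>h\<in>z ` Pow {..<k}. y + h \<in> E"
        using \<delta>\<^sub>0(2)[rule_format, of "z ` Pow {..<k}"] by simp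
      then obtain y where y: "\<And>S. S \<subseteq> {..<k} \<Longrightarrow> I (y + z S) < \<infinity>" by (auto simp: E_def)
      define C where "C = (2 ^ k) powr p * (inverse \<delta> ^ k) powr p"
      have bound: "AE x in lebesgue. ennreal (\<bar>g b x\<bar> powr p)
          \<le> ennreal C * (\<Sum>S\<in>Pow {..<k}. ennreal (\<bar>diag_form k (\<lambda>c. g c x) (y + z S)\<bar> powr p))"
        using sym
      proof eventually_elim
        case (elim x)
        define D where "D S = diag_form k (\<lambda>c. g c x) (y + z S)" for S
        obtain M :: nat where M: "M > 0" "\<And>y \<delta>.
            (\<Sum>S\<in>Pow {..<k}. (-1) ^ card S * diag_form k (\<lambda>c. g c x) (y + (\<Sum>i\<in>S. \<delta> *\<^sub>R b ! i)))
              = (-1) ^ k * real M * \<delta> ^ k * g b x"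
          by (rule diag_form_polarization[OF b, of "\<lambda>c. g c x"]) (use elim in blast)+
        have "\<bar>g b x\<bar> * \<delta> ^ k \<le> real M * \<delta> ^ k * \<bar>g b x\<bar>"
          using M(1) \<delta> mult_right_mono[of 1 "real M" "\<delta> ^ k * \<bar>g b x\<bar>"] by (simp add: mult.commute mult.assoc)
        also have "\<dots> = \<bar>\<Sum>S\<in>Pow {..<k}. (-1) ^ card S * D S\<bar>"
          unfolding D_def z_def M(2) using \<delta> by (simp add: abs_mult power_abs)
        finally have "\<bar>g b x\<bar> \<le> inverse \<delta> ^ k * \<bar>\<Sum>S\<in>Pow {..<k}. (-1) ^ card S * D S\<bar>"
          using \<delta> by (simp add: field_simps)
        then have "\<bar>g b x\<bar> powr p \<le> (inverse \<delta> ^ k * \<bar>\<Sum>S\<in>Pow {..<k}. (-1) ^ card S * D S\<bar>) powr p"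
          using p by (intro powr_mono2) auto
        also have "\<dots> = (inverse \<delta> ^ k) powr p * \<bar>\<Sum>S\<in>Pow {..<k}. (-1) ^ card S * D S\<bar> powr p"
          using \<delta> by (simp add: powr_mult)
        also have "\<dots> \<le> (inverse \<delta> ^ k) powr p * ((2 ^ k) powr p * (\<Sum>S\<in>Pow {..<k}. \<bar>D S\<bar> powr p))"
          using powr_abs_sum_le[of "Pow {..<k}" p "\<lambda>S. (-1) ^ card S * D S"] p
          by (intro mult_left_mono) (auto simp: card_Pow abs_mult)
        finally have "ennreal (\<bar>g b x\<bar> powr p) \<le> ennreal (C * (\<Sum>S\<in>Pow {..<k}. \<bar>D S\<bar> powr p))"
          by (intro ennreal_leI) (simp add: C_def ac_simps)
        then show ?case by (simp add: ennreal_mult sum_nonneg C_def D_def)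
      qed
      have dm: "(\<lambda>x. ennreal (\<bar>diag_form k (\<lambda>c. g c x) \<xi>\<bar> powr p)) \<in> borel_measurable lebesgue" for \<xi>
      proof -
        have "(\<lambda>x. diag_form k (\<lambda>c. g c x) \<xi>) \<in> borel_measurable lebesgue"
          unfolding diag_form_def by (intro borel_measurable_sum borel_measurable_times borel_measurable_const gm)
        then show ?thesis by measurable
      qed
      have "(\<integral>\<^sup>+x. ennreal (\<bar>g b x\<bar> powr p) \<partial>lebesgue)
          \<le> (\<integral>\<^sup>+x. ennreal C * (\<Sum>S\<in>Pow {..<k}. ennreal (\<bar>diag_form k (\<lambda>c. g c x) (y + z S)\<bar> powr p)) \<partial>lebesgue)"
        by (rule nn_integral_mono_AE[OF bound])
      also have "\<dots> = ennreal C * (\<Sum>S\<in>Pow {..<k}. I (y + z S))"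
        unfolding I_def using dm
        by (subst nn_integral_cmult) (auto simp: nn_integral_sum simp del: sum_ennreal intro!: borel_measurable_sum)
      also have "\<dots> < \<infinity>" using y by (auto simp: ennreal_mult_less_top)
      finally show ?thesis .
    qed
    define n where "n = real (card (basis_lists k :: 'a list set)) powr p"
    have "(\<integral>\<^sup>+x. ennreal (form_norm k (weak_D k f x) powr p) \<partial>lebesgue)
        \<le> (\<integral>\<^sup>+x. ennreal n * (\<Sum>c\<in>basis_lists k. ennreal (\<bar>g c x\<bar> powr p)) \<partial>lebesgue)"
    proof (rule nn_integral_mono)
      fix x
      have "0 \<le> form_norm k (weak_D k f x)"
        using abs_weak_D_le_form_norm[of "replicate k 0" k f x] by (simp add: order_trans[OF abs_ge_zero])
      then have "form_norm k (weak_D k f x) powr p \<le> \<bar>\<Sum>c\<in>basis_lists k. \<bar>g c x\<bar>\<bar> powr p"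
        using form_norm_weak_D_le[of k f x] p by (intro powr_mono2) (auto simp: g_def)
      also have "\<dots> \<le> n * (\<Sum>c\<in>basis_lists k. \<bar>g c x\<bar> powr p)"
        using powr_abs_sum_le[of "basis_lists k" p "\<lambda>c. \<bar>g c x\<bar>"] finite_basis_lists[where k=k and 'a='a] p by (simp add: n_def)
      finally show "ennreal (form_norm k (weak_D k f x) powr p) \<le> ennreal n * (\<Sum>c\<in>basis_lists k. ennreal (\<bar>g c x\<bar> powr p))"
        by (simp add: ennreal_mult[symmetric] sum_nonneg n_def ennreal_leI)
    qed
    also have "\<dots> = ennreal n * (\<Sum>c\<in>basis_lists k. \<integral>\<^sup>+x. ennreal (\<bar>g c x\<bar> powr p) \<partial>lebesgue)"
    proof -
      have m: "(\<lambda>x. ennreal (\<bar>g c x\<bar> powr p)) \<in> borel_measurable lebesgue" if "c \<in> basis_lists k" for c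
        using gm[OF that] by measurable
      then show ?thesis
        by (subst nn_integral_cmult) (auto simp: nn_integral_sum simp del: sum_ennreal intro!: borel_measurable_sum)
    qed
    also have "\<dots> < \<infinity>" using gfin finite_basis_lists[where k=k and 'a='a] by (auto simp: ennreal_mult_less_top)
    finally show "(\<integral>\<^sup>+x. ennreal (form_norm k (weak_D k f x) powr p) \<partial>lebesgue) < \<infinity>" .
  qed
qed

theorem theorem1p5:
  fixes p :: real
  assumes "CARD('n::finite) \<ge> 2" and "1 \<le> p"
  shows "(\<forall>s::real. s > 0 \<and> s \<notin> \<int> \<longrightarrow>
            (\<forall>f :: real ^ 'n \<Rightarrow> real. f \<in> L1_loc \<longrightarrow>
               (W_seminorm s p f < \<infinity> \<longleftrightarrow> affine_energy s p f < \<infinity>)))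
       \<and> (\<forall>s::nat. s \<ge> 1 \<longrightarrow>
            (\<forall>f :: real ^ 'n \<Rightarrow> real. f \<in> W1_loc s \<longrightarrow>
               (W_seminorm (real s) p f < \<infinity> \<longleftrightarrow> affine_energy (real s) p f < \<infinity>)))"
proof (intro conjI allI impI)
  have dim: "DIM(real ^ 'n) \<ge> 2" using assms(1) by simp
  show "W_seminorm s p f < \<infinity> \<longleftrightarrow> affine_energy s p f < \<infinity>"
    if "s > 0 \<and> s \<notin> \<int>" "f \<in> L1_loc" for s :: real and f :: "real ^ 'n \<Rightarrow> real"
    using finite_seminorm_iff_finite_affine_energy_nonint[OF dim assms(2)] that by blast
  show "W_seminorm (real s) p f < \<infinity> \<longleftrightarrow> affine_energy (real s) p f < \<infinity>"
    if "s \<ge> 1" "f \<in> W1_loc s" for s :: nat and f :: "real ^ 'n \<Rightarrow> real"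
    by (rule finite_seminorm_iff_finite_affine_energy_int[OF dim assms(2) that])
qed

end
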